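(* Let $\mathbb{K}$ be a field of characteristic $0$, let $S=\mathbb{K}[x_1,x_2,x_3,x_4]$, and let $I=\langle l_1^t,\ldots,l_n^t\rangle\subseteq S$ with $l_1,\ldots,l_n\in S_1$ generic linear forms. Then $S/I$ fails to have the Weak Lefschetz Property in each of the following cases: $n=5$ and $t\ge 3$; $n=6$ and $t\ge 27$; $n=7$ and $t\ge 140$; $n=8$ and $t\ge 704$.
   Context: $S$ has the standard grading. For a homogeneous ideal $I\subseteq S$ with $A=S/I$ Artinian, $A$ has the Weak Lefschetz Property (WLP) if there is a linear form $\ell\in S_1$ such that for all $m$ the multiplication map $\mu_\ell:A_m\xrightarrow{\ \cdot\ell\ }A_{m+1}$ is injective or surjective. A statement about generic linear forms $l_1,\ldots,l_n$ means that (for the given $n$ and $t$) it holds for all tuples in some nonempty Zariski-open subset of $(S_1)^n$. *)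

theory Defs
  imports
    "HOL-Library.Poly_Mapping"
    "HOL-Library.Numeral_Type"
    "HOL-Algebra.QuotRing"
    "HOL-Algebra.Algebraic_Closure_Type"
begin

text \<open>
  A polynomial is a finitely supported map from monomials to coefficients, a monomial being the
  finitely supported map from variables to exponents; multiplication is the convolution product
  supplied by \<^theory>\<open>HOL-Library.Poly_Mapping\<close>.
\<close>

type_synonym ('v, 'a) mpoly = "('v \<Rightarrow>\<^sub>0 nat) \<Rightarrow>\<^sub>0 'a"

abbreviation mpoly_ring :: "('v, 'a::comm_ring_1) mpoly ring"
  where "mpoly_ring \<equiv> ring_of_type_algebra"

definition monom_degree :: "('v \<Rightarrow>\<^sub>0 nat) \<Rightarrow> nat"
  where "monom_degree m = (\<Sum>v\<in>Poly_Mapping.keys m. Poly_Mapping.lookup m v)"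

text \<open>The graded piece \<open>S\<^sub>d\<close>; it contains the zero polynomial.\<close>

definition homogeneous_part :: "nat \<Rightarrow> ('v, 'a::comm_ring_1) mpoly set"
  where "homogeneous_part d = {p. \<forall>m\<in>Poly_Mapping.keys p. monom_degree m = d}"

definition poly_eval :: "('v \<Rightarrow> 'a) \<Rightarrow> ('v, 'a::comm_ring_1) mpoly \<Rightarrow> 'a"
  where "poly_eval c p =
    (\<Sum>m\<in>Poly_Mapping.keys p. Poly_Mapping.lookup p m *
      (\<Prod>v\<in>Poly_Mapping.keys m. c v ^ Poly_Mapping.lookup m v))"

locale artinian_ring = ring +
  assumes descending_chain_condition:
    "\<lbrakk>\<And>k::nat. ideal (C k) R; \<And>k. C (Suc k) \<subseteq> C k\<rbrakk> \<Longrightarrow> \<exists>N. \<forall>k\<ge>N. C k = C N"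

text \<open>
  For a homogeneous ideal \<open>I\<close> of \<open>S\<close>, the degree \<open>d\<close> piece of \<open>A = S/I\<close>, as a set of cosets: the
  image of \<open>S\<^sub>d\<close> under the quotient map.
\<close>

definition quot_part :: "('v, 'a::comm_ring_1) mpoly set \<Rightarrow> nat \<Rightarrow> ('v, 'a) mpoly set set"
  where "quot_part I d = (\<lambda>p. I +>\<^bsub>mpoly_ring\<^esub> p) ` homogeneous_part d"

definition mult_map ::
    "('v, 'a::comm_ring_1) mpoly set \<Rightarrow> ('v, 'a) mpoly \<Rightarrow> ('v, 'a) mpoly set \<Rightarrow> ('v, 'a) mpoly set"
  where "mult_map I h a = (I +>\<^bsub>mpoly_ring\<^esub> h) \<otimes>\<^bsub>mpoly_ring Quot I\<^esub> a"

text \<open>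
  The Weak Lefschetz Property of \<open>S/I\<close>. The standing assumption that \<open>S/I\<close> is Artinian is not part
  of this predicate, so that its negation is a statement about multiplication maps only.
\<close>

definition weak_lefschetz :: "('v, 'a::comm_ring_1) mpoly set \<Rightarrow> bool"
  where "weak_lefschetz I \<longleftrightarrow>
    (\<exists>h\<in>homogeneous_part 1. \<forall>m.
      inj_on (mult_map I h) (quot_part I m) \<or>
      mult_map I h ` quot_part I m = quot_part I (Suc m))"

text \<open>
  \<open>(S\<^sub>1)\<^sup>n\<close> as functions on \<open>{..<n}\<close>, extended by \<open>undefined\<close>. Its Zariski topology is that of affine
  space, the coordinate indexed by \<open>(i, v)\<close> being the coefficient of the variable \<open>v\<close> in the \<open>i\<close>-th
  form. An open set is the complement of the common zero set of a set of polynomials in these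
  coordinates.
\<close>

definition linear_form_tuples :: "nat \<Rightarrow> (nat \<Rightarrow> ('v, 'a::comm_ring_1) mpoly) set"
  where "linear_form_tuples n = {..<n} \<rightarrow>\<^sub>E homogeneous_part 1"

definition tuple_coords :: "(nat \<Rightarrow> ('v, 'a::comm_ring_1) mpoly) \<Rightarrow> nat \<times> 'v \<Rightarrow> 'a"
  where "tuple_coords l = (\<lambda>(i, v). Poly_Mapping.lookup (l i) (Poly_Mapping.single v 1))"

definition zariski_open :: "nat \<Rightarrow> (nat \<Rightarrow> ('v, 'a::comm_ring_1) mpoly) set \<Rightarrow> bool"
  where "zariski_open n U \<longleftrightarrow>
    (\<exists>P :: (nat \<times> 'v, 'a) mpoly set.
      (\<forall>p\<in>P. \<forall>m\<in>Poly_Mapping.keys p. Poly_Mapping.keys m \<subseteq> {..<n} \<times> UNIV) \<and>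
      U = {l \<in> linear_form_tuples n. \<exists>p\<in>P. poly_eval (tuple_coords l) p \<noteq> 0})"

definition power_ideal :: "nat \<Rightarrow> nat \<Rightarrow> (nat \<Rightarrow> ('v, 'a::comm_ring_1) mpoly) \<Rightarrow> ('v, 'a) mpoly set"
  where "power_ideal n t l = Idl\<^bsub>mpoly_ring\<^esub> {l i ^ t | i. i < n}"

end

(* Let k be such that M = t + k - 1 satisfies the inequalities below. Both injectivity and surjectivity of
   multiplication by h from degree M - 1 to degree M fail, for every linear form h.

   By apolarity, the cokernel of this multiplication is dual to the space K of forms F of degree M with
   D_h F = 0 and D_{l_i}^t F = 0 for all i. As D_h F = 0 makes F a form in three variables, K consists of the
   plane curves of degree M with multiplicity at least k at the n images of the points l_i under projection
   from h (Emsalem and Iarrobino). Such curves are E^s G, where E is a product of curves of negative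
   self-intersection (in generic position) that a dimension count provides, and where G ranges over a linear
   system whose dimension is bounded below by counting conditions. These counts hold for arbitrary points, so
   h need not be generic: K is nonzero, which refutes surjectivity.

   For generic l_i the powers l_i^t have no syzygies in degree M, so the dimensions of the degree M - 1 and M
   parts of the ideal are known; if multiplication by h were injective, K would have dimension smaller than
   the one found. Absence of syzygies is an open condition, so it suffices to see it for points on the moment
   curve: a hyperplane meets the curve in any three prescribed points, and M derivatives in such hyperplane
   directions can be chosen to kill all terms l_j^t g_j but one. *)

theory Submission
  imports Defs "Jordan_Normal_Form.Determinant"
begin

text \<open>The benchmark is the expected dimension
  \<open>(M+2 choose 2) - n (k+1 choose 2)\<close>: injectivity would push the dimension of K down
  to it. The excess that refutes this comes from the plane blown up at n points. There, for general
  points, the curves whose product is E have self-intersection -1 and do not meet one another, and G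
  has intersection number 0 with each, because d / \<nu> is the sum of the multiplicities of such a
  curve divided by its degree. So E^s G meets each of them in -s, and each contributes (s choose 2)
  to the excess; this is why s \<ge> 2 is arranged. For n = 6, 7, 8, contracting these curves gives
  another plane in which G is a curve of degree e: d^2 - n \<nu>^2 = 1 and 3 d - n \<nu> = 3, so the
  count for G is exactly (e+2 choose 2). As t = M - k + 1 = (c - \<mu>) s + (d - \<nu>) e + 1, the
  exponents reached are a translate of a numerical semigroup, whence lower bounds on t. The geometry
  only guides the choice of numbers; the formal argument counts conditions.\<close>

section \<open>Dimension inequalities for finitely spanned subspaces\<close>

context vector_space
begin

text \<open>The polynomial ring is infinite-dimensional, and \<open>dim\<close> takes the value 0 on
  subspaces without a finite basis. A finite spanning set \<open>W\<close> therefore accompanies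
  every comparison of dimensions below; for graded pieces it is the set of monomials.\<close>

lemma obtain_finite_basis:
  assumes "subspace V" "V \<subseteq> span W" "finite W"
  obtains B where "B \<subseteq> V" "independent B" "span B = V" "finite B" "card B = dim V"
proof -
  obtain B where B: "B \<subseteq> V" "independent B" "V \<subseteq> span B" "card B = dim V"
    using basis_exists by blast
  have "finite B"
    using independent_span_bound[OF assms(3) B(2)] B(1) assms(2) by auto
  moreover have "span B = V"
    using B assms(1) span_minimal by (metis subset_antisym)
  ultimately show thesis using that B by blast
qed

lemma independent_card_le_dim_finite:
  assumes "V \<subseteq> span W" "finite W" "B \<subseteq> V" "independent B"
  shows "finite B \<and> card B \<le> dim V"
proof -
  obtain C where C: "C \<subseteq> V" "independent C" "V \<subseteq> span C" "card C = dim V"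
    using basis_exists by blast
  have "finite C"
    using independent_span_bound[OF assms(2) C(2)] C(1) assms(1) by auto
  then show ?thesis
    using independent_span_bound[of C B] C assms by auto
qed

lemma dim_mono_finite:
  assumes "V \<subseteq> span W" "finite W" "U \<subseteq> V"
  shows "dim U \<le> dim V"
proof -
  obtain B where B: "B \<subseteq> U" "independent B" "U \<subseteq> span B" "card B = dim U"
    using basis_exists by blast
  then show ?thesis
    using independent_card_le_dim_finite[OF assms(1,2), of B] assms(3) by auto
qed

text \<open>Rank and nullity of a projection \<open>\<pi>\<close> along \<open>A\<close>, restricted
  to \<open>B\<close>: its kernel there is \<open>A \<inter> B\<close>, and its image lies in the
  complement of \<open>A\<close> in the sum that is spanned by \<open>ac - a\<close>.\<close>

lemma dim_sum_Int_le:
  assumes A: "subspace A" and B: "subspace B"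
    and W: "A \<subseteq> span W" "B \<subseteq> span W" "finite W"
  shows "dim A + dim B \<le> dim {x + y |x y. x \<in> A \<and> y \<in> B} + dim (A \<inter> B)"
proof -
  let ?S = "{x + y |x y. x \<in> A \<and> y \<in> B}"
  have S: "subspace ?S" using subspace_sums[OF A B] .
  have SW: "?S \<subseteq> span W" using W by (auto intro: span_add)
  have AS: "A \<subseteq> ?S" using subspace_0[OF B] by force
  have BS: "B \<subseteq> ?S" using subspace_0[OF A] by force
  obtain a where a: "a \<subseteq> A" "independent a" "span a = A" "finite a" "card a = dim A"
    using obtain_finite_basis[OF A W(1,3)] .
  obtain ac where ac: "a \<subseteq> ac" "ac \<subseteq> ?S" "independent ac" "?S \<subseteq> span ac"
    using maximal_independent_subset_extend[of a ?S] a AS by blast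
  have fac: "finite ac" "card ac = dim ?S"
    using independent_card_le_dim_finite[OF SW W(3) ac(2,3)] basis_card_eq_dim[OF ac(2,4,3)] by auto
  interpret p: vector_space_pair scale scale by unfold_locales
  obtain \<pi> where \<pi>: "Vector_Spaces.linear scale scale \<pi>" "\<forall>x\<in>ac. \<pi> x = (if x \<in> a then 0 else x)"
    using p.linear_independent_extend[OF ac(3), of "\<lambda>x. if x \<in> a then 0 else x"] by blast
  interpret pi: Vector_Spaces.linear scale scale \<pi> by fact
  obtain d where d: "d \<subseteq> A \<inter> B" "independent d" "span d = A \<inter> B" "finite d" "card d = dim (A \<inter> B)"
    using obtain_finite_basis[OF subspace_inter[OF A B] le_infI1[OF W(1)] W(3)] .
  have split: "\<exists>y z. x = y + z \<and> y \<in> A \<and> z \<in> span (ac - a) \<and> \<pi> x = z" if "x \<in> span ac" for x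
  proof -
    have "ac = a \<union> (ac - a)" using ac by auto
    then have "x \<in> {u + v |u v. u \<in> span a \<and> v \<in> span (ac - a)}"
      using that span_Un[of a "ac - a"] by simp
    then obtain y z where yz: "x = y + z" "y \<in> span a" "z \<in> span (ac - a)" by auto
    have "\<pi> y = 0"
      using p.linear_eq_0_on_span[OF \<pi>(1) _ yz(2)] \<pi>(2) ac(1) by (metis subsetD)
    moreover have "\<pi> z = z"
      using p.linear_eq_on[OF \<pi>(1) linear_id yz(3)] \<pi>(2) by auto
    ultimately have "\<pi> x = z" using yz(1) pi.add by simp
    then show ?thesis using yz a by auto
  qed
  obtain c where c: "c \<subseteq> \<pi> ` B" "independent c" "span c = \<pi> ` B" "finite c" "card c = dim (\<pi> ` B)"
  proof (rule obtain_finite_basis[of "\<pi> ` B" "ac - a"])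
    show "subspace (\<pi> ` B)" using p.linear_subspace_image[OF \<pi>(1) B] .
    show "\<pi> ` B \<subseteq> span (ac - a)" using split BS ac(4) by fastforce
  qed (use fac in auto)
  have "\<pi> ` B \<subseteq> span (ac - a)" using split BS ac(4) by fastforce
  then have cac: "card c \<le> card (ac - a)"
    using c(5) dim_le_card[of "\<pi> ` B" "ac - a"] fac by auto
  have "\<forall>y\<in>c. \<exists>x\<in>B. \<pi> x = y" using c(1) by auto
  then obtain s where s: "\<And>y. y \<in> c \<Longrightarrow> s y \<in> B" "\<And>y. y \<in> c \<Longrightarrow> \<pi> (s y) = y" by metis
  have "B \<subseteq> span (d \<union> s ` c)"
  proof
    fix x assume x: "x \<in> B"
    then have "\<pi> x \<in> span c" using c(3) by auto
    moreover have "c = \<pi> ` (s ` c)" using s by force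
    ultimately have "\<pi> x \<in> \<pi> ` span (s ` c)"
      using p.linear_span_image[OF \<pi>(1)] by metis
    then obtain u where u: "u \<in> span (s ` c)" "\<pi> x = \<pi> u" by auto
    have uB: "u \<in> B" using u(1) s(1) span_minimal[OF _ B] by blast
    have xu: "x - u \<in> B" using x uB B subspace_diff by blast
    have "\<pi> (x - u) = 0" using u(2) pi.diff by simp
    then have "x - u \<in> A" using split[of "x - u"] xu BS ac(4) by auto
    then have "x - u \<in> span d" using xu d(3) by blast
    then have "x - u \<in> span (d \<union> s ` c)" "u \<in> span (d \<union> s ` c)"
      using u(1) span_mono[of d "d \<union> s ` c"] span_mono[of "s ` c" "d \<union> s ` c"] by auto
    then show "x \<in> span (d \<union> s ` c)" using span_add[of "x - u" _ u] by simp
  qed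
  then have "dim B \<le> card (d \<union> s ` c)" using dim_le_card d(4) c(4) by blast
  also have "\<dots> \<le> card d + card c"
    using card_Un_le[of d "s ` c"] card_image_le[OF c(4), of s] by linarith
  finally have "dim B \<le> dim (A \<inter> B) + card (ac - a)" using cac d(5) by linarith
  moreover have "card (ac - a) = dim ?S - dim A" "dim A \<le> dim ?S"
    using card_Diff_subset[of a ac] a ac fac card_mono[of ac a] by auto
  ultimately show ?thesis by linarith
qed

text \<open>The hypothesis on \<open>b\<close> says that every linear functional on \<open>V\<close> is represented by \<open>b\<close>.\<close>
lemma dim_orthogonal_le:
  assumes V: "subspace V" "V \<subseteq> span B0" "finite B0"
    and Y: "subspace Y" "Y \<subseteq> V" and W: "subspace W" "W \<subseteq> V"
    and b_lin: "\<And>x. Vector_Spaces.linear scale (*) (\<lambda>g. b g x)"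
    and perp: "\<And>w x. w \<in> W \<Longrightarrow> x \<in> Y \<Longrightarrow> b w x = 0"
    and repr: "\<And>\<theta>. Vector_Spaces.linear scale (*) \<theta> \<Longrightarrow> \<exists>g\<in>V. \<forall>F\<in>V. b g F = \<theta> F"
  shows "dim Y + dim W \<le> dim V"
proof -
  obtain C where C: "C \<subseteq> Y" "independent C" "span C = Y" "finite C" "card C = dim Y"
    using obtain_finite_basis[OF Y(1) subset_trans[OF Y(2) V(2)] V(3)] .
  interpret p: vector_space_pair scale "(*)" by unfold_locales (auto simp: algebra_simps)
  \<comment> \<open>The vectors \<open>g x\<close> are dual to the basis \<open>C\<close> of
    \<open>Y\<close>. The coefficients of a vector in their span are its values on \<open>C\<close>,
    which are 0 for vectors of \<open>W\<close>; so the span, of dimension \<open>dim Y\<close>,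
    meets \<open>W\<close> only in 0.\<close>
  have "\<exists>g\<in>V. \<forall>y\<in>C. b g y = (if y = x then 1 else 0)" for x
  proof -
    obtain \<theta> where "Vector_Spaces.linear scale (*) \<theta>" "\<forall>y\<in>C. \<theta> y = (if y = x then 1 else 0)"
      using p.linear_independent_extend[OF C(2), of "\<lambda>y. if y = x then 1 else 0"] by blast
    then show ?thesis using repr[of \<theta>] C(1) Y(2) by (metis subset_iff)
  qed
  then obtain g where g: "\<And>x. g x \<in> V" "\<And>x y. y \<in> C \<Longrightarrow> b (g x) y = (if y = x then 1 else 0)"
    by metis
  have b_sum: "b (\<Sum>x\<in>C. scale (f x) (g x)) y = f y" if "y \<in> C" for f y
  proof -
    interpret l: Vector_Spaces.linear scale "(*)" "\<lambda>g. b g y" by (rule b_lin)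
    show ?thesis using that g(2) C(4) by (simp add: l.sum l.scale eq_commute[of y] if_distrib[of "(*) _"] cong: if_cong)
  qed
  have inj: "inj_on g C" by (rule inj_onI) (metis g(2) zero_neq_one)
  have ind: "independent (g ` C)"
  proof (rule independent_if_scalars_zero)
    fix f x assume "(\<Sum>x\<in>g ` C. scale (f x) x) = 0" "x \<in> g ` C"
    then obtain y where y: "y \<in> C" "x = g y" "(\<Sum>x\<in>C. scale (f (g x)) (g x)) = 0"
      using inj by (auto simp: sum.reindex)
    interpret l: Vector_Spaces.linear scale "(*)" "\<lambda>g. b g y" by (rule b_lin)
    show "f x = 0" using b_sum[OF y(1), of "\<lambda>x. f (g x)"] y l.zero by simp
  qed (use C in auto)
  let ?G = "span (g ` C)"
  have dG: "dim ?G = dim Y"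
    using dim_span_eq_card_independent[OF ind] card_image[OF inj] C(5) by simp
  have GV: "?G \<subseteq> V" using g(1) span_minimal[OF _ V(1)] by blast
  have "z = 0" if z: "z \<in> W" "z \<in> ?G" for z
  proof -
    obtain f where "z = (\<Sum>x\<in>g ` C. scale (f x) x)"
      using z(2) span_finite[of "g ` C"] C(4) by auto
    then have f: "z = (\<Sum>x\<in>C. scale (f (g x)) (g x))" using inj by (simp add: sum.reindex)
    have "f (g y) = 0" if "y \<in> C" for y
      using b_sum[OF that, of "\<lambda>x. f (g x)"] perp[OF z(1), of y] that C(1) f by auto
    then show ?thesis using f by simp
  qed
  then have "W \<inter> ?G \<subseteq> {0}" by auto
  then have "dim (W \<inter> ?G) = 0"
    using dim_le_card[of "W \<inter> ?G" "{}"] by (simp add: span_empty)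
  moreover have "{x + y |x y. x \<in> W \<and> y \<in> ?G} \<subseteq> V"
    using GV W(2) V(1) subspace_add by blast
  ultimately show ?thesis
    using dim_sum_Int_le[OF W(1) subspace_span, of B0 "g ` C"] W(2) GV V dG
      dim_mono_finite[OF V(2,3), of "{x + y |x y. x \<in> W \<and> y \<in> ?G}"] by fastforce
qed

end

lemma (in vector_space_pair) dim_le_dim_image_kernel:
  assumes f: "Vector_Spaces.linear s1 s2 f" and V: "vs1.subspace V" "V \<subseteq> vs1.span W" "finite W"
  shows "vs1.dim V \<le> vs2.dim (f ` V) + vs1.dim {v \<in> V. f v = 0}"
proof -
  interpret f: Vector_Spaces.linear s1 s2 f by fact
  have "{v \<in> V. f v = 0} = V \<inter> {v. f v = 0}" by auto
  then have K: "vs1.subspace {v \<in> V. f v = 0}"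
    using vs1.subspace_inter[OF V(1) linear_subspace_kernel[OF f]] by simp
  obtain d where d: "d \<subseteq> {v \<in> V. f v = 0}" "vs1.span d = {v \<in> V. f v = 0}" "finite d"
      "card d = vs1.dim {v \<in> V. f v = 0}"
    using vs1.obtain_finite_basis[OF K subset_trans[OF Collect_restrict V(2)] V(3)] .
  have "f ` V \<subseteq> f ` vs1.span W" using V by auto
  then have "f ` V \<subseteq> vs2.span (f ` W)" using linear_span_image[OF f] by simp
  then obtain c where c: "c \<subseteq> f ` V" "vs2.span c = f ` V" "finite c" "card c = vs2.dim (f ` V)"
    using vs2.obtain_finite_basis[OF linear_subspace_image[OF f V(1)], of "f ` W" thesis] finite_imageI[OF V(3)] by metis
  have "\<forall>y\<in>c. \<exists>x\<in>V. f x = y" using c(1) by auto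
  then obtain s where s: "\<And>y. y \<in> c \<Longrightarrow> s y \<in> V" "\<And>y. y \<in> c \<Longrightarrow> f (s y) = y" by metis
  have "V \<subseteq> vs1.span (d \<union> s ` c)"
  proof
    fix x assume x: "x \<in> V"
    then have "f x \<in> vs2.span c" using c(2) by auto
    moreover have "c = f ` (s ` c)" using s by force
    ultimately have "f x \<in> f ` vs1.span (s ` c)"
      using linear_span_image[OF f] by metis
    then obtain u where u: "u \<in> vs1.span (s ` c)" "f x = f u" by auto
    have "u \<in> V" using u(1) s(1) vs1.span_minimal[OF _ V(1)] by blast
    then have "x - u \<in> vs1.span d"
      using d(2) x V(1) vs1.subspace_diff u(2) f.diff by auto
    then have "x - u \<in> vs1.span (d \<union> s ` c)" "u \<in> vs1.span (d \<union> s ` c)"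
      using u(1) vs1.span_mono[of d "d \<union> s ` c"] vs1.span_mono[of "s ` c" "d \<union> s ` c"] by auto
    then show "x \<in> vs1.span (d \<union> s ` c)" using vs1.span_add[of "x - u" _ u] by simp
  qed
  then have "vs1.dim V \<le> card (d \<union> s ` c)" using vs1.dim_le_card d(3) c(3) by blast
  also have "\<dots> \<le> card d + card c"
    using card_Un_le[of d "s ` c"] card_image_le[OF c(3), of s] by linarith
  finally show ?thesis using c(4) d(4) by linarith
qed

section \<open>Polynomials as a vector space, monomials and graded pieces\<close>

lemma mpoly_sum_single: "p = (\<Sum>m\<in>Poly_Mapping.keys p. Poly_Mapping.single m (Poly_Mapping.lookup p m))"
proof (rule poly_mapping_eqI)
  fix k
  show "Poly_Mapping.lookup p k =
    Poly_Mapping.lookup (\<Sum>m\<in>Poly_Mapping.keys p. Poly_Mapping.single m (Poly_Mapping.lookup p m)) k"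
  proof (cases "k \<in> Poly_Mapping.keys p")
    case True
    then show ?thesis
      by (simp add: lookup_sum lookup_single when_def)
  next
    case False
    then have "Poly_Mapping.lookup p k = 0" by (simp add: in_keys_iff)
    then show ?thesis using False
      by (simp add: lookup_sum lookup_single when_def)
  qed
qed

lemma mpoly_additive_eqI:
  fixes f g :: "('b \<Rightarrow>\<^sub>0 'c::comm_monoid_add) \<Rightarrow> 'd::comm_monoid_add"
  assumes "f 0 = 0" "g 0 = 0" "\<And>p q. f (p + q) = f p + f q" "\<And>p q. g (p + q) = g p + g q"
    and "\<And>m a. f (Poly_Mapping.single m a) = g (Poly_Mapping.single m a)"
  shows "f p = g p"
proof -
  have *: "h (sum s A) = (\<Sum>x\<in>A. h (s x))"
    if "h 0 = 0" "\<And>p q. h (p + q) = h p + h q" for h :: "('b \<Rightarrow>\<^sub>0 'c) \<Rightarrow> 'd" and s and A :: "'b set"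
    using that by (induction A rule: infinite_finite_induct) auto
  show ?thesis
    by (subst (1 2) mpoly_sum_single) (simp add: *[of f] *[of g] assms)
qed

definition cmul :: "'a \<Rightarrow> ('v, 'a::comm_ring_1) mpoly \<Rightarrow> ('v, 'a) mpoly"
  where "cmul c p = Poly_Mapping.single 0 c * p"

lemma lookup_cmul [simp]: "Poly_Mapping.lookup (cmul c p) m = c * Poly_Mapping.lookup p m"
  unfolding cmul_def mult_map_scale_conv_mult[symmetric]
  by (simp add: Poly_Mapping.map.rep_eq when_def)

lemma mult_cmul_right: "p * cmul c q = cmul c (p * q)"
  by (simp add: cmul_def algebra_simps)

lemma mult_cmul_left: "cmul c p * q = cmul c (p * q)"
  by (simp add: cmul_def algebra_simps)

lemma cmul_sum: "cmul c (sum f A) = (\<Sum>x\<in>A. cmul c (f x))"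
  by (simp add: cmul_def sum_distrib_left)

lemma cmul_add: "cmul c (p + q) = cmul c p + cmul c q"
  by (simp add: cmul_def distrib_left)

interpretation mp: vector_space "cmul :: 'a::field \<Rightarrow> ('v, 'a) mpoly \<Rightarrow> ('v, 'a) mpoly"
proof
  fix a b :: 'a and x y :: "('v, 'a) mpoly"
  show "cmul a (cmul b x) = cmul (a * b) x"
    by (simp add: cmul_def mult.assoc[symmetric] mult_single)
qed (simp_all add: cmul_def algebra_simps single_add)

interpretation mpp: vector_space_pair "cmul :: 'a::field \<Rightarrow> ('v, 'a) mpoly \<Rightarrow> ('v, 'a) mpoly"
  "cmul :: 'a::field \<Rightarrow> ('w, 'a) mpoly \<Rightarrow> ('w, 'a) mpoly"
  by unfold_locales

lemma linear_cmulI: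
  fixes f :: "('v, 'a::field) mpoly \<Rightarrow> ('w, 'a) mpoly"
  assumes "\<And>p q. f (p + q) = f p + f q" "\<And>c p. f (cmul c p) = cmul c (f p)"
  shows "Vector_Spaces.linear cmul cmul f"
  using assms by unfold_locales auto

definition var :: "'v \<Rightarrow> ('v, 'a::comm_ring_1) mpoly"
  where "var v = Poly_Mapping.single (Poly_Mapping.single v 1) 1"

definition monoms :: "nat \<Rightarrow> ('v \<Rightarrow>\<^sub>0 nat) set"
  where "monoms d = {m. monom_degree m = d}"

lemma homogeneous_part_iff: "p \<in> homogeneous_part d \<longleftrightarrow> Poly_Mapping.keys p \<subseteq> monoms d"
  by (auto simp: homogeneous_part_def monoms_def)

lemma monom_degree_eq: "monom_degree m = (\<Sum>v\<in>UNIV. Poly_Mapping.lookup m (v::'v::finite))"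
  unfolding monom_degree_def by (rule sum.mono_neutral_left) (auto simp: in_keys_iff)

lemma monom_degree_add: "monom_degree (m + m') = monom_degree m + monom_degree (m' :: 'v::finite \<Rightarrow>\<^sub>0 nat)"
  by (simp add: monom_degree_eq lookup_add sum.distrib)

lemma monom_degree_single [simp]: "monom_degree (Poly_Mapping.single v k) = k"
  by (simp add: monom_degree_def)

lemma monom_degree_zero [simp]: "monom_degree 0 = 0"
  by (simp add: monom_degree_def)

lemma monom_degree_0_iff: "monom_degree m = 0 \<longleftrightarrow> m = (0 :: 'v::finite \<Rightarrow>\<^sub>0 nat)"
  by (auto simp: monom_degree_eq intro: poly_mapping_eqI)

lemma monom_split: "Poly_Mapping.lookup m v > 0 \<Longrightarrow>
    m = (m - Poly_Mapping.single v 1) + Poly_Mapping.single v (1::nat)"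
  by (rule poly_mapping_eqI) (auto simp: lookup_add lookup_minus lookup_single when_def)

text \<open>Stars and bars: the exponents read along an enumeration \<open>vs\<close> of the
  variables are the lists of length \<open>CARD('v)\<close> with sum \<open>d\<close>.\<close>

lemma card_monoms: "finite (monoms d :: ('v::finite \<Rightarrow>\<^sub>0 nat) set) \<and>
   card (monoms d :: ('v::finite \<Rightarrow>\<^sub>0 nat) set) = (d + CARD('v) - 1) choose d"
proof -
  obtain vs :: "'v list" where vs: "set vs = UNIV" "distinct vs"
    using finite_distinct_list[of "UNIV :: 'v set"] by auto
  have len: "length vs = CARD('v)" using vs distinct_card by fastforce
  let ?f = "\<lambda>m :: 'v \<Rightarrow>\<^sub>0 nat. map (Poly_Mapping.lookup m) vs"
  have "bij_betw ?f (monoms d) {l. length l = CARD('v) \<and> sum_list l = d}"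
  proof (rule bij_betw_imageI)
    show "inj_on ?f (monoms d)"
    proof (rule inj_onI)
      fix m m' assume "?f m = ?f m'"
      then show "m = m'" using vs(1) by (auto intro!: poly_mapping_eqI)
    qed
    have deg: "sum_list (?f m) = monom_degree m" for m
      using vs by (simp add: monom_degree_eq sum_list_distinct_conv_sum_set)
    show "?f ` monoms d = {l. length l = CARD('v) \<and> sum_list l = d}"
    proof (intro equalityI subsetI)
      fix l :: "nat list" assume l: "l \<in> {l. length l = CARD('v) \<and> sum_list l = d}"
      define m where "m = Abs_poly_mapping (\<lambda>v. case map_of (zip vs l) v of None \<Rightarrow> 0 | Some x \<Rightarrow> x)"
      have lm: "Poly_Mapping.lookup m = (\<lambda>v. case map_of (zip vs l) v of None \<Rightarrow> 0 | Some x \<Rightarrow> x)"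
        unfolding m_def by (rule Abs_poly_mapping_inverse) simp
      have "?f m = l"
      proof (rule nth_equalityI)
        fix i assume "i < length (?f m)"
        then show "?f m ! i = l ! i"
          using l len vs(2) by (simp add: lm map_of_zip_nth)
      qed (use l len in auto)
      then show "l \<in> ?f ` monoms d"
        using deg[of m] l by (auto simp: monoms_def intro!: image_eqI[of _ _ m])
    qed (auto simp: deg len monoms_def)
  qed
  moreover have "finite {l :: nat list. length l = CARD('v) \<and> sum_list l = d}"
  proof (rule finite_subset)
    show "{l :: nat list. length l = CARD('v) \<and> sum_list l = d} \<subseteq> {l. set l \<subseteq> {..d} \<and> length l = CARD('v)}"
      using member_le_sum_list by fastforce
  qed (simp add: finite_lists_length_eq)
  ultimately show ?thesis
    using bij_betw_same_card bij_betw_finite card_length_sum_list[of "CARD('v)" d] by fastforce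
qed

lemma finite_monoms [simp]: "finite (monoms d :: ('v::finite \<Rightarrow>\<^sub>0 nat) set)"
  using card_monoms by blast

lemma homogeneous_zero [simp]: "0 \<in> homogeneous_part d"
  by (simp add: homogeneous_part_iff)

lemma homogeneous_add: "p \<in> homogeneous_part d \<Longrightarrow> q \<in> homogeneous_part d \<Longrightarrow> p + q \<in> homogeneous_part d"
  using keys_add[of p q] by (auto simp: homogeneous_part_iff)

lemma homogeneous_cmul: "p \<in> homogeneous_part d \<Longrightarrow> cmul c p \<in> homogeneous_part d"
  by (auto simp: homogeneous_part_def in_keys_iff)

lemma homogeneous_sum: "(\<And>x. x \<in> A \<Longrightarrow> f x \<in> homogeneous_part d) \<Longrightarrow> sum f A \<in> homogeneous_part d"
  by (induction A rule: infinite_finite_induct) (auto intro: homogeneous_add)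

lemma homogeneous_mult:
  fixes p q :: "('v::finite, 'a::comm_ring_1) mpoly"
  assumes "p \<in> homogeneous_part d" "q \<in> homogeneous_part e"
  shows "p * q \<in> homogeneous_part (d + e)"
  using assms keys_mult[of p q] by (fastforce simp: homogeneous_part_def monom_degree_add)

lemma homogeneous_one: "(1 :: ('v::finite, 'a::comm_ring_1) mpoly) \<in> homogeneous_part 0"
  by (auto simp: homogeneous_part_def in_keys_iff lookup_one when_def)

lemma homogeneous_power:
  fixes p :: "('v::finite, 'a::comm_ring_1) mpoly"
  shows "p \<in> homogeneous_part d \<Longrightarrow> p ^ n \<in> homogeneous_part (n * d)"
  by (induction n) (auto intro: homogeneous_mult homogeneous_one)

lemma homogeneous_single: "monom_degree m = d \<Longrightarrow> Poly_Mapping.single m a \<in> homogeneous_part d"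
  by (auto simp: homogeneous_part_def in_keys_iff lookup_single when_def)

lemma homogeneous_var: "var v \<in> homogeneous_part 1"
  by (auto simp: var_def intro!: homogeneous_single)

lemma subspace_homogeneous: "mp.subspace (homogeneous_part d :: ('v, 'a::field) mpoly set)"
  by (auto simp: mp.subspace_def intro: homogeneous_add homogeneous_cmul)

abbreviation monomial :: "('v \<Rightarrow>\<^sub>0 nat) \<Rightarrow> ('v, 'a::comm_ring_1) mpoly"
  where "monomial m \<equiv> Poly_Mapping.single m 1"

lemma sum_cmul_monomial: "finite A \<Longrightarrow> Poly_Mapping.keys p \<subseteq> A \<Longrightarrow>
    p = (\<Sum>m\<in>A. cmul (Poly_Mapping.lookup p m) (monomial m))"
  by (rule poly_mapping_eqI)
    (auto simp: lookup_sum lookup_single when_def in_keys_iff if_distrib[of "(*) _"] cong: if_cong)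

lemma homogeneous_subset_span:
  "(homogeneous_part d :: ('v::finite, 'a::field) mpoly set) \<subseteq> mp.span (monomial ` monoms d)"
proof
  fix p :: "('v, 'a) mpoly" assume "p \<in> homogeneous_part d"
  then have "p = (\<Sum>m\<in>monoms d. cmul (Poly_Mapping.lookup p m) (monomial m))"
    by (intro sum_cmul_monomial) (auto simp: homogeneous_part_iff)
  also have "\<dots> \<in> mp.span (monomial ` monoms d)"
    by (intro mp.span_sum mp.span_scale mp.span_base) auto
  finally show "p \<in> mp.span (monomial ` monoms d)" .
qed

lemma inj_monomial: "inj (monomial :: ('v \<Rightarrow>\<^sub>0 nat) \<Rightarrow> ('v, 'a::comm_ring_1) mpoly)"
  by (rule injI) (metis lookup_single_eq lookup_single_not_eq zero_neq_one)

lemma independent_monomials: "finite A \<Longrightarrow> mp.independent (monomial ` A :: ('v, 'a::field) mpoly set)"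
proof (rule mp.independent_if_scalars_zero)
  fix f :: "('v, 'a) mpoly \<Rightarrow> 'a" and x :: "('v, 'a) mpoly"
  assume A: "finite A" and s: "(\<Sum>x\<in>monomial ` A. cmul (f x) x) = 0" and x: "x \<in> monomial ` A"
  obtain m where m: "m \<in> A" "x = monomial m" using x by auto
  have "(\<Sum>k\<in>A. cmul (f (monomial k)) (monomial k)) = (0 :: ('v, 'a) mpoly)"
    using s inj_monomial by (subst (asm) sum.reindex) (auto intro: inj_on_subset)
  then have "Poly_Mapping.lookup (\<Sum>k\<in>A. cmul (f (monomial k)) (monomial k)) m = 0" by simp
  then show "f x = 0"
    using m A by (simp add: lookup_sum lookup_single when_def if_distrib[of "(*) _"] cong: if_cong)
qed simp

lemma dim_homogeneous:
  "mp.dim (homogeneous_part d :: ('v::finite, 'a::field) mpoly set) = card (monoms d :: ('v \<Rightarrow>\<^sub>0 nat) set)"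
proof -
  have "mp.dim (homogeneous_part d :: ('v::finite, 'a::field) mpoly set) = card (monomial ` monoms d :: ('v, 'a) mpoly set)"
    by (rule mp.dim_unique[OF _ homogeneous_subset_span independent_monomials[OF finite_monoms]])
      (auto simp: monoms_def intro: homogeneous_single)
  also have "\<dots> = card (monoms d :: ('v \<Rightarrow>\<^sub>0 nat) set)"
    by (rule card_image) (use inj_monomial in \<open>auto intro: inj_on_subset\<close>)
  finally show ?thesis .
qed

section \<open>Partial and directional derivatives\<close>

lift_definition pderiv_var :: "'v \<Rightarrow> ('v, 'a::comm_ring_1) mpoly \<Rightarrow> ('v, 'a) mpoly"
  is "\<lambda>v f m. of_nat (Poly_Mapping.lookup m v + 1) * f (m + Poly_Mapping.single v 1)"
proof -
  fix v :: 'v and f :: "('v \<Rightarrow>\<^sub>0 nat) \<Rightarrow> 'a"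
  assume f: "finite {x. f x \<noteq> 0}"
  show "finite {m. of_nat (Poly_Mapping.lookup m v + 1) * f (m + Poly_Mapping.single v 1) \<noteq> 0}"
    by (rule finite_subset[OF _ finite_vimageI[OF f, of "\<lambda>m. m + Poly_Mapping.single v 1"]]) (auto simp: inj_on_def)
qed

lemma lookup_pderiv_var: "Poly_Mapping.lookup (pderiv_var v p) m =
    of_nat (Poly_Mapping.lookup m v + 1) * Poly_Mapping.lookup p (m + Poly_Mapping.single v 1)"
  by (simp add: pderiv_var.rep_eq)

lemma pderiv_var_add: "pderiv_var v (p + q) = pderiv_var v p + pderiv_var v q"
  by (rule poly_mapping_eqI) (simp add: lookup_pderiv_var lookup_add distrib_left)

lemma pderiv_var_zero: "pderiv_var v 0 = 0"
  by (rule poly_mapping_eqI) (simp add: lookup_pderiv_var)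

lemma pderiv_var_sum: "pderiv_var v (sum f A) = (\<Sum>x\<in>A. pderiv_var v (f x))"
  by (induction A rule: infinite_finite_induct) (auto simp: pderiv_var_add pderiv_var_zero)

lemma pderiv_var_cmul: "pderiv_var v (cmul c p) = cmul c (pderiv_var v p)"
  by (rule poly_mapping_eqI) (simp add: lookup_pderiv_var algebra_simps)

lemma pderiv_var_single:
  "pderiv_var v (Poly_Mapping.single m a) =
     Poly_Mapping.single (m - Poly_Mapping.single v 1) (of_nat (Poly_Mapping.lookup m v) * a)"
proof (rule poly_mapping_eqI)
  fix k
  show "Poly_Mapping.lookup (pderiv_var v (Poly_Mapping.single m a)) k =
    Poly_Mapping.lookup (Poly_Mapping.single (m - Poly_Mapping.single v 1) (of_nat (Poly_Mapping.lookup m v) * a)) k"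
  proof (cases "Poly_Mapping.lookup m v = 0")
    case True
    then have "m \<noteq> k + Poly_Mapping.single v 1" by (metis add_is_0 lookup_add lookup_single_eq one_neq_zero)
    then show ?thesis using True by (simp add: lookup_pderiv_var lookup_single when_def)
  next
    case False
    then have "m = k + Poly_Mapping.single v 1 \<longleftrightarrow> m - Poly_Mapping.single v 1 = k"
      using monom_split[of m v] by auto
    moreover obtain j where "Poly_Mapping.lookup m v = Suc j" using False not0_implies_Suc by blast
    ultimately show ?thesis by (auto simp: lookup_pderiv_var lookup_single when_def lookup_minus)
  qed
qed

lemma pderiv_var_mult:
  fixes p q :: "('v, 'a::comm_ring_1) mpoly"
  shows "pderiv_var v (p * q) = pderiv_var v p * q + p * pderiv_var v q"
proof -
  have single: "pderiv_var v (Poly_Mapping.single m a * Poly_Mapping.single k b) =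
    pderiv_var v (Poly_Mapping.single m a) * Poly_Mapping.single k b +
    Poly_Mapping.single m a * pderiv_var v (Poly_Mapping.single k b)" for m k and a b :: 'a
  proof -
    let ?e = "Poly_Mapping.single v (1::nat)"
    have 1: "m + k - ?e = m - ?e + k" if "Poly_Mapping.lookup m v > 0"
      using that by (intro poly_mapping_eqI) (auto simp: lookup_add lookup_minus lookup_single when_def)
    have 2: "m + k - ?e = m + (k - ?e)" if "Poly_Mapping.lookup k v > 0"
      using that by (intro poly_mapping_eqI) (auto simp: lookup_add lookup_minus lookup_single when_def)
    show ?thesis
    proof (cases "Poly_Mapping.lookup m v > 0"; cases "Poly_Mapping.lookup k v > 0")
      assume "Poly_Mapping.lookup m v > 0" "Poly_Mapping.lookup k v > 0"
      then show ?thesis using 1 2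
        by (simp add: mult_single pderiv_var_single lookup_add algebra_simps single_add)
    qed (use 1 2 in \<open>simp_all add: mult_single pderiv_var_single lookup_add algebra_simps\<close>)
  qed
  have "pderiv_var v (p * Poly_Mapping.single k b) =
      pderiv_var v p * Poly_Mapping.single k b + p * pderiv_var v (Poly_Mapping.single k b)" for k b
    by (rule mpoly_additive_eqI[of "\<lambda>p. pderiv_var v (p * Poly_Mapping.single k b)"
      "\<lambda>p. pderiv_var v p * Poly_Mapping.single k b + p * pderiv_var v (Poly_Mapping.single k b)" p])
      (simp_all add: pderiv_var_zero pderiv_var_add algebra_simps single)
  then show ?thesis
    by (intro mpoly_additive_eqI[of "\<lambda>q. pderiv_var v (p * q)" "\<lambda>q. pderiv_var v p * q + p * pderiv_var v q" q])
      (simp_all add: pderiv_var_zero pderiv_var_add algebra_simps)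
qed

lemma pderiv_var_commute: "pderiv_var v (pderiv_var w p) = pderiv_var w (pderiv_var v p)"
  by (cases "v = w"; intro poly_mapping_eqI)
    (auto simp: lookup_pderiv_var lookup_add lookup_single when_def algebra_simps)

lemma homogeneous_pderiv_var:
  fixes p :: "('v::finite, 'a::comm_ring_1) mpoly"
  assumes "p \<in> homogeneous_part d" shows "pderiv_var v p \<in> homogeneous_part (d - 1)"
proof -
  have "monom_degree m = d - 1" if "m \<in> Poly_Mapping.keys (pderiv_var v p)" for m
  proof -
    have "m + Poly_Mapping.single v 1 \<in> Poly_Mapping.keys p"
      using that by (auto simp: in_keys_iff lookup_pderiv_var)
    then have "monom_degree (m + Poly_Mapping.single v 1) = d"
      using assms by (auto simp: homogeneous_part_def)
    then show ?thesis by (simp add: monom_degree_add)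
  qed
  then show ?thesis by (auto simp: homogeneous_part_def)
qed

lemma pderiv_var_constant:
  fixes p :: "('v::finite, 'a::comm_ring_1) mpoly"
  assumes "p \<in> homogeneous_part 0" shows "pderiv_var v p = 0"
proof (rule poly_mapping_eqI)
  fix m
  have "m + Poly_Mapping.single v 1 \<notin> Poly_Mapping.keys p"
  proof
    assume *: "m + Poly_Mapping.single v 1 \<in> Poly_Mapping.keys p"
    have "\<forall>m\<in>Poly_Mapping.keys p. monom_degree m = 0"
      using assms by (simp add: homogeneous_part_def)
    from bspec[OF this *] show False by (simp add: monom_degree_add)
  qed
  then have "Poly_Mapping.lookup p (m + Poly_Mapping.single v 1) = 0"
    by (simp add: in_keys_iff)
  then show "Poly_Mapping.lookup (pderiv_var v p) m = Poly_Mapping.lookup 0 m"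
    by (simp add: lookup_pderiv_var)
qed

text \<open>A monomial of positive degree involves some variable, and differentiating by it
  multiplies the coefficient by a positive integer, which is nonzero in characteristic 0.\<close>

lemma pderiv_var_eq_0_imp:
  fixes p :: "('v::finite, 'a::field_char_0) mpoly"
  assumes p: "p \<in> homogeneous_part d" "d > 0" and 0: "\<And>v. pderiv_var v p = 0"
  shows "p = 0"
proof (rule ccontr)
  assume "p \<noteq> 0"
  then obtain m where m: "m \<in> Poly_Mapping.keys p" using keys_eq_empty by (metis ex_in_conv)
  then have "monom_degree m \<noteq> 0" using p by (auto simp: homogeneous_part_def)
  then obtain v where "Poly_Mapping.lookup m v \<noteq> 0" by (auto simp: monom_degree_eq)
  then have s: "m = (m - Poly_Mapping.single v 1) + Poly_Mapping.single v 1"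
    using monom_split[of m v] by simp
  have "Poly_Mapping.lookup (pderiv_var v p) (m - Poly_Mapping.single v 1) =
      of_nat (Poly_Mapping.lookup (m - Poly_Mapping.single v 1) v + 1) * Poly_Mapping.lookup p m"
    unfolding lookup_pderiv_var using s by simp
  also have "\<dots> \<noteq> 0"
    using m of_nat_neq_0[of "Poly_Mapping.lookup (m - Poly_Mapping.single v 1) v", where 'a='a]
    by (auto simp: in_keys_iff)
  finally show False using 0 by simp
qed

definition dderiv :: "('v::finite \<Rightarrow> 'a) \<Rightarrow> ('v, 'a::comm_ring_1) mpoly \<Rightarrow> ('v, 'a) mpoly"
  where "dderiv u p = (\<Sum>v\<in>UNIV. cmul (u v) (pderiv_var v p))"

lemma dderiv_add: "dderiv u (p + q) = dderiv u p + dderiv u q"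
  by (simp add: dderiv_def pderiv_var_add cmul_add sum.distrib)

lemma dderiv_zero [simp]: "dderiv u 0 = 0"
  by (simp add: dderiv_def pderiv_var_zero cmul_def)

lemma dderiv_cmul: "dderiv u (cmul c p) = cmul c (dderiv u p)"
  unfolding dderiv_def cmul_sum
  by (rule sum.cong) (simp_all only: pderiv_var_cmul, simp add: cmul_def algebra_simps)

lemma dderiv_sum: "dderiv u (sum f A) = (\<Sum>x\<in>A. dderiv u (f x))"
  by (induction A rule: infinite_finite_induct) (auto simp: dderiv_add)

lemma dderiv_mult: "dderiv u (p * q) = dderiv u p * q + p * dderiv u q"
  by (simp add: dderiv_def pderiv_var_mult cmul_add sum.distrib sum_distrib_left sum_distrib_right
    mult_cmul_left mult_cmul_right)

lemma pderiv_var_dderiv: "pderiv_var v (dderiv u p) = dderiv u (pderiv_var v p)"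
  by (simp add: dderiv_def pderiv_var_sum pderiv_var_cmul pderiv_var_commute[of v])

lemma dderiv_commute: "dderiv u (dderiv w p) = dderiv w (dderiv u p)"
  unfolding dderiv_def[of u] by (simp add: dderiv_sum dderiv_cmul pderiv_var_dderiv)

lemma homogeneous_dderiv: "p \<in> homogeneous_part d \<Longrightarrow> dderiv u p \<in> homogeneous_part (d - 1)"
  unfolding dderiv_def by (intro homogeneous_sum homogeneous_cmul homogeneous_pderiv_var)

lemma dderiv_constant: "p \<in> homogeneous_part 0 \<Longrightarrow> dderiv u p = 0"
  by (simp add: dderiv_def pderiv_var_constant cmul_def)

lemma linear_dderiv: "Vector_Spaces.linear cmul cmul (dderiv u :: ('v::finite, 'a::field) mpoly \<Rightarrow> _)"
  by (rule linear_cmulI) (simp_all add: dderiv_add dderiv_cmul)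

lemma funpow_dderiv_add: "(dderiv u ^^ n) (p + q) = (dderiv u ^^ n) p + (dderiv u ^^ n) q"
  by (induction n) (simp_all add: dderiv_add)

lemma funpow_dderiv_zero [simp]: "(dderiv u ^^ n) 0 = 0"
  by (induction n) simp_all

lemma funpow_dderiv_cmul: "(dderiv u ^^ n) (cmul c p) = cmul c ((dderiv u ^^ n) p)"
  by (induction n) (simp_all add: dderiv_cmul)

lemma linear_funpow_dderiv:
  "Vector_Spaces.linear cmul cmul (dderiv u ^^ n :: ('v::finite, 'a::field) mpoly \<Rightarrow> _)"
  by (rule linear_cmulI) (simp_all add: funpow_dderiv_add funpow_dderiv_cmul)

lemma homogeneous_funpow_dderiv:
  "p \<in> homogeneous_part d \<Longrightarrow> (dderiv u ^^ n) p \<in> homogeneous_part (d - n)"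
proof (induction n)
  case (Suc n)
  then show ?case using homogeneous_dderiv[where u = u and p = "(dderiv u ^^ n) p"] by fastforce
qed simp

lemma dderiv_funpow_commute: "dderiv w ((dderiv u ^^ n) p) = (dderiv u ^^ n) (dderiv w p)"
  by (induction n) (simp_all add: dderiv_commute[of w])

lemma funpow_dderiv_mono:
  assumes "(dderiv u ^^ m) p = 0" "m \<le> n" shows "(dderiv u ^^ n) p = 0"
proof -
  have "(dderiv u ^^ n) p = (dderiv u ^^ (n - m)) ((dderiv u ^^ m) p)"
    using assms(2) by (metis comp_apply funpow_add le_add_diff_inverse2)
  then show ?thesis using assms(1) by simp
qed

lemma funpow_dderiv_homogeneous_eq_0:
  assumes "p \<in> homogeneous_part d" "d < n" shows "(dderiv u ^^ n) p = 0"
proof -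
  have "(dderiv u ^^ d) p \<in> homogeneous_part 0" using homogeneous_funpow_dderiv[OF assms(1), of d u] by simp
  then have "(dderiv u ^^ Suc d) p = 0" using dderiv_constant by simp
  then show ?thesis using funpow_dderiv_mono assms(2) by (metis Suc_leI)
qed

text \<open>For \<open>u \<noteq> 0\<close> the largest \<open>a\<close> with \<open>D\<^sub>u\<^sup>a F \<noteq> 0\<close> is the degree of \<open>F\<close> minus its multiplicity at the
  point \<open>u\<close>; additivity of that multiplicity on products takes the following form.\<close>
lemma funpow_dderiv_mult_eq_0:
  "(dderiv u ^^ Suc a) p = 0 \<Longrightarrow> (dderiv u ^^ Suc b) q = 0 \<Longrightarrow> (dderiv u ^^ Suc (a + b)) (p * q) = 0"
proof (induction "a + b" arbitrary: a b p q)
  case 0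
  then show ?case by (simp add: dderiv_mult)
next
  case (Suc n)
  have "(dderiv u ^^ Suc n) (dderiv u p * q) = 0"
  proof (cases a)
    case 0
    then show ?thesis using Suc.prems(1) by simp
  next
    case (Suc a')
    then show ?thesis using Suc.hyps(1)[of a' b "dderiv u p" q] Suc.prems Suc.hyps(2)
      by (simp add: funpow_swap1)
  qed
  moreover have "(dderiv u ^^ Suc n) (p * dderiv u q) = 0"
  proof (cases b)
    case 0
    then show ?thesis using Suc.prems(2) by simp
  next
    case (Suc b')
    then show ?thesis using Suc.hyps(1)[of a b' p "dderiv u q"] Suc.prems Suc.hyps(2)
      by (simp add: funpow_swap1)
  qed
  ultimately have "(dderiv u ^^ Suc n) (dderiv u (p * q)) = 0"
    by (simp only: dderiv_mult funpow_dderiv_add) simp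
  then show ?case using Suc.hyps(2) by (simp add: funpow_swap1)
qed

section \<open>Linear forms and the apolarity pairing\<close>

definition linear_coeff :: "('v, 'a::comm_ring_1) mpoly \<Rightarrow> 'v \<Rightarrow> 'a"
  where "linear_coeff h v = Poly_Mapping.lookup h (Poly_Mapping.single v 1)"

lemma monoms_1: "monoms 1 = range (\<lambda>v::'v::finite. Poly_Mapping.single v 1)"
proof -
  have "m \<in> range (\<lambda>v::'v. Poly_Mapping.single v 1)" if "monom_degree m = 1" for m
  proof -
    have "\<exists>v. Poly_Mapping.lookup m v > 0"
      using that by (rule_tac ccontr) (simp add: monom_degree_eq)
    then obtain v where v: "Poly_Mapping.lookup m v > 0" by blast
    have "monom_degree (m - Poly_Mapping.single v 1) = 0"
      using that monom_split[OF v] by (metis add_diff_cancel_right' diff_self_eq_0 monom_degree_add monom_degree_single)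
    then show ?thesis using monom_split[OF v] by (metis add_0 monom_degree_0_iff rangeI)
  qed
  then show ?thesis by (auto simp: monoms_def)
qed

lemma linear_form_eq:
  assumes "h \<in> homogeneous_part 1"
  shows "h = (\<Sum>v\<in>UNIV. cmul (linear_coeff h v) (var (v::'v::finite)))"
proof -
  have "inj (\<lambda>v::'v. Poly_Mapping.single v (1::nat))"
    by (rule injI) (metis lookup_single_eq lookup_single_not_eq zero_neq_one)
  then have "(\<Sum>m\<in>monoms 1. cmul (Poly_Mapping.lookup h m) (monomial m)) =
      (\<Sum>v\<in>UNIV. cmul (linear_coeff h v) (var (v::'v)))"
    unfolding monoms_1 by (simp add: sum.reindex linear_coeff_def var_def)
  then show ?thesis
    using sum_cmul_monomial[of "monoms 1" h] assms by (simp add: homogeneous_part_iff)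
qed

definition monom_fact :: "('v::finite \<Rightarrow>\<^sub>0 nat) \<Rightarrow> 'a::field_char_0"
  where "monom_fact m = (\<Prod>v\<in>UNIV. fact (Poly_Mapping.lookup m v))"

lemma monom_fact_nonzero [simp]: "monom_fact m \<noteq> 0"
  by (simp add: monom_fact_def)

lemma monom_fact_Suc:
  fixes m :: "'v::finite \<Rightarrow>\<^sub>0 nat"
  shows "monom_fact (m + Poly_Mapping.single v 1) =
    of_nat (Poly_Mapping.lookup m v + 1) * (monom_fact m :: 'a::field_char_0)"
proof -
  have "(\<Prod>w\<in>UNIV - {v}. fact (Poly_Mapping.lookup (m + Poly_Mapping.single v 1) w)) =
    (\<Prod>w\<in>UNIV - {v}. fact (Poly_Mapping.lookup m w) :: 'a)"
    by (rule prod.cong) (auto simp: lookup_add lookup_single when_def)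
  then show ?thesis
    unfolding monom_fact_def by (subst (1 2) prod.remove[of _ v]) (auto simp: lookup_add algebra_simps)
qed

text \<open>This is the constant term of the differential operator \<open>p(D)\<close> applied to
  \<open>q\<close>. The weights \<open>monom_fact\<close> are the factorials produced by repeated
  differentiation; they make multiplication by a linear form adjoint to differentiation along its
  coefficient vector.\<close>

definition apolar :: "('v::finite, 'a::field_char_0) mpoly \<Rightarrow> ('v, 'a) mpoly \<Rightarrow> 'a"
  where "apolar p q = (\<Sum>m\<in>Poly_Mapping.keys p. monom_fact m * Poly_Mapping.lookup p m * Poly_Mapping.lookup q m)"

lemma apolar_superset: "finite A \<Longrightarrow> Poly_Mapping.keys p \<subseteq> A \<Longrightarrow>
   apolar p q = (\<Sum>m\<in>A. monom_fact m * Poly_Mapping.lookup p m * Poly_Mapping.lookup q m)"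
  unfolding apolar_def by (rule sum.mono_neutral_left) (auto simp: in_keys_iff)

lemma apolar_add: "apolar (p + p') q = apolar p q + apolar p' q"
  using keys_add[of p p']
  by (simp add: apolar_superset[of "Poly_Mapping.keys p \<union> Poly_Mapping.keys p'"] lookup_add
    algebra_simps sum.distrib)

lemma apolar_add_right: "apolar p (q + q') = apolar p q + apolar p q'"
  by (simp add: apolar_def lookup_add algebra_simps sum.distrib)

lemma apolar_cmul: "apolar (cmul c p) q = c * apolar p q"
proof -
  have "Poly_Mapping.keys (cmul c p) \<subseteq> Poly_Mapping.keys p" by (auto simp: in_keys_iff)
  then show ?thesis
    by (simp add: apolar_superset[of "Poly_Mapping.keys p"] sum_distrib_left algebra_simps)
qed

lemma apolar_cmul_right: "apolar p (cmul c q) = c * apolar p q"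
  by (simp add: apolar_def sum_distrib_left algebra_simps)

lemma apolar_0 [simp]: "apolar 0 q = 0" "apolar p 0 = 0"
  by (simp_all add: apolar_def)

lemma apolar_sum: "apolar (sum f A) q = (\<Sum>x\<in>A. apolar (f x) q)"
  by (induction A rule: infinite_finite_induct) (auto simp: apolar_add)

lemma apolar_sum_right: "apolar p (sum f A) = (\<Sum>x\<in>A. apolar p (f x))"
  by (induction A rule: infinite_finite_induct) (auto simp: apolar_add_right)

lemma apolar_single: "apolar (Poly_Mapping.single m a) q = monom_fact m * a * Poly_Mapping.lookup q m"
  by (simp add: apolar_superset[of "{m}"])

lemma apolar_var_mult:
  fixes p q :: "('v::finite, 'a::field_char_0) mpoly"
  shows "apolar (var v * p) q = apolar p (pderiv_var v q)"
proof (rule mpoly_additive_eqI[of "\<lambda>p. apolar (var v * p) q" "\<lambda>p. apolar p (pderiv_var v q)" p])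
  fix m a
  show "apolar (var v * Poly_Mapping.single m a) q = apolar (Poly_Mapping.single m a) (pderiv_var v q)"
    using monom_fact_Suc[of m v, where 'a='a]
    by (simp add: var_def mult_single apolar_single lookup_pderiv_var add.commute[of "Poly_Mapping.single v (Suc 0)"])
qed (simp_all add: apolar_add algebra_simps)

lemma apolar_linear_mult:
  assumes "h \<in> homogeneous_part 1"
  shows "apolar (h * p) q = apolar p (dderiv (linear_coeff h) q)"
  by (subst linear_form_eq[OF assms])
    (simp add: sum_distrib_right apolar_sum mult_cmul_left apolar_cmul apolar_var_mult dderiv_def
      apolar_sum_right apolar_cmul_right)

lemma apolar_linear_power_mult:
  assumes "h \<in> homogeneous_part 1"
  shows "apolar (h ^ t * p) q = apolar p ((dderiv (linear_coeff h) ^^ t) q)"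
  by (induction t arbitrary: q) (simp_all add: mult.assoc apolar_linear_mult[OF assms] funpow_swap1)

lemma linear_apolar: "Vector_Spaces.linear cmul (*) (\<lambda>p. apolar p (q :: ('v::finite, 'a::field_char_0) mpoly))"
  by unfold_locales (simp_all add: apolar_add apolar_cmul algebra_simps)

text \<open>The pairing is perfect in each degree: a functional \<open>f\<close> is represented by
  the form with coefficients \<open>f (monomial m) / monom_fact m\<close>, a division that
  characteristic 0 permits.\<close>

lemma dim_apolar_le:
  fixes U W :: "('v::finite, 'a::field_char_0) mpoly set"
  assumes U: "mp.subspace U" "U \<subseteq> homogeneous_part d" and W: "mp.subspace W" "W \<subseteq> homogeneous_part d"
    and perp: "\<And>w x. w \<in> W \<Longrightarrow> x \<in> U \<Longrightarrow> apolar w x = 0"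
  shows "mp.dim U + mp.dim W \<le> mp.dim (homogeneous_part d :: ('v, 'a) mpoly set)"
proof (rule mp.dim_orthogonal_le[OF subspace_homogeneous homogeneous_subset_span _ U W linear_apolar perp])
  fix f :: "('v, 'a) mpoly \<Rightarrow> 'a"
  assume f: "Vector_Spaces.linear cmul (*) f"
  interpret f: Vector_Spaces.linear cmul "(*)" f by fact
  define g where "g = (\<Sum>m\<in>monoms d. Poly_Mapping.single m (f (monomial m) / monom_fact m))"
  have "g \<in> homogeneous_part d"
    unfolding g_def by (intro homogeneous_sum homogeneous_single) (simp add: monoms_def)
  moreover have "apolar g F = f F" if "F \<in> homogeneous_part d" for F
  proof -
    have "F = (\<Sum>m\<in>monoms d. cmul (Poly_Mapping.lookup F m) (monomial m))"
      using that by (intro sum_cmul_monomial) (auto simp: homogeneous_part_iff)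
    then have "f F = (\<Sum>m\<in>monoms d. Poly_Mapping.lookup F m * f (monomial m))"
      by (metis (no_types, lifting) f.scale f.sum sum.cong)
    then show ?thesis by (simp add: g_def apolar_sum apolar_single mult.commute)
  qed
  ultimately show "\<exists>g\<in>homogeneous_part d. \<forall>F\<in>homogeneous_part d. apolar g F = f F" by blast
qed simp_all

text \<open>The linear order on the variables supplies a monomial order, hence the absence of zero
  divisors, so that multiplication by \<open>h\<close> has trivial kernel.\<close>

lemma dim_mult_image:
  fixes h :: "('v::{finite,linorder}, 'a::field) mpoly"
  assumes "h \<noteq> 0" "mp.subspace V" "V \<subseteq> homogeneous_part d"
  shows "mp.dim V \<le> mp.dim ((*) h ` V)"
proof -
  have lin: "Vector_Spaces.linear cmul cmul ((*) h)"
    by (rule linear_cmulI) (simp_all add: distrib_left mult_cmul_right)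
  have "{v \<in> V. h * v = 0} \<subseteq> {0}" using assms(1) by auto
  then have "mp.dim {v \<in> V. h * v = 0} = 0"
    using mp.dim_le_card[of "{v \<in> V. h * v = 0}" "{}"] by simp
  then show ?thesis
    using mpp.dim_le_dim_image_kernel[OF lin assms(2) subset_trans[OF assms(3) homogeneous_subset_span]] by simp
qed

lemma dim_homogeneous_4: "mp.dim (homogeneous_part d :: (4, 'a::field) mpoly set) = (d + 3) choose 3"
proof -
  have "(d + 3) choose d = (d + 3) choose 3"
    by (subst binomial_symmetric) simp_all
  moreover have "d + CARD(4) - 1 = d + 3" by simp
  ultimately show ?thesis using card_monoms[where 'v = 4, of d] unfolding dim_homogeneous by metis
qed

lemma choose_3_Suc: "(Suc d + 3) choose 3 = ((d + 3) choose 3) + ((Suc d + 2) choose 2)"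
  by (simp add: eval_nat_numeral)

section \<open>Plane curves with assigned multiplicities\<close>

definition linear_form :: "('v::finite \<Rightarrow> 'a) \<Rightarrow> ('v, 'a::comm_ring_1) mpoly"
  where "linear_form u = (\<Sum>v\<in>UNIV. cmul (u v) (var v))"

lemma homogeneous_linear_form: "linear_form u \<in> homogeneous_part 1"
  unfolding linear_form_def by (intro homogeneous_sum homogeneous_cmul homogeneous_var)

lemma single_Suc_0_eq_iff: "Poly_Mapping.single v (Suc 0) = Poly_Mapping.single w (Suc 0) \<longleftrightarrow> v = w"
  by (metis One_nat_def lookup_single_eq lookup_single_not_eq zero_neq_one)

lemma linear_coeff_linear_form [simp]: "linear_coeff (linear_form u) = u"
proof
  fix v
  have "linear_coeff (linear_form u) v = (\<Sum>w\<in>UNIV. if w = v then u w else 0)"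
    unfolding linear_coeff_def linear_form_def lookup_sum
    by (rule sum.cong) (auto simp: var_def lookup_single when_def single_Suc_0_eq_iff)
  then show "linear_coeff (linear_form u) v = u v" by simp
qed

text \<open>The equation \<open>D\<^sub>h F = 0\<close> makes \<open>F\<close> a form on the projective plane of lines through the point \<open>h\<close>; the
  other equations then say that \<open>F\<close> has multiplicity at least \<open>\<mu> i\<close> at the image of the point \<open>u i\<close>
  (provided \<open>\<mu> i \<le> d\<close>, because of truncated subtraction).\<close>
definition fat_space :: "('v::finite \<Rightarrow> 'a) \<Rightarrow> (nat \<Rightarrow> 'v \<Rightarrow> 'a) \<Rightarrow> nat set \<Rightarrow> nat \<Rightarrow> (nat \<Rightarrow> nat) \<Rightarrow>
    ('v, 'a::comm_ring_1) mpoly set"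
  where "fat_space h u I d \<mu> =
    {F \<in> homogeneous_part d. dderiv h F = 0 \<and> (\<forall>i\<in>I. (dderiv (u i) ^^ (Suc d - \<mu> i)) F = 0)}"

lemma subspace_fat_space: "mp.subspace (fat_space h u I d \<mu> :: ('v::finite, 'a::field) mpoly set)"
  using subspace_homogeneous[where 'v = 'v and 'a = 'a, of d]
  by (auto simp: mp.subspace_def fat_space_def funpow_dderiv_add funpow_dderiv_cmul dderiv_add dderiv_cmul)

lemma fat_space_subset: "fat_space h u I d \<mu> \<subseteq> homogeneous_part d"
  by (auto simp: fat_space_def)

lemma subspace_image_mult: "mp.subspace V \<Longrightarrow> mp.subspace ((*) (h :: ('v, 'a::field) mpoly) ` V)"
  by (rule mpp.linear_subspace_image[OF linear_cmulI]) (simp_all add: distrib_left mult_cmul_right)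

text \<open>Forms killed by \<open>dderiv h\<close> are orthogonal to all multiples of
  \<open>linear_form h\<close>, which fill a space of dimension \<open>(d + 2) choose 3\<close> in
  degree \<open>d\<close>. Working through the pairing avoids a change of coordinates adapted to
  \<open>h\<close>.\<close>

lemma dim_fat_space_empty_le:
  fixes h :: "4 \<Rightarrow> 'a::field_char_0"
  assumes "\<exists>v. h v \<noteq> 0"
  shows "mp.dim (fat_space h u {} d \<mu>) \<le> (d + 2) choose 2"
proof (cases d)
  case 0
  have "mp.dim (fat_space h u {} d \<mu>) \<le> mp.dim (homogeneous_part d :: (4, 'a) mpoly set)"
    by (rule mp.dim_mono_finite[OF homogeneous_subset_span _ fat_space_subset]) simp
  then show ?thesis using 0 by (simp add: dim_homogeneous_4 numeral_2_eq_2)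
next
  case (Suc d')
  let ?l = "linear_form h"
  let ?S = "homogeneous_part d' :: (4, 'a) mpoly set"
  have "?l \<noteq> 0"
  proof
    assume "?l = 0"
    then have "linear_coeff ?l = (\<lambda>v. 0)" by (simp add: linear_coeff_def fun_eq_iff del: linear_coeff_linear_form)
    then show False using assms by simp
  qed
  then have "mp.dim ?S \<le> mp.dim ((*) ?l ` ?S)"
    by (rule dim_mult_image[OF _ subspace_homogeneous order_refl])
  moreover have "mp.dim (fat_space h u {} d \<mu>) + mp.dim ((*) ?l ` ?S)
      \<le> mp.dim (homogeneous_part d :: (4, 'a) mpoly set)"
  proof (rule dim_apolar_le[OF subspace_fat_space fat_space_subset subspace_image_mult[OF subspace_homogeneous]])
    show "(*) ?l ` ?S \<subseteq> homogeneous_part d"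
      using homogeneous_mult[OF homogeneous_linear_form, of _ d' h] Suc by auto
    fix w x assume "w \<in> (*) ?l ` ?S" "x \<in> fat_space h u {} d \<mu>"
    then show "apolar w x = 0"
      using apolar_linear_mult[OF homogeneous_linear_form[of h]] by (auto simp: fat_space_def)
  qed
  ultimately show ?thesis using choose_3_Suc[of d'] unfolding dim_homogeneous_4 Suc by linarith
qed

lemma dim_fat_space_empty_ge:
  fixes h :: "4 \<Rightarrow> 'a::field_char_0"
  shows "(d + 2) choose 2 \<le> mp.dim (fat_space h u {} d \<mu>)"
proof (cases d)
  case 0
  have "fat_space h u {} d \<mu> = homogeneous_part d"
    using 0 by (auto simp: fat_space_def dderiv_constant)
  then show ?thesis using 0 by (simp add: dim_homogeneous_4 numeral_2_eq_2)
next
  case (Suc d')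
  let ?S = "homogeneous_part d :: (4, 'a) mpoly set"
  have "mp.dim ?S \<le> mp.dim (dderiv h ` ?S) + mp.dim {F \<in> ?S. dderiv h F = 0}"
    by (rule mpp.dim_le_dim_image_kernel[OF linear_dderiv subspace_homogeneous homogeneous_subset_span]) simp
  moreover have "mp.dim (dderiv h ` ?S) \<le> mp.dim (homogeneous_part d' :: (4, 'a) mpoly set)"
    by (rule mp.dim_mono_finite[OF homogeneous_subset_span])
      (use homogeneous_dderiv[where d = d and u = h] Suc in auto)
  moreover have "{F \<in> ?S. dderiv h F = 0} = fat_space h u {} d \<mu>"
    by (auto simp: fat_space_def)
  ultimately show ?thesis using choose_3_Suc[of d'] Suc unfolding dim_homogeneous_4 by simp
qed

text \<open>A point of multiplicity \<open>\<mu> j\<close> costs at most as many conditions as there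
  are plane forms of degree \<open>\<mu> j - 1\<close>: after \<open>Suc d - \<mu> j\<close>
  derivatives along \<open>u j\<close> a form of that degree is left, still killed by
  \<open>dderiv h\<close>. The points are imposed one at a time, and nothing is assumed about their
  position.\<close>

lemma dim_fat_space_ge:
  fixes h :: "4 \<Rightarrow> 'a::field_char_0"
  assumes h: "\<exists>v. h v \<noteq> 0" and "finite I" "\<And>i. i \<in> I \<Longrightarrow> \<mu> i \<le> d"
  shows "(d + 2) choose 2 \<le> mp.dim (fat_space h u I d \<mu>) + (\<Sum>i\<in>I. (\<mu> i + 1) choose 2)"
  using assms(2,3)
proof (induction I rule: finite_induct)
  case empty
  then show ?case using dim_fat_space_empty_ge by simp
next
  case (insert j I)
  let ?V = "fat_space h u I d \<mu>" and ?D = "dderiv (u j) ^^ (Suc d - \<mu> j)"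
  have "mp.dim ?V \<le> mp.dim (?D ` ?V) + mp.dim {F \<in> ?V. ?D F = 0}"
    by (rule mpp.dim_le_dim_image_kernel[OF linear_funpow_dderiv subspace_fat_space
      subset_trans[OF fat_space_subset homogeneous_subset_span]]) simp
  moreover have "{F \<in> ?V. ?D F = 0} = fat_space h u (insert j I) d \<mu>"
    by (auto simp: fat_space_def)
  moreover have "mp.dim (?D ` ?V) \<le> (\<mu> j + 1) choose 2"
  proof (cases "\<mu> j")
    case 0
    then have "?D ` ?V \<subseteq> {0}"
      using funpow_dderiv_homogeneous_eq_0[of _ d "Suc d" "u j"] by (auto simp: fat_space_def simp del: funpow.simps)
    then show ?thesis using mp.dim_le_card[of "?D ` ?V" "{}"] by simp
  next
    case (Suc m)
    have "?D ` ?V \<subseteq> fat_space h u {} m \<mu>"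
    proof
      fix G assume "G \<in> ?D ` ?V"
      then obtain F where F: "F \<in> homogeneous_part d" "dderiv h F = 0" "G = ?D F"
        by (auto simp: fat_space_def)
      have "d - (Suc d - \<mu> j) = m" using Suc insert.prems[of j] by auto
      then have "G \<in> homogeneous_part m"
        using homogeneous_funpow_dderiv[OF F(1), of "Suc d - \<mu> j" "u j"] F(3) by simp
      moreover have "dderiv h G = 0" using F by (simp add: dderiv_funpow_commute)
      ultimately show "G \<in> fat_space h u {} m \<mu>" by (simp add: fat_space_def)
    qed
    then have "mp.dim (?D ` ?V) \<le> mp.dim (fat_space h u {} m \<mu>)"
      by (intro mp.dim_mono_finite[OF subset_trans[OF fat_space_subset homogeneous_subset_span]]) auto
    then show ?thesis using dim_fat_space_empty_le[OF h, of u m \<mu>] Suc by simp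
  qed
  moreover have "(d + 2) choose 2 \<le> mp.dim ?V + (\<Sum>i\<in>I. (\<mu> i + 1) choose 2)"
    using insert by simp
  ultimately show ?case using insert.hyps by simp
qed

lemma fat_space_nonzero:
  fixes h :: "4 \<Rightarrow> 'a::field_char_0"
  assumes h: "\<exists>v. h v \<noteq> 0" and "finite I" "\<And>i. i \<in> I \<Longrightarrow> \<mu> i \<le> d"
    and "(\<Sum>i\<in>I. (\<mu> i + 1) choose 2) < (d + 2) choose 2"
  shows "\<exists>F \<in> fat_space h u I d \<mu>. F \<noteq> 0"
proof (rule ccontr)
  assume "\<not> ?thesis"
  then have "fat_space h u I d \<mu> \<subseteq> mp.span {}" by (auto simp: mp.span_empty)
  then have "mp.dim (fat_space h u I d \<mu>) = 0" using mp.dim_le_card[of "fat_space h u I d \<mu>" "{}"] by simp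
  moreover have "(d + 2) choose 2 \<le> mp.dim (fat_space h u I d \<mu>) + (\<Sum>i\<in>I. (\<mu> i + 1) choose 2)"
    by (rule dim_fat_space_ge[OF assms(1-3)])
  ultimately show False using assms(4) by linarith
qed

lemma fat_space_one: "1 \<in> fat_space h u I 0 (\<lambda>_. 0)"
  using dderiv_constant[OF homogeneous_one]
  by (auto simp: fat_space_def homogeneous_one)

lemma fat_space_mult:
  assumes "F \<in> fat_space h u I d \<mu>" "G \<in> fat_space h u I e \<nu>"
    and "\<And>i. i \<in> I \<Longrightarrow> \<mu> i \<le> d" "\<And>i. i \<in> I \<Longrightarrow> \<nu> i \<le> e"
  shows "F * G \<in> fat_space h u I (d + e) (\<lambda>i. \<mu> i + \<nu> i)"
proof -
  have "(dderiv (u i) ^^ (Suc (d + e) - (\<mu> i + \<nu> i))) (F * G) = 0" if "i \<in> I" for i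
  proof -
    have "Suc d - \<mu> i = Suc (d - \<mu> i)" "Suc e - \<nu> i = Suc (e - \<nu> i)"
      "Suc (d + e) - (\<mu> i + \<nu> i) = Suc ((d - \<mu> i) + (e - \<nu> i))"
      using assms(3,4)[OF that] by auto
    moreover have "(dderiv (u i) ^^ (Suc d - \<mu> i)) F = 0" "(dderiv (u i) ^^ (Suc e - \<nu> i)) G = 0"
      using assms(1,2) that by (simp_all add: fat_space_def)
    ultimately show ?thesis by (metis funpow_dderiv_mult_eq_0)
  qed
  then show ?thesis
    using assms(1,2) by (auto simp: fat_space_def homogeneous_mult dderiv_mult)
qed

lemma fat_space_prod:
  assumes "finite A" "\<And>k. k \<in> A \<Longrightarrow> F k \<in> fat_space h u I d (\<mu> k)" "\<And>k i. k \<in> A \<Longrightarrow> i \<in> I \<Longrightarrow> \<mu> k i \<le> d"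
  shows "prod F A \<in> fat_space h u I (card A * d) (\<lambda>i. \<Sum>k\<in>A. \<mu> k i)"
  using assms
proof (induction A rule: finite_induct)
  case (insert k A)
  have "(\<Sum>k\<in>A. \<mu> k i) \<le> card A * d" if "i \<in> I" for i
    using sum_bounded_above[of A "\<lambda>k. \<mu> k i" d] insert.prems(2) that by simp
  then have "F k * prod F A \<in> fat_space h u I (d + card A * d) (\<lambda>i. \<mu> k i + (\<Sum>k\<in>A. \<mu> k i))"
    by (intro fat_space_mult insert) (auto intro: insert)
  then show ?case using insert.hyps by simp
qed (simp add: fat_space_one)

lemma fat_space_cong: "F \<in> fat_space h u I d \<mu> \<Longrightarrow> d = d' \<Longrightarrow> (\<And>i. i \<in> I \<Longrightarrow> \<mu> i = \<mu>' i) \<Longrightarrow> F \<in> fat_space h u I d' \<mu>'"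
  by (auto simp: fat_space_def)

text \<open>Multiplication by \<open>E ^ s\<close> embeds the system of the cofactors
  \<open>G\<close> into the system of interest. Counting conditions for \<open>G\<close> alone can
  give more than the same count for the products, and this gain is what the whole proof lives
  on.\<close>

lemma dim_fat_space_power_mult:
  fixes h :: "4 \<Rightarrow> 'a::field_char_0"
  assumes h: "\<exists>v. h v \<noteq> 0" and E: "E \<in> fat_space h u {..<n} c (\<lambda>_. \<mu>)" "E \<noteq> 0" and le: "\<mu> \<le> c" "\<nu> \<le> d"
  shows "(d * e + 2) choose 2 \<le>
    mp.dim (fat_space h u {..<n} (c * s + d * e) (\<lambda>_. \<mu> * s + \<nu> * e)) + n * ((\<nu> * e + 1) choose 2)"
proof -
  let ?Y = "fat_space h u {..<n} (d * e) (\<lambda>_. \<nu> * e)"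
  have Es: "E ^ s \<in> fat_space h u {..<n} (c * s) (\<lambda>_. \<mu> * s)"
    using fat_space_prod[of "{..<s}" "\<lambda>_. E", OF _ E(1)] le by (simp add: mult.commute)
  have "(d * e + 2) choose 2 \<le> mp.dim ?Y + n * ((\<nu> * e + 1) choose 2)"
    using dim_fat_space_ge[OF h, of "{..<n}" "\<lambda>_. \<nu> * e" "d * e" u] le by simp
  moreover have "mp.dim ?Y \<le> mp.dim ((*) (E ^ s) ` ?Y)"
    by (rule dim_mult_image[OF _ subspace_fat_space fat_space_subset]) (use E in auto)
  moreover have "(*) (E ^ s) ` ?Y \<subseteq> fat_space h u {..<n} (c * s + d * e) (\<lambda>_. \<mu> * s + \<nu> * e)"
    using fat_space_mult[OF Es] le by auto
  then have "mp.dim ((*) (E ^ s) ` ?Y) \<le> mp.dim (fat_space h u {..<n} (c * s + d * e) (\<lambda>_. \<mu> * s + \<nu> * e))"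
    by (intro mp.dim_mono_finite[OF subset_trans[OF fat_space_subset homogeneous_subset_span]]) auto
  ultimately show ?thesis by linarith
qed

text \<open>Multiply, over all \<open>k\<close>, curves of degree \<open>\<delta>\<close> with multiplicity \<open>m\<close> at the point \<open>k\<close> and \<open>m'\<close> at the
  others.\<close>
lemma fat_space_product_of_curves:
  fixes h :: "4 \<Rightarrow> 'a::field_char_0"
  assumes h: "\<exists>v. h v \<noteq> 0" and m: "m \<le> \<delta>" "m' \<le> \<delta>"
    and lt: "((m + 1) choose 2) + (n - 1) * ((m' + 1) choose 2) < (\<delta> + 2) choose 2"
  shows "\<exists>E \<in> fat_space h u {..<n} (n * \<delta>) (\<lambda>_. m + (n - 1) * m'). E \<noteq> 0"
proof -
  let ?\<mu> = "\<lambda>k i. if i = k then m else m'"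
  have split: "(\<Sum>i<n. if i = k then a else b) = a + (n - 1) * b" if "k < n" for k and a b :: nat
    using that by (subst sum.remove[of _ k]) (auto intro!: sum.cong)
  have "\<exists>F \<in> fat_space h u {..<n} \<delta> (?\<mu> k). F \<noteq> 0" if "k < n" for k
  proof (rule fat_space_nonzero[OF h])
    have "(\<Sum>i<n. (?\<mu> k i + 1) choose 2) = (\<Sum>i<n. if i = k then (m + 1) choose 2 else (m' + 1) choose 2)"
      by (intro sum.cong) auto
    then show "(\<Sum>i<n. (?\<mu> k i + 1) choose 2) < (\<delta> + 2) choose 2"
      using lt split[OF that] by simp
  qed (use m in auto)
  then obtain F where F: "\<And>k. k < n \<Longrightarrow> F k \<in> fat_space h u {..<n} \<delta> (?\<mu> k)" "\<And>k. k < n \<Longrightarrow> F k \<noteq> 0"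
    by metis
  \<comment> \<open>Each point is the special one for exactly one factor, so the product has the
    same multiplicity at all points.\<close>
  have "prod F {..<n} \<in> fat_space h u {..<n} (card {..<n} * \<delta>) (\<lambda>i. \<Sum>k<n. ?\<mu> k i)"
    by (rule fat_space_prod) (use F m in auto)
  then have "prod F {..<n} \<in> fat_space h u {..<n} (n * \<delta>) (\<lambda>_. m + (n - 1) * m')"
  proof (rule fat_space_cong)
    fix i assume "i \<in> {..<n}"
    moreover have "(\<Sum>k<n. ?\<mu> k i) = (\<Sum>k<n. if k = i then m else m')"
      by (intro sum.cong) auto
    ultimately show "(\<Sum>k<n. ?\<mu> k i) = m + (n - 1) * m'" using split[of i m m'] by simp
  qed simp
  moreover have "prod F {..<n} \<noteq> 0" using F(2) by simp
  ultimately show ?thesis by blast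
qed

section \<open>Powers of linear forms without syzygies, and the consequence of injectivity\<close>

lemma (in vector_space) independent_familyI:
  assumes C: "finite C" and a: "\<And>a. (\<Sum>c\<in>C. scale (a c) (f c)) = 0 \<Longrightarrow> \<forall>c\<in>C. a c = 0"
  shows "inj_on f C" "independent (f ` C)"
proof -
  show inj: "inj_on f C"
  proof (rule inj_onI, rule ccontr)
    fix c c' assume c: "c \<in> C" "c' \<in> C" "f c = f c'" "c \<noteq> c'"
    have "(\<Sum>x\<in>C. scale (if x = c then 1 else if x = c' then -1 else 0) (f x)) =
        (\<Sum>x\<in>C. (if x = c then f c else 0) + (if x = c' then - f c' else 0))"
      by (rule sum.cong) (use c in auto)
    also have "\<dots> = 0" using c C by (simp add: sum.distrib)
    finally show False using a[of "\<lambda>x. if x = c then 1 else if x = c' then -1 else 0"] c(1) by auto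
  qed
  show "independent (f ` C)"
  proof (rule independent_if_scalars_zero)
    fix g x assume "(\<Sum>x\<in>f ` C. scale (g x) x) = 0" "x \<in> f ` C"
    then show "g x = 0" using a[of "\<lambda>c. g (f c)"] inj by (auto simp: sum.reindex)
  qed (use C in auto)
qed

text \<open>The index \<open>r\<close> is the degree of the cofactors; for linear forms
  \<open>l i\<close> this is the part of the ideal in degree \<open>t + r\<close>, as
  \<open>power_ideal_part_eq\<close> confirms.\<close>

definition power_ideal_part :: "nat \<Rightarrow> nat \<Rightarrow> (nat \<Rightarrow> ('v, 'a::comm_ring_1) mpoly) \<Rightarrow> nat \<Rightarrow> ('v, 'a) mpoly set"
  where "power_ideal_part n t l r = {(\<Sum>i<n. l i ^ t * g i) | g. \<forall>i<n. g i \<in> homogeneous_part r}"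

text \<open>Over a field and for finitely many variables this is linear independence of the family
  \<open>power_monomial\<close> over the monomials of degree \<open>r\<close>. In that form it
  yields a dimension and, later, a determinant.\<close>

definition no_syzygies :: "nat \<Rightarrow> nat \<Rightarrow> (nat \<Rightarrow> ('v, 'a::comm_ring_1) mpoly) \<Rightarrow> nat \<Rightarrow> bool"
  where "no_syzygies n t l r \<longleftrightarrow>
    (\<forall>g. (\<forall>i<n. g i \<in> homogeneous_part r) \<longrightarrow> (\<Sum>i<n. l i ^ t * g i) = 0 \<longrightarrow> (\<forall>i<n. g i = 0))"

definition power_monomial :: "nat \<Rightarrow> (nat \<Rightarrow> ('v, 'a::comm_ring_1) mpoly) \<Rightarrow> nat \<times> ('v \<Rightarrow>\<^sub>0 nat) \<Rightarrow> ('v, 'a) mpoly"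
  where "power_monomial t l = (\<lambda>(i, m). l i ^ t * monomial m)"

lemma sum_power_monomial:
  "(\<Sum>c\<in>{..<n} \<times> A. cmul (a c) (power_monomial t l c)) =
   (\<Sum>i<n. l i ^ t * (\<Sum>m\<in>A. cmul (a (i, m)) (monomial m)))"
proof -
  have "(\<Sum>c\<in>{..<n} \<times> A. cmul (a c) (power_monomial t l c)) =
      (\<Sum>i<n. \<Sum>m\<in>A. cmul (a (i, m)) (power_monomial t l (i, m)))"
    by (simp add: sum.cartesian_product)
  then show ?thesis
    by (simp add: power_monomial_def sum_distrib_left mult_cmul_right)
qed

lemma lookup_sum_cmul_monomial:
  "finite A \<Longrightarrow> m \<in> A \<Longrightarrow> Poly_Mapping.lookup (\<Sum>m\<in>A. cmul (b m) (monomial m)) m = b m"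
  by (simp add: lookup_sum lookup_single when_def if_distrib[of "(*) _"] cong: if_cong)

lemma no_syzygies_imp_independent:
  fixes l :: "nat \<Rightarrow> ('v::finite, 'a::field) mpoly"
  assumes "no_syzygies n t l r"
    and s: "(\<Sum>c\<in>{..<n} \<times> monoms r. cmul (a c) (power_monomial t l c)) = 0"
  shows "\<forall>c\<in>{..<n} \<times> monoms r. a c = 0"
proof -
  define g where "g i = (\<Sum>m\<in>monoms r. cmul (a (i, m)) (monomial m))" for i
  have "\<forall>i<n. g i \<in> homogeneous_part r"
    unfolding g_def by (auto intro!: homogeneous_sum homogeneous_cmul homogeneous_single simp: monoms_def)
  moreover have "(\<Sum>i<n. l i ^ t * g i) = 0"
    using s by (simp add: sum_power_monomial g_def)
  ultimately have "g i = 0" if "i < n" for i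
    using assms(1) that unfolding no_syzygies_def by blast
  then have "a (i, m) = 0" if "i < n" "m \<in> monoms r" for i m
    using lookup_sum_cmul_monomial[of "monoms r" m "\<lambda>m. a (i, m)"] that by (simp add: g_def)
  then show ?thesis by auto
qed

lemma independent_imp_no_syzygies:
  fixes l :: "nat \<Rightarrow> ('v::finite, 'a::field) mpoly"
  assumes "\<And>a. (\<Sum>c\<in>{..<n} \<times> monoms r. cmul (a c) (power_monomial t l c)) = 0 \<Longrightarrow>
    \<forall>c\<in>{..<n} \<times> monoms r. a c = 0"
  shows "no_syzygies n t l r"
  unfolding no_syzygies_def
proof (intro allI impI)
  fix g i assume g: "\<forall>i<n. g i \<in> homogeneous_part r" and s: "(\<Sum>i<n. l i ^ t * g i) = 0" and i: "i < n"
  have e: "g i = (\<Sum>m\<in>monoms r. cmul (Poly_Mapping.lookup (g i) m) (monomial m))" if "i < n" for i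
    using g that by (intro sum_cmul_monomial) (auto simp: homogeneous_part_iff)
  have "(\<Sum>c\<in>{..<n} \<times> monoms r. cmul (case c of (i, m) \<Rightarrow> Poly_Mapping.lookup (g i) m) (power_monomial t l c)) =
     (\<Sum>i<n. l i ^ t * g i)"
    unfolding sum_power_monomial using e by simp
  then have "\<forall>c\<in>{..<n} \<times> monoms r. (case c of (i, m) \<Rightarrow> Poly_Mapping.lookup (g i) m) = 0"
    by (intro assms) (simp add: s)
  then show "g i = 0" using i e[OF i] by (simp add: cmul_def)
qed

lemma subspace_power_ideal_part: "mp.subspace (power_ideal_part n t l r :: ('v, 'a::field) mpoly set)"
  unfolding mp.subspace_def
proof (intro conjI ballI allI)
  show "0 \<in> power_ideal_part n t l r"
    by (auto simp: power_ideal_part_def intro!: exI[of _ "\<lambda>_. 0"])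
next
  fix x y assume "x \<in> power_ideal_part n t l r" "y \<in> power_ideal_part n t l r"
  then obtain f g where "\<forall>i<n. f i \<in> homogeneous_part r" "\<forall>i<n. g i \<in> homogeneous_part r"
    "x = (\<Sum>i<n. l i ^ t * f i)" "y = (\<Sum>i<n. l i ^ t * g i)" by (auto simp: power_ideal_part_def)
  then show "x + y \<in> power_ideal_part n t l r"
    by (auto simp: power_ideal_part_def sum.distrib distrib_left homogeneous_add
      intro!: exI[of _ "\<lambda>i. f i + g i"])
next
  fix c x assume "x \<in> power_ideal_part n t l r"
  then obtain f where "\<forall>i<n. f i \<in> homogeneous_part r" "x = (\<Sum>i<n. l i ^ t * f i)"
    by (auto simp: power_ideal_part_def)
  then show "cmul c x \<in> power_ideal_part n t l r"
    by (auto simp: power_ideal_part_def cmul_sum mult_cmul_right homogeneous_cmul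
      intro!: exI[of _ "\<lambda>i. cmul c (f i)"])
qed

lemma homogeneous_linear_power_mult:
  fixes l :: "('v::finite, 'a::comm_ring_1) mpoly"
  assumes "l \<in> homogeneous_part 1" "p \<in> homogeneous_part r"
  shows "l ^ t * p \<in> homogeneous_part (t + r)"
  using homogeneous_mult[OF homogeneous_power[OF assms(1), of t] assms(2)] by simp

lemma power_ideal_part_subset:
  fixes l :: "nat \<Rightarrow> ('v::finite, 'a::comm_ring_1) mpoly"
  assumes "\<And>i. i < n \<Longrightarrow> l i \<in> homogeneous_part 1"
  shows "power_ideal_part n t l r \<subseteq> homogeneous_part (t + r)"
  using assms by (auto simp: power_ideal_part_def intro!: homogeneous_sum homogeneous_linear_power_mult)

lemma power_ideal_part_subset_span:
  fixes l :: "nat \<Rightarrow> ('v::finite, 'a::field) mpoly"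
  shows "power_ideal_part n t l r \<subseteq> mp.span (power_monomial t l ` ({..<n} \<times> monoms r))"
proof
  fix x assume "x \<in> power_ideal_part n t l r"
  then obtain g where g: "\<forall>i<n. g i \<in> homogeneous_part r" and x: "x = (\<Sum>i<n. l i ^ t * g i)"
    by (auto simp: power_ideal_part_def)
  have e: "g i = (\<Sum>m\<in>monoms r. cmul (Poly_Mapping.lookup (g i) m) (monomial m))" if "i < n" for i
    using g that by (intro sum_cmul_monomial) (auto simp: homogeneous_part_iff)
  have "x = (\<Sum>c\<in>{..<n} \<times> monoms r. cmul (case c of (i, m) \<Rightarrow> Poly_Mapping.lookup (g i) m) (power_monomial t l c))"
    unfolding sum_power_monomial x using e by simp
  also have "\<dots> \<in> mp.span (power_monomial t l ` ({..<n} \<times> monoms r))"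
    by (intro mp.span_sum mp.span_scale mp.span_base) auto
  finally show "x \<in> mp.span (power_monomial t l ` ({..<n} \<times> monoms r))" .
qed

lemma power_monomial_in_part:
  fixes l :: "nat \<Rightarrow> ('v::finite, 'a::comm_ring_1) mpoly"
  assumes "c \<in> {..<n} \<times> monoms r"
  shows "power_monomial t l c \<in> power_ideal_part n t l r"
proof -
  obtain i m where c: "c = (i, m)" "i < n" "m \<in> monoms r" using assms by auto
  have "(\<Sum>j<n. l j ^ t * (if j = i then monomial m else 0)) = (\<Sum>j<n. if j = i then l i ^ t * monomial m else 0)"
    by (rule sum.cong) auto
  then have "power_monomial t l c = (\<Sum>j<n. l j ^ t * (if j = i then monomial m else 0))"
    using c by (simp add: power_monomial_def)
  moreover have "\<forall>j<n. (if j = i then monomial m else 0) \<in> homogeneous_part r"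
    using c(3) by (auto simp: monoms_def intro: homogeneous_single)
  ultimately show ?thesis
    unfolding power_ideal_part_def by (intro CollectI exI[of _ "\<lambda>j. if j = i then monomial m else 0"]) auto
qed

text \<open>Put M = t + r + 1 and k = r + 2. Injectivity puts the intersection of \<open>h\<close>
  times the forms of degree M - 1 with the ideal inside \<open>h\<close> times the ideal, whose
  dimension is at most the number of generators \<open>power_monomial\<close> in degree M - 1.
  Absence of syzygies bounds the ideal in degree M from below. The sum of the two spaces is then
  large, and its orthogonal is left with at most the expected dimension.\<close>

lemma injective_imp_dim_fat_space_le:
  fixes l :: "nat \<Rightarrow> (4, 'a::field_char_0) mpoly"
  assumes l: "\<And>i. i < n \<Longrightarrow> l i \<in> homogeneous_part 1"
    and h: "h \<in> homogeneous_part 1" "h \<noteq> 0"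
    and ns: "no_syzygies n t l (Suc r)"
    and inj: "\<And>p. p \<in> homogeneous_part (t + r) \<Longrightarrow> h * p \<in> power_ideal_part n t l (Suc r) \<Longrightarrow>
      p \<in> power_ideal_part n t l r"
  shows "mp.dim (fat_space (linear_coeff h) (\<lambda>i. linear_coeff (l i)) {..<n} (t + Suc r) (\<lambda>_. Suc (Suc r)))
    + n * ((r + 3) choose 2) \<le> (t + r + 3) choose 2"
proof -
  let ?S = "homogeneous_part (t + r) :: (4, 'a) mpoly set"
  let ?A = "(*) h ` ?S" and ?B = "power_ideal_part n t l (Suc r)"
  let ?F = "fat_space (linear_coeff h) (\<lambda>i. linear_coeff (l i)) {..<n} (t + Suc r) (\<lambda>_. Suc (Suc r))"
  let ?H = "homogeneous_part (t + Suc r) :: (4, 'a) mpoly set"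
  have card: "card (monoms d :: (4 \<Rightarrow>\<^sub>0 nat) set) = (d + 3) choose 3" for d
    using dim_homogeneous[where 'v = 4 and 'a = 'a, of d] dim_homogeneous_4[where 'a = 'a, of d] by simp
  have A: "mp.subspace ?A" "?A \<subseteq> ?H"
    using subspace_image_mult[OF subspace_homogeneous] homogeneous_mult[OF h(1), of _ "t + r"] by auto
  have B: "mp.subspace ?B" "?B \<subseteq> ?H"
    using subspace_power_ideal_part power_ideal_part_subset[of n l t "Suc r"] l by auto
  have dA: "(t + r + 3) choose 3 \<le> mp.dim ?A"
    using dim_mult_image[OF h(2) subspace_homogeneous order_refl, of "t + r"]
    unfolding dim_homogeneous_4 by simp
  let ?C = "{..<n} \<times> (monoms (Suc r) :: (4 \<Rightarrow>\<^sub>0 nat) set)"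
  have "inj_on (power_monomial t l) ?C" "mp.independent (power_monomial t l ` ?C)"
    using mp.independent_familyI[of ?C "power_monomial t l"] no_syzygies_imp_independent[OF ns] by auto
  then have "card ?C \<le> mp.dim ?B"
    using mp.independent_card_le_dim_finite[of ?B "power_monomial t l ` ?C" "power_monomial t l ` ?C"]
      power_ideal_part_subset_span[of n t l "Suc r"] power_monomial_in_part[of _ n "Suc r" t l]
    by (simp add: card_image image_subset_iff)
  then have dB: "n * ((Suc r + 3) choose 3) \<le> mp.dim ?B"
    by (simp add: card_cartesian_product card)
  let ?C' = "{..<n} \<times> (monoms r :: (4 \<Rightarrow>\<^sub>0 nat) set)"
  have "?A \<inter> ?B \<subseteq> (*) h ` power_ideal_part n t l r" using inj by auto
  also have "\<dots> \<subseteq> (*) h ` mp.span (power_monomial t l ` ?C')"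
    using power_ideal_part_subset_span[of n t l r] by auto
  also have "\<dots> = mp.span ((*) h ` power_monomial t l ` ?C')"
    by (rule mpp.linear_span_image[OF linear_cmulI, symmetric]) (simp_all add: distrib_left mult_cmul_right)
  finally have "mp.dim (?A \<inter> ?B) \<le> card ((*) h ` power_monomial t l ` ?C')"
    by (rule mp.dim_le_card) simp
  also have "\<dots> \<le> card ?C'"
    unfolding image_image by (rule card_image_le) simp
  finally have dAB: "mp.dim (?A \<inter> ?B) \<le> n * ((r + 3) choose 3)"
    by (simp add: card_cartesian_product card)
  let ?W = "{x + y |x y. x \<in> ?A \<and> y \<in> ?B}"
  have sum: "mp.dim ?A + mp.dim ?B \<le> mp.dim ?W + mp.dim (?A \<inter> ?B)"
    by (rule mp.dim_sum_Int_le[OF A(1) B(1) subset_trans[OF A(2) homogeneous_subset_span]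
      subset_trans[OF B(2) homogeneous_subset_span]]) simp
  have perp: "mp.dim ?F + mp.dim ?W \<le> mp.dim ?H"
  proof (rule dim_apolar_le[OF subspace_fat_space fat_space_subset mp.subspace_sums[OF A(1) B(1)]])
    show "?W \<subseteq> ?H" using A(2) B(2) homogeneous_add by blast
    fix w x assume w: "w \<in> ?W" and x: "x \<in> ?F"
    obtain p q where pq: "w = h * p + q" "q \<in> ?B" using w by auto
    obtain g where g: "q = (\<Sum>i<n. l i ^ t * g i)" using pq(2) by (auto simp: power_ideal_part_def)
    have "apolar (h * p) x = 0" using x by (simp add: apolar_linear_mult[OF h(1)] fat_space_def)
    moreover have "apolar (l i ^ t * g i) x = 0" if "i < n" for i
      using x that by (simp add: apolar_linear_power_mult[OF l] fat_space_def)
    ultimately show "apolar w x = 0" by (simp add: pq g apolar_add apolar_sum)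
  qed
  have "(Suc r + 3) choose 3 = ((r + 3) choose 3) + ((r + 3) choose 2)"
    "(t + Suc r + 3) choose 3 = ((t + r + 3) choose 3) + ((t + r + 3) choose 2)"
    using choose_3_Suc[of r] choose_3_Suc[of "t + r"] by (simp_all add: numeral_3_eq_3)
  then show ?thesis
    using dA dB dAB sum perp unfolding dim_homogeneous_4 by (simp add: algebra_simps)
qed

text \<open>Lay the intervals of length \<open>r j\<close> end to end and reduce positions modulo \<open>R\<close>.\<close>
lemma cyclic_covering:
  fixes J :: "nat set"
  assumes J: "finite J" and r: "\<And>j. j \<in> J \<Longrightarrow> r j \<le> R" and sum: "(\<Sum>j\<in>J. r j) \<le> m * R"
  obtains f :: "nat \<Rightarrow> nat set" where "\<And>x. x < R \<Longrightarrow> f x \<subseteq> J" "\<And>x. x < R \<Longrightarrow> card (f x) \<le> m"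
    "\<And>j. j \<in> J \<Longrightarrow> r j \<le> card {x. x < R \<and> j \<in> f x}"
proof -
  define s where "s j = (\<Sum>i | i \<in> J \<and> i < j. r i)" for j
  define f where "f x = {j \<in> J. \<exists>p. s j \<le> p \<and> p < s j + r j \<and> p mod R = x}" for x
  have s_le: "s j + r j \<le> (\<Sum>i\<in>K. r i)" if "j \<in> J" "{i \<in> J. i < j} \<subseteq> K" "j \<in> K" "K \<subseteq> J" for j K
  proof -
    have "s j + r j = (\<Sum>i\<in>insert j {i \<in> J. i < j}. r i)"
      unfolding s_def by (subst sum.insert) (use J in auto)
    also have "\<dots> \<le> (\<Sum>i\<in>K. r i)"
      by (rule sum_mono2) (use that J finite_subset in auto)
    finally show ?thesis .
  qed
  have s_mono: "s j + r j \<le> s j'" if "j \<in> J" "j < j'" for j j'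
  proof -
    have "{i \<in> J. i < j} \<subseteq> {i \<in> J. i < j'}" using that(2) by auto
    then show ?thesis using s_le[of j "{i \<in> J. i < j'}"] that unfolding s_def[of j'] by simp
  qed
  have card: "card (f x) \<le> m" for x
  proof -
    have "\<forall>j\<in>f x. \<exists>p. s j \<le> p \<and> p < s j + r j \<and> p mod R = x" by (auto simp: f_def)
    then obtain p where p: "\<And>j. j \<in> f x \<Longrightarrow> s j \<le> p j \<and> p j < s j + r j \<and> p j mod R = x" by metis
    \<comment> \<open>The intervals are disjoint, so positions with equal residue have different
      quotients modulo \<open>R\<close>, and these quotients are below \<open>m\<close> because all
      positions are below \<open>m * R\<close>.\<close>
    have "inj_on (\<lambda>j. p j div R) (f x)"
    proof (rule linorder_inj_onI)
      fix j j' assume j: "j < j'" "j \<in> f x" "j' \<in> f x"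
      then have "p j < p j'" using p[of j] p[of j'] s_mono[of j j'] by (auto simp: f_def)
      moreover have "p j mod R = p j' mod R" using p j by simp
      ultimately show "p j div R \<noteq> p j' div R" by (metis div_mult_mod_eq less_irrefl)
    qed auto
    moreover have "(\<lambda>j. p j div R) ` f x \<subseteq> {..<m}"
    proof
      fix y assume "y \<in> (\<lambda>j. p j div R) ` f x"
      then obtain j where j: "j \<in> f x" "y = p j div R" by auto
      have "j \<in> J" using j by (simp add: f_def)
      then have "p j < m * R" using p[OF j(1)] s_le[of j J] sum by auto
      then show "y \<in> {..<m}" using j(2) by (simp add: less_mult_imp_div_less)
    qed
    ultimately show ?thesis using card_inj_on_le[of "\<lambda>j. p j div R" "f x" "{..<m}"] by simp
  qed
  have "r j \<le> card {x. x < R \<and> j \<in> f x}" if j: "j \<in> J" for j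
  proof (cases "R = 0")
    case False
    \<comment> \<open>No interval is longer than \<open>R\<close>, so it does not wrap onto
      itself.\<close>
    have "inj_on (\<lambda>p. p mod R) {s j..<s j + r j}"
    proof (rule linorder_inj_onI)
      fix p q assume pq: "p < q" "p \<in> {s j..<s j + r j}" "q \<in> {s j..<s j + r j}"
      have "\<not> R dvd q - p" using pq r[OF j] by (auto dest!: dvd_imp_le)
      then show "p mod R \<noteq> q mod R" using pq(1) by (metis less_imp_le mod_eq_dvd_iff_nat)
    qed auto
    moreover have "(\<lambda>p. p mod R) ` {s j..<s j + r j} \<subseteq> {x. x < R \<and> j \<in> f x}"
      using False j by (auto simp: f_def)
    ultimately show ?thesis
      using card_inj_on_le[of "\<lambda>p. p mod R" "{s j..<s j + r j}" "{x. x < R \<and> j \<in> f x}"] by simp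
  qed (use r[OF j] in simp)
  then show thesis using card by (intro that[of f]) (auto simp: f_def)
qed

section \<open>Absence of syzygies for points on the moment curve\<close>

lemma pderiv_var_var: "pderiv_var w (var v) = (if v = w then 1 else 0)"
  by (auto simp: var_def pderiv_var_single lookup_single when_def)

lemma dderiv_linear_form: "dderiv u (linear_form w) = Poly_Mapping.single 0 (\<Sum>v\<in>UNIV. u v * w v)"
proof -
  have "dderiv u (var v) = (\<Sum>w\<in>UNIV. if w = v then cmul (u v) 1 else 0)" for v
    unfolding dderiv_def by (rule sum.cong) (auto simp: pderiv_var_var cmul_def)
  then have "dderiv u (linear_form w) = (\<Sum>v\<in>UNIV. Poly_Mapping.single 0 (u v * w v))"
    by (simp add: linear_form_def dderiv_sum dderiv_cmul) (simp add: cmul_def mult_single mult.commute)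
  also have "sum (\<lambda>v. Poly_Mapping.single 0 (u v * w v)) A = Poly_Mapping.single 0 (\<Sum>v\<in>A. u v * w v)" for A
    by (induction A rule: infinite_finite_induct) (auto simp: single_add)
  finally show ?thesis .
qed

definition var_index :: "4 \<Rightarrow> nat"
  where "var_index = (SOME f. bij_betw f UNIV {..<4})"

lemma bij_var_index: "bij_betw var_index UNIV {..<4}"
proof -
  have "\<exists>f :: 4 \<Rightarrow> nat. bij_betw f UNIV {..<4}"
    using ex_bij_betw_finite_nat[of "UNIV :: 4 set"] by (simp add: atLeast0LessThan)
  then show ?thesis unfolding var_index_def by (rule someI_ex)
qed

text \<open>A polynomial of degree at most 3 stands for the vector of its coefficients; it pairs with the point
  of the moment curve with parameter \<open>s\<close> by evaluation at \<open>s\<close>.\<close>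

definition moment :: "'a \<Rightarrow> (4, 'a::comm_ring_1) mpoly"
  where "moment s = linear_form (\<lambda>v. s ^ var_index v)"

definition polyderiv :: "'a poly \<Rightarrow> (4, 'a::comm_ring_1) mpoly \<Rightarrow> (4, 'a) mpoly"
  where "polyderiv q = dderiv (\<lambda>v. coeff q (var_index v))"

lemma polyderiv_moment:
  assumes "Polynomial.degree q < 4"
  shows "polyderiv q (moment s) = Poly_Mapping.single 0 (poly q s)"
proof -
  have "(\<Sum>v\<in>UNIV. coeff q (var_index v) * s ^ var_index v) = (\<Sum>i<4. coeff q i * s ^ i)"
    by (rule sum.reindex_bij_betw[OF bij_var_index])
  also have "\<dots> = (\<Sum>i\<le>Polynomial.degree q. coeff q i * s ^ i)"
    by (rule sum.mono_neutral_right) (use assms in \<open>auto simp: coeff_eq_0\<close>)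
  finally show ?thesis
    by (simp add: polyderiv_def moment_def dderiv_linear_form poly_altdef)
qed

lemma homogeneous_moment: "moment s \<in> homogeneous_part 1"
  unfolding moment_def by (rule homogeneous_linear_form)

lemma moment_nonzero: "moment (s :: 'a::comm_ring_1) \<noteq> 0"
proof
  assume "moment s = 0"
  then have "linear_coeff (moment s) = (\<lambda>_. 0)" by (simp add: linear_coeff_def fun_eq_iff)
  moreover obtain v where "var_index v = 0"
    using bij_var_index by (metis bij_betw_apply bij_betw_imp_surj_on image_iff lessThan_iff zero_less_numeral)
  ultimately show False by (auto simp: moment_def fun_eq_iff dest!: spec[of _ v])
qed

lemma polyderiv_sum_left: "polyderiv (\<Sum>i\<in>A. smult (c i) (w i)) F = (\<Sum>i\<in>A. cmul (c i) (polyderiv (w i) F))"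
proof (induction A rule: infinite_finite_induct)
  case (insert x A)
  have "polyderiv (smult c p + q) F = cmul c (polyderiv p F) + polyderiv q F" for c p q
  proof -
    have "cmul (c * a + b) r = cmul c (cmul a r) + cmul b r" for a b and r :: "(4, 'a) mpoly"
      by (rule poly_mapping_eqI) (simp add: lookup_add algebra_simps)
    then show ?thesis by (simp add: polyderiv_def dderiv_def sum.distrib cmul_sum)
  qed
  then show ?case using insert by simp
qed (simp_all add: polyderiv_def dderiv_def cmul_def)

lemma pderiv_var_polyderiv: "pderiv_var v F = polyderiv (Polynomial.monom 1 (var_index v)) F"
proof -
  have "inj var_index" using bij_var_index by (simp add: bij_betw_def)
  then have "(\<Sum>w\<in>UNIV. cmul (if var_index v = var_index w then 1 else 0) (pderiv_var w F)) =
      (\<Sum>w\<in>UNIV. if w = v then pderiv_var v F else 0)"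
    by (intro sum.cong) (auto simp: inj_eq cmul_def)
  then show ?thesis by (simp add: polyderiv_def dderiv_def)
qed

lemma polyderiv_zero [simp]: "polyderiv q 0 = 0"
  by (simp add: polyderiv_def)

lemma polyderiv_add: "polyderiv q (F + G) = polyderiv q F + polyderiv q G"
  by (simp add: polyderiv_def dderiv_add)

lemma polyderiv_commute: "polyderiv p (polyderiv q F) = polyderiv q (polyderiv p F)"
  by (simp add: polyderiv_def dderiv_commute)

lemma polyderiv_mult: "polyderiv q (F * G) = polyderiv q F * G + F * polyderiv q G"
  by (simp add: polyderiv_def dderiv_mult)

lemma homogeneous_polyderiv: "F \<in> homogeneous_part d \<Longrightarrow> polyderiv q F \<in> homogeneous_part (d - 1)"
  unfolding polyderiv_def by (rule homogeneous_dderiv)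

lemma polyderiv_power_eq_0: "polyderiv q F = 0 \<Longrightarrow> polyderiv q (F ^ n) = 0"
proof (induction n)
  case 0
  then show ?case by (simp add: polyderiv_def dderiv_constant homogeneous_one)
qed (simp add: polyderiv_mult)

lemma foldr_polyderiv_zero [simp]: "foldr polyderiv qs 0 = 0"
  by (induction qs) simp_all

lemma foldr_polyderiv_add: "foldr polyderiv qs (F + G) = foldr polyderiv qs F + foldr polyderiv qs G"
  by (induction qs) (simp_all add: polyderiv_add)

lemma foldr_polyderiv_sum: "foldr polyderiv qs (sum f A) = (\<Sum>x\<in>A. foldr polyderiv qs (f x))"
  by (induction A rule: infinite_finite_induct) (simp_all add: foldr_polyderiv_add)

lemma foldr_polyderiv_commute: "polyderiv q (foldr polyderiv qs F) = foldr polyderiv qs (polyderiv q F)"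
  by (induction qs) (simp_all add: polyderiv_commute[of q])

lemma foldr_polyderiv_filter:
  "foldr polyderiv qs F = foldr polyderiv (filter (\<lambda>q. \<not> P q) qs) (foldr polyderiv (filter P qs) F)"
  by (induction qs) (simp_all add: foldr_polyderiv_commute)

lemma foldr_polyderiv_homogeneous_eq_0:
  assumes "F \<in> homogeneous_part d" "d < length qs"
  shows "foldr polyderiv qs F = 0"
  using assms
proof (induction qs arbitrary: F d)
  case (Cons q qs)
  show ?case
  proof (cases d)
    case 0
    then have "polyderiv q F = 0" using Cons.prems by (simp add: polyderiv_def dderiv_constant)
    then show ?thesis by (simp add: foldr_polyderiv_commute)
  next
    case (Suc d')
    then show ?thesis
      using Cons.IH[of "polyderiv q F" d'] homogeneous_polyderiv[OF Cons.prems(1), of q] Cons.prems(2)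
      by (simp add: foldr_polyderiv_commute)
  qed
qed simp

lemma homogeneous_foldr_polyderiv:
  "F \<in> homogeneous_part d \<Longrightarrow> foldr polyderiv qs F \<in> homogeneous_part (d - length qs)"
proof (induction qs)
  case (Cons q qs)
  then show ?case using homogeneous_polyderiv[of "foldr polyderiv qs F" "d - length qs" q] by simp
qed simp

lemma foldr_polyderiv_power_mult:
  assumes "\<And>q. q \<in> set qs \<Longrightarrow> polyderiv q l = 0"
  shows "foldr polyderiv qs (l ^ t * g) = l ^ t * foldr polyderiv qs g"
  using assms by (induction qs) (simp_all add: polyderiv_mult polyderiv_power_eq_0)

text \<open>A direction whose polynomial vanishes at \<open>s\<close> kills \<open>moment s\<close>,
  so its derivative passes through the power and acts on \<open>g\<close> alone. More than
  \<open>r\<close> such derivatives kill \<open>g\<close>, and derivatives commute.\<close>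

lemma foldr_polyderiv_moment_power_eq_0:
  assumes g: "g \<in> homogeneous_part r" and deg: "\<And>q. q \<in> set qs \<Longrightarrow> Polynomial.degree q < 4"
    and len: "r < length (filter (\<lambda>q. poly q s = 0) qs)"
  shows "foldr polyderiv qs (moment s ^ t * g) = 0"
proof -
  have "foldr polyderiv (filter (\<lambda>q. poly q s = 0) qs) (moment s ^ t * g) =
     moment s ^ t * foldr polyderiv (filter (\<lambda>q. poly q s = 0) qs) g"
    by (rule foldr_polyderiv_power_mult) (simp add: polyderiv_moment deg)
  then show ?thesis
    by (subst foldr_polyderiv_filter[where P = "\<lambda>q. poly q s = 0"])
      (simp add: foldr_polyderiv_homogeneous_eq_0[OF g len])
qed

text \<open>Lagrange polynomials without their denominators. For four nodes they are a basis of the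
  polynomials of degree at most 3, that is, of the directions; the node opposite to each is the only
  one where it does not vanish.\<close>

definition lagrange :: "'a set \<Rightarrow> 'a \<Rightarrow> 'a::field poly"
  where "lagrange A x = (\<Prod>y\<in>A - {x}. [:- y, 1:])"

lemma poly_lagrange: "finite A \<Longrightarrow> x \<in> A \<Longrightarrow> y \<in> A \<Longrightarrow> poly (lagrange A x) y = 0 \<longleftrightarrow> x \<noteq> y"
  by (auto simp: lagrange_def poly_prod)

lemma degree_prod_linear: "finite A \<Longrightarrow> Polynomial.degree (\<Prod>y\<in>A. [:- y, 1 :: 'a::field:]) = card A"
  by (subst degree_prod_eq_sum_degree) auto

lemma lagrange_expansion:
  assumes A: "finite A" "card A = 4" and q: "Polynomial.degree q < 4"
  shows "q = (\<Sum>x\<in>A. smult (poly q x / poly (lagrange A x) x) (lagrange A x))"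
proof (rule poly_eqI_degree[of A])
  fix y assume y: "y \<in> A"
  have "poly (\<Sum>x\<in>A. smult (poly q x / poly (lagrange A x) x) (lagrange A x)) y =
     (\<Sum>x\<in>A. if x = y then poly q y else 0)"
    unfolding poly_sum by (rule sum.cong) (use A y poly_lagrange in auto)
  then show "poly q y = poly (\<Sum>x\<in>A. smult (poly q x / poly (lagrange A x) x) (lagrange A x)) y"
    using A y by simp
next
  show "Polynomial.degree (\<Sum>x\<in>A. smult (poly q x / poly (lagrange A x) x) (lagrange A x)) < card A"
    using A by (intro degree_sum_less)
      (auto intro!: le_less_trans[OF degree_smult_le] simp: lagrange_def degree_prod_linear)
qed (use A q in auto)

lemma polyderiv_only_one:
  assumes A: "finite A" "card A = 4" "x \<in> A" and 0: "\<And>y. y \<in> A \<Longrightarrow> y \<noteq> x \<Longrightarrow> polyderiv (lagrange A y) F = 0"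
    and q: "Polynomial.degree q < 4"
  shows "polyderiv q F = cmul (poly q x / poly (lagrange A x) x) (polyderiv (lagrange A x) F)"
proof -
  have "polyderiv q F = (\<Sum>y\<in>A. cmul (poly q y / poly (lagrange A y) y) (polyderiv (lagrange A y) F))"
    by (subst lagrange_expansion[OF A(1,2) q]) (rule polyderiv_sum_left)
  also have "\<dots> = (\<Sum>y\<in>A. if y = x then cmul (poly q x / poly (lagrange A x) x) (polyderiv (lagrange A x) F) else 0)"
    by (rule sum.cong) (auto simp: 0)
  finally show ?thesis using A by simp
qed

text \<open>Three of the four basis directions kill \<open>F\<close>, so every derivative is a
  multiple of the one along \<open>lagrange A x\<close>, with factor proportional to the value at
  \<open>x\<close>. As the \<open>qs\<close> do not vanish at \<open>x\<close>, no factor is lost: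
  once one derivative of \<open>F\<close> is 0, all are, and \<open>F\<close>, of positive degree,
  is 0.\<close>

lemma foldr_polyderiv_only_one_eq_0:
  fixes F :: "(4, 'a::field_char_0) mpoly"
  assumes A: "finite A" "card A = 4" "x \<in> A" and 0: "\<And>y. y \<in> A \<Longrightarrow> y \<noteq> x \<Longrightarrow> polyderiv (lagrange A y) F = 0"
    and F: "F \<in> homogeneous_part (length qs)"
    and qs: "\<And>q. q \<in> set qs \<Longrightarrow> Polynomial.degree q < 4" "\<And>q. q \<in> set qs \<Longrightarrow> poly q x \<noteq> 0"
    and eq: "foldr polyderiv qs F = 0"
  shows "F = 0"
  using 0 F qs eq
proof (induction qs arbitrary: F)
  case (Cons q qs)
  let ?W = "lagrange A x"
  have "polyderiv q F = 0"
  proof (rule Cons.IH)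
    show "polyderiv q F \<in> homogeneous_part (length qs)"
      using homogeneous_polyderiv[OF Cons.prems(2), of q] by simp
    show "foldr polyderiv qs (polyderiv q F) = 0"
      using Cons.prems(5) by (simp add: foldr_polyderiv_commute)
    show "polyderiv (lagrange A y) (polyderiv q F) = 0" if "y \<in> A" "y \<noteq> x" for y
      using Cons.prems(1)[OF that] by (simp add: polyderiv_commute[of "lagrange A y"])
  qed (use Cons.prems in auto)
  moreover have "polyderiv q F = cmul (poly q x / poly ?W x) (polyderiv ?W F)"
    by (rule polyderiv_only_one[OF A Cons.prems(1)]) (use Cons.prems in auto)
  moreover have "poly q x / poly ?W x \<noteq> 0"
    using poly_lagrange[of A x x] A Cons.prems(4)[of q] by simp
  ultimately have W: "polyderiv ?W F = 0" by simp
  show ?case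
  proof (rule pderiv_var_eq_0_imp[OF Cons.prems(2)])
    fix v
    have "Polynomial.degree (Polynomial.monom (1::'a) (var_index v)) < 4"
      using bij_betw_apply[OF bij_var_index, of v] by (simp add: degree_monom_eq)
    then show "pderiv_var v F = 0"
      unfolding pderiv_var_polyderiv
      by (subst polyderiv_only_one[OF A Cons.prems(1)]) (auto simp: W cmul_def)
  qed simp
qed simp

text \<open>To isolate the term of \<open>i\<^sub>0\<close>, apply \<open>t + r\<close> derivatives whose directions vanish at up to three of the other
  points, so that more than \<open>r\<close> of them vanish at each one. This only works on terms that three further
  directions \<open>w\<^sub>2, w\<^sub>3, w\<^sub>4\<close>, spanning the directions that vanish at \<open>i\<^sub>0\<close>, already kill; a descending induction on
  the number of derivatives along them reduces to that case.\<close>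
lemma no_syzygies_moment:
  fixes a :: "nat \<Rightarrow> 'a::field_char_0"
  assumes a: "inj_on a {..<n}" and n: "4 \<le> n" and rt: "r < t" and nr: "n * (r + 1) \<le> 3 * (t + r) + 1"
  shows "no_syzygies n t (\<lambda>i. moment (a i)) r"
  unfolding no_syzygies_def
proof (intro allI impI)
  fix g and i0 :: nat
  assume g: "\<forall>i<n. g i \<in> homogeneous_part r" and syz: "(\<Sum>i<n. moment (a i) ^ t * g i) = 0" and i0: "i0 < n"
  have "3 \<le> card ({..<n} - {i0})" using n i0 by simp
  then obtain T where T: "T \<subseteq> {..<n} - {i0}" "card T = 3" by (metis obtain_subset_with_card_n)
  then obtain j2 j3 j4 where j: "T = {j2, j3, j4}" "j2 \<noteq> j3" "j2 \<noteq> j4" "j3 \<noteq> j4" by (auto simp: card_3_iff)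
  have jn: "j2 < n" "j3 < n" "j4 < n" "j2 \<noteq> i0" "j3 \<noteq> i0" "j4 \<noteq> i0" using T j by auto
  define A where "A = a ` {i0, j2, j3, j4}"
  have aeq: "a i = a j \<longleftrightarrow> i = j" if "i < n" "j < n" for i j
    using inj_on_eq_iff[OF a] that by auto
  have cA: "card {i0, j2, j3, j4} = 4" using j jn by auto
  have inj: "inj_on a {i0, j2, j3, j4}" by (rule inj_on_subset[OF a]) (use jn i0 in auto)
  have A: "finite A" "card A = 4" "a i0 \<in> A"
    unfolding A_def card_image[OF inj] cA by auto
  define w2 w3 w4 where w_def: "w2 = lagrange A (a j2)" "w3 = lagrange A (a j3)" "w4 = lagrange A (a j4)"
  have w0: "poly w2 (a j) = 0 \<longleftrightarrow> j \<noteq> j2" "poly w3 (a j) = 0 \<longleftrightarrow> j \<noteq> j3" "poly w4 (a j) = 0 \<longleftrightarrow> j \<noteq> j4"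
    if "j \<in> {i0, j2, j3, j4}" for j
    using that poly_lagrange[OF A(1)] aeq jn i0 unfolding w_def A_def by auto
  have "Polynomial.degree (lagrange A y) < 4" if "y \<in> A" for y
    using that A by (simp add: lagrange_def degree_prod_linear)
  then have wdeg: "Polynomial.degree w2 < 4" "Polynomial.degree w3 < 4" "Polynomial.degree w4 < 4"
    unfolding w_def A_def by auto
  let ?l = "moment (a i0)"
  have wl: "polyderiv w2 ?l = 0" "polyderiv w3 ?l = 0" "polyderiv w4 ?l = 0"
    using wdeg w0[of i0] jn by (simp_all add: polyderiv_moment)
  define ws where "ws b c d = replicate b w2 @ replicate c w3 @ replicate d w4" for b c d :: nat
  define Q where "Q b c d = foldr polyderiv (ws b c d) (g i0)" for b c d
  have hom: "Q b c d \<in> homogeneous_part (r - (b + c + d))" for b c d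
    using homogeneous_foldr_polyderiv[of "g i0" r "ws b c d"] g i0 by (simp add: Q_def ws_def add.assoc)
  have step: "polyderiv w2 (Q b c d) = Q (Suc b) c d" "polyderiv w3 (Q b c d) = Q b (Suc c) d"
    "polyderiv w4 (Q b c d) = Q b c (Suc d)" for b c d
    by (simp_all add: Q_def ws_def foldr_polyderiv_commute del: foldr_replicate)
  have "b + c + d \<le> r \<Longrightarrow> Q b c d = 0" for b c d
  proof (induction "r - (b + c + d)" arbitrary: b c d rule: less_induct)
    case less
    let ?F = "?l ^ t * Q b c d" and ?R = "t + (r - (b + c + d))"
    have kill: "polyderiv w2 (Q b c d) = 0 \<and> polyderiv w3 (Q b c d) = 0 \<and> polyderiv w4 (Q b c d) = 0"
    proof (cases "b + c + d < r")
      case True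
      then show ?thesis using less.hyps by (simp add: step)
    next
      case False
      then show ?thesis using hom[of b c d] less.prems by (simp add: polyderiv_def dderiv_constant)
    qed
    \<comment> \<open>The number of directions vanishing at \<open>a j\<close> that are still
      missing from \<open>r + 1\<close>. For example \<open>w3\<close> and \<open>w4\<close> vanish
      at \<open>a j2\<close>, so \<open>c + d\<close> of them are already present there; outside
      \<open>T\<close> no help from the \<open>w\<close>'s is counted.\<close>
    define need where "need j = (if j = j2 then r + 1 - (c + d) else if j = j3 then r + 1 - (b + d)
      else if j = j4 then r + 1 - (b + c) else r + 1)" for j
    let ?J = "{..<n} - {i0}"
    have need_le: "need j \<le> ?R" for j using less.prems rt unfolding need_def by auto
    \<comment> \<open>The hypothesis on \<open>n\<close> gives
      \<open>(n - 1) * (r + 1) + r \<le> 3 * (t + r)\<close>, a reserve of \<open>r\<close>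
      incidences. Each derivative along a \<open>w\<close> vanishes at two points of
      \<open>T\<close> where an ordinary one may vanish at three points, so it wastes one incidence;
      there are \<open>b + c + d \<le> r\<close> of them.\<close>
    have sum_need: "(\<Sum>j\<in>?J. need j) \<le> 3 * ?R"
    proof -
      have "(\<Sum>j\<in>?J. need j) = (\<Sum>j\<in>?J - T. need j) + (\<Sum>j\<in>T. need j)"
        by (rule sum.subset_diff) (use T in auto)
      also have "(\<Sum>j\<in>?J - T. need j) = (\<Sum>j\<in>?J - T. r + 1)"
        by (rule sum.cong) (auto simp: need_def j)
      also have "card (?J - T) = n - 4"
        using card_Diff_subset[OF _ T(1)] T i0 by (simp add: finite_subset[OF T(1)])
      then have "(\<Sum>j\<in>?J - T. r + 1) = (n - 4) * (r + 1)" by simp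
      also have "(\<Sum>j\<in>T. need j) = (r + 1 - (c + d)) + ((r + 1 - (b + d)) + (r + 1 - (b + c)))"
        using j by (simp add: need_def)
      also have "\<dots> = 3 * (r + 1) - 2 * (b + c + d)" using less.prems by simp
      finally have *: "(\<Sum>j\<in>?J. need j) + 2 * (b + c + d) = (n - 4) * (r + 1) + 3 * (r + 1)"
        using less.prems by simp
      have "(n - 4) * (r + 1) + 4 * (r + 1) = n * (r + 1)"
        using n by (metis add_mult_distrib le_add_diff_inverse2)
      moreover have "(n - 4) * (r + 1) + 3 * (r + 1) + (r + 1) = (n - 4) * (r + 1) + 4 * (r + 1)" by simp
      ultimately have "(\<Sum>j\<in>?J. need j) + 2 * (b + c + d) + (r + 1) = n * (r + 1)" using * by metis
      then have "(\<Sum>j\<in>?J. need j) + 2 * (b + c + d) + r \<le> 3 * (t + r)" using nr by linarith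
      then show ?thesis using less.prems by arith
    qed
    obtain f where f: "\<And>x. x < ?R \<Longrightarrow> f x \<subseteq> ?J" "\<And>x. x < ?R \<Longrightarrow> card (f x) \<le> 3"
      "\<And>j. j \<in> ?J \<Longrightarrow> need j \<le> card {x. x < ?R \<and> j \<in> f x}"
      using cyclic_covering[of ?J need ?R 3] need_le sum_need by auto
    \<comment> \<open>The hyperplane through the at most three points selected by
      \<open>f x\<close>; it misses the point of \<open>i0\<close>, which lies outside
      \<open>f x\<close>.\<close>
    define u where "u x = (\<Prod>y\<in>a ` f x. [:- y, 1:])" for x
    have fin: "finite (f x)" if "x < ?R" for x using f(1)[OF that] finite_subset by blast
    have u0: "poly (u x) (a j) = 0 \<longleftrightarrow> j \<in> f x" if "x < ?R" "j < n" for x j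
      using f(1)[OF that(1)] fin[OF that(1)] aeq that(2) by (auto simp: u_def poly_prod)
    have udeg: "Polynomial.degree (u x) < 4" if "x < ?R" for x
      using f(2)[OF that] fin[OF that] card_image_le[OF fin[OF that], of a] by (simp add: u_def degree_prod_linear)
    have nz: "poly (u x) (a i0) \<noteq> 0" if "x < ?R" for x
      using u0[OF that i0] f(1)[OF that] by auto
    let ?us = "map u [0..<?R]"
    have deg: "Polynomial.degree q < 4" if "q \<in> set (?us @ ws b c d)" for q
      using that udeg wdeg by (auto simp: ws_def)
    have 0: "foldr polyderiv (?us @ ws b c d) (moment (a j) ^ t * g j) = 0" if j': "j \<in> ?J" for j
    proof (rule foldr_polyderiv_moment_power_eq_0[of _ r])
      have "length (filter (\<lambda>q. poly q (a j) = 0) ?us) = card {x. x < ?R \<and> poly (u x) (a j) = 0}"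
        by (subst length_filter_conv_card) (auto intro!: arg_cong[of _ _ card])
      also have "{x. x < ?R \<and> poly (u x) (a j) = 0} = {x. x < ?R \<and> j \<in> f x}"
        using u0 j' by auto
      finally have "need j \<le> length (filter (\<lambda>q. poly q (a j) = 0) ?us)" using f(3)[OF j'] by simp
      moreover have "r < need j + length (filter (\<lambda>q. poly q (a j) = 0) (ws b c d))"
        using w0[of j] j less.prems by (auto simp: need_def ws_def)
      ultimately show "r < length (filter (\<lambda>q. poly q (a j) = 0) (?us @ ws b c d))" by simp
    qed (use g j' deg in auto)
    have "0 = foldr polyderiv (?us @ ws b c d) (\<Sum>i<n. moment (a i) ^ t * g i)" using syz by simp
    also have "\<dots> = (\<Sum>i<n. foldr polyderiv (?us @ ws b c d) (moment (a i) ^ t * g i))"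
      by (rule foldr_polyderiv_sum)
    also have "\<dots> = foldr polyderiv (?us @ ws b c d) (?l ^ t * g i0)"
      using i0 0 by (subst sum.remove[of _ i0]) (auto intro!: sum.neutral)
    also have "\<dots> = foldr polyderiv ?us ?F"
    proof -
      have "foldr polyderiv (ws b c d) (?l ^ t * g i0) = ?F"
        unfolding Q_def by (rule foldr_polyderiv_power_mult) (use wl in \<open>auto simp: ws_def\<close>)
      then show ?thesis by (simp only: foldr_append comp_apply)
    qed
    finally have eq: "foldr polyderiv ?us ?F = 0" by simp
    have "?F = 0"
    proof (rule foldr_polyderiv_only_one_eq_0[OF A])
      fix y assume "y \<in> A" "y \<noteq> a i0"
      then show "polyderiv (lagrange A y) ?F = 0"
        using kill wl unfolding A_def w_def by (auto simp: polyderiv_mult polyderiv_power_eq_0)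
    next
      show "?F \<in> homogeneous_part (length ?us)"
        using homogeneous_linear_power_mult[OF homogeneous_moment hom] by simp
    qed (use udeg nz eq in \<open>auto simp del: foldr_map\<close>)
    then show ?case using moment_nonzero[of "a i0"] by simp
  qed
  from this[of 0 0 0] show "g i0 = 0" by (simp add: Q_def ws_def)
qed

section \<open>Regular functions on tuples of linear forms, and openness\<close>

definition monom_eval :: "('v \<Rightarrow> 'a::comm_ring_1) \<Rightarrow> ('v \<Rightarrow>\<^sub>0 nat) \<Rightarrow> 'a"
  where "monom_eval c m = (\<Prod>v\<in>Poly_Mapping.keys m. c v ^ Poly_Mapping.lookup m v)"

lemma monom_eval_superset: "finite A \<Longrightarrow> Poly_Mapping.keys m \<subseteq> A \<Longrightarrow>
    monom_eval c m = (\<Prod>v\<in>A. c v ^ Poly_Mapping.lookup m v)"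
  unfolding monom_eval_def by (rule prod.mono_neutral_left) (auto simp: in_keys_iff)

lemma monom_eval_add: "monom_eval c (m + m') = monom_eval c m * monom_eval c m'"
  using keys_add[of m m']
  by (simp add: monom_eval_superset[of "Poly_Mapping.keys m \<union> Poly_Mapping.keys m'"] lookup_add power_add prod.distrib)

lemma poly_eval_superset: "finite A \<Longrightarrow> Poly_Mapping.keys p \<subseteq> A \<Longrightarrow>
    poly_eval c p = (\<Sum>m\<in>A. Poly_Mapping.lookup p m * monom_eval c m)"
  unfolding poly_eval_def monom_eval_def by (rule sum.mono_neutral_left) (auto simp: in_keys_iff)

lemma poly_eval_add: "poly_eval c (p + q) = poly_eval c p + poly_eval c q"
  using keys_add[of p q]
  by (simp add: poly_eval_superset[of "Poly_Mapping.keys p \<union> Poly_Mapping.keys q"] lookup_add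
    algebra_simps sum.distrib)

lemma poly_eval_zero [simp]: "poly_eval c 0 = 0"
  by (simp add: poly_eval_def)

lemma poly_eval_single: "poly_eval c (Poly_Mapping.single m a) = a * monom_eval c m"
  by (subst poly_eval_superset[of "{m}"]) auto

lemma poly_eval_mult: "poly_eval c (p * q) = poly_eval c p * poly_eval c q"
proof -
  have "poly_eval c (p * Poly_Mapping.single k b) = poly_eval c p * poly_eval c (Poly_Mapping.single k b)" for k b
    by (rule mpoly_additive_eqI[of "\<lambda>p. poly_eval c (p * Poly_Mapping.single k b)"
        "\<lambda>p. poly_eval c p * poly_eval c (Poly_Mapping.single k b)" p])
      (simp_all add: poly_eval_add distrib_right mult_single poly_eval_single monom_eval_add)
  then show ?thesis
    by (intro mpoly_additive_eqI[of "\<lambda>q. poly_eval c (p * q)" "\<lambda>q. poly_eval c p * poly_eval c q" q])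
      (simp_all add: poly_eval_add distrib_left)
qed

definition supported_in :: "'v set \<Rightarrow> ('v, 'a::comm_ring_1) mpoly \<Rightarrow> bool"
  where "supported_in V p \<longleftrightarrow> (\<forall>m\<in>Poly_Mapping.keys p. Poly_Mapping.keys m \<subseteq> V)"

lemma supported_in_add: "supported_in V p \<Longrightarrow> supported_in V q \<Longrightarrow> supported_in V (p + q)"
  unfolding supported_in_def using keys_add[of p q] by blast

lemma supported_in_mult: "supported_in V p \<Longrightarrow> supported_in V q \<Longrightarrow> supported_in V (p * q)"
  unfolding supported_in_def
proof
  fix m
  assume p: "\<forall>m\<in>Poly_Mapping.keys p. Poly_Mapping.keys m \<subseteq> V"
    and q: "\<forall>m\<in>Poly_Mapping.keys q. Poly_Mapping.keys m \<subseteq> V"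
    and "m \<in> Poly_Mapping.keys (p * q)"
  then obtain a b where ab: "m = a + b" "a \<in> Poly_Mapping.keys p" "b \<in> Poly_Mapping.keys q"
    using keys_mult[of p q] by auto
  then show "Poly_Mapping.keys m \<subseteq> V"
    using keys_add[of a b] bspec[OF p ab(2)] bspec[OF q ab(3)] by auto
qed

definition regular_function :: "nat \<Rightarrow> ((nat \<Rightarrow> ('v, 'a::comm_ring_1) mpoly) \<Rightarrow> 'a) \<Rightarrow> bool"
  where "regular_function n f \<longleftrightarrow> (\<exists>q. supported_in ({..<n} \<times> UNIV) q \<and>
    (\<forall>l\<in>linear_form_tuples n. poly_eval (tuple_coords l) q = f l))"

lemma regular_cong:
  "regular_function n f \<Longrightarrow> (\<And>l. l \<in> linear_form_tuples n \<Longrightarrow> f l = g l) \<Longrightarrow> regular_function n g"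
  unfolding regular_function_def by metis

lemma regular_const: "regular_function n (\<lambda>l. c)"
  unfolding regular_function_def
  by (rule exI[of _ "Poly_Mapping.single 0 c"])
    (auto simp: supported_in_def poly_eval_single monom_eval_def in_keys_iff lookup_single when_def split: if_splits)

lemma regular_coord:
  assumes "i < n"
  shows "regular_function n (\<lambda>l. linear_coeff (l i) v)"
proof -
  let ?q = "Poly_Mapping.single (Poly_Mapping.single (i, v) 1) 1 :: (nat \<times> 'a, 'b) mpoly"
  have "supported_in ({..<n} \<times> UNIV) ?q"
    using assms by (auto simp: supported_in_def)
  moreover have "poly_eval (tuple_coords l) ?q = linear_coeff (l i) v" for l
    by (simp add: poly_eval_single monom_eval_def tuple_coords_def linear_coeff_def)
  ultimately show ?thesis unfolding regular_function_def by blast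
qed

lemma regular_add:
  "regular_function n f \<Longrightarrow> regular_function n g \<Longrightarrow> regular_function n (\<lambda>l. f l + g l)"
  unfolding regular_function_def
  by (elim exE, rename_tac p q, rule_tac x = "p + q" in exI) (auto simp: supported_in_add poly_eval_add)

lemma regular_mult:
  "regular_function n f \<Longrightarrow> regular_function n g \<Longrightarrow> regular_function n (\<lambda>l. f l * g l)"
  unfolding regular_function_def
  by (elim exE, rename_tac p q, rule_tac x = "p * q" in exI) (auto simp: supported_in_mult poly_eval_mult)

lemma regular_sum:
  "(\<And>x. x \<in> A \<Longrightarrow> regular_function n (f x)) \<Longrightarrow> regular_function n (\<lambda>l. \<Sum>x\<in>A. f x l)"
  by (induction A rule: infinite_finite_induct) (auto intro: regular_const regular_add)

lemma regular_prod:
  "(\<And>x. x \<in> A \<Longrightarrow> regular_function n (f x)) \<Longrightarrow> regular_function n (\<lambda>l. \<Prod>x\<in>A. f x l)"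
  by (induction A rule: infinite_finite_induct) (auto intro: regular_const regular_mult)

lemma regular_det:
  assumes "\<And>i j. i < N \<Longrightarrow> j < N \<Longrightarrow> regular_function n (\<lambda>l. A l i j)"
  shows "regular_function n (\<lambda>l. det (mat N N (\<lambda>(i, j). A l i j)))"
proof (rule regular_cong)
  show "regular_function n (\<lambda>l. \<Sum>p\<in>{p. p permutes {0..<N}}. signof p * (\<Prod>i\<in>{0..<N}. A l i (p i)))"
    by (intro regular_sum regular_mult regular_const regular_prod assms)
      (metis (mono_tags) atLeastLessThan_iff mem_Collect_eq permutes_in_image)+
  have "(\<Prod>i\<in>{0..<N}. A l i (p i)) = (\<Prod>i=0..<N. mat N N (\<lambda>(i, j). A l i j) $$ (i, p i))"
    if "p permutes {0..<N}" for l p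
    by (rule prod.cong) (use permutes_in_image[OF that] in auto)
  then have 1: "(\<Sum>p\<in>{p. p permutes {0..<N}}. signof p * (\<Prod>i\<in>{0..<N}. A l i (p i))) =
      (\<Sum>p\<in>{p. p permutes {0..<N}}. signof p * (\<Prod>i=0..<N. mat N N (\<lambda>(i, j). A l i j) $$ (i, p i)))" for l
    by (intro sum.cong refl) (simp only: mem_Collect_eq)
  show "(\<Sum>p\<in>{p. p permutes {0..<N}}. signof p * (\<Prod>i\<in>{0..<N}. A l i (p i))) =
      det (mat N N (\<lambda>(i, j). A l i j))" for l
    unfolding 1 by (rule det_def'[symmetric]) simp
qed

lemma zariski_open_regular:
  assumes "regular_function n f"
  shows "zariski_open n {l \<in> linear_form_tuples n. f l \<noteq> 0}"
proof -
  obtain q where q: "supported_in ({..<n} \<times> UNIV) q"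
    "\<forall>l\<in>linear_form_tuples n. poly_eval (tuple_coords l) q = f l"
    using assms unfolding regular_function_def by blast
  then show ?thesis
    unfolding zariski_open_def by (intro exI[of _ "{q}"]) (auto simp: supported_in_def)
qed

lemma lookup_var_mult: "Poly_Mapping.lookup (var v * p) m =
    (if Poly_Mapping.lookup m v > 0 then Poly_Mapping.lookup p (m - Poly_Mapping.single v 1) else 0)"
proof (rule mpoly_additive_eqI[of "\<lambda>p. Poly_Mapping.lookup (var v * p) m"
    "\<lambda>p. if Poly_Mapping.lookup m v > 0 then Poly_Mapping.lookup p (m - Poly_Mapping.single v 1) else 0" p])
  fix k a
  let ?e = "Poly_Mapping.single v (1::nat)"
  have "k + ?e = m \<longleftrightarrow> Poly_Mapping.lookup m v > 0 \<and> k = m - ?e"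
    using monom_split[of m v] by (auto simp: lookup_add)
  then show "Poly_Mapping.lookup (var v * Poly_Mapping.single k a) m =
     (if Poly_Mapping.lookup m v > 0 then Poly_Mapping.lookup (Poly_Mapping.single k a) (m - ?e) else 0)"
    by (auto simp: var_def mult_single lookup_single when_def add.commute[of k])
qed (simp_all add: lookup_add distrib_left)

lemma regular_lookup_power_mult:
  fixes p :: "('v::finite, 'a::comm_ring_1) mpoly"
  assumes "i < n"
  shows "regular_function n (\<lambda>l. Poly_Mapping.lookup (l i ^ t * p) m)"
proof (induction t arbitrary: m)
  case 0
  then show ?case by (simp add: regular_const)
next
  case (Suc t)
  have IH: "regular_function n (\<lambda>l. if Poly_Mapping.lookup m v > 0
      then Poly_Mapping.lookup (l i ^ t * p) (m - Poly_Mapping.single v 1) else 0)" for v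
    by (cases "Poly_Mapping.lookup m v > 0") (simp_all add: Suc regular_const)
  show ?case
  proof (rule regular_cong)
    show "regular_function n (\<lambda>l. \<Sum>v\<in>UNIV. linear_coeff (l i) v *
       (if Poly_Mapping.lookup m v > 0 then Poly_Mapping.lookup (l i ^ t * p) (m - Poly_Mapping.single v 1) else 0))"
      by (intro regular_sum regular_mult regular_coord assms IH)
    fix l :: "nat \<Rightarrow> ('v, 'a) mpoly" assume "l \<in> linear_form_tuples n"
    then have l: "l i \<in> homogeneous_part 1" using assms by (auto simp: linear_form_tuples_def)
    have "l i ^ Suc t * p = (\<Sum>v\<in>UNIV. cmul (linear_coeff (l i) v) (var v)) * (l i ^ t * p)"
      using linear_form_eq[OF l] by (simp add: mult.assoc)
    also have "\<dots> = (\<Sum>v\<in>UNIV. cmul (linear_coeff (l i) v) (var v * (l i ^ t * p)))"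
      by (simp add: sum_distrib_right mult_cmul_left)
    finally show "(\<Sum>v\<in>UNIV. linear_coeff (l i) v *
       (if Poly_Mapping.lookup m v > 0 then Poly_Mapping.lookup (l i ^ t * p) (m - Poly_Mapping.single v 1) else 0)) =
       Poly_Mapping.lookup (l i ^ Suc t * p) m"
      by (simp only: lookup_sum lookup_cmul lookup_var_mult)
  qed
qed

text \<open>Functionals \<open>\<psi> c\<close> dual to the independent family at \<open>l0\<close>
  give a square matrix of their values on the family at \<open>l\<close>. It is the identity at
  \<open>l0\<close>, its determinant is a polynomial in the coefficients of \<open>l\<close>, and
  any linear relation among the family is a kernel vector. Allowing \<open>n \<le> n'\<close> lets a
  condition on the first four forms be a regular function of all of them.\<close>

theorem no_syzygies_open:
  fixes l0 :: "nat \<Rightarrow> ('v::finite, 'a::field) mpoly"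
  assumes l0: "\<And>i. i < n \<Longrightarrow> l0 i \<in> homogeneous_part 1" and ns: "no_syzygies n t l0 r" and n: "n \<le> n'"
  obtains f where "regular_function n' f" "f l0 \<noteq> 0" "\<And>l. f l \<noteq> 0 \<Longrightarrow> no_syzygies n t l r"
proof -
  let ?C = "{..<n} \<times> (monoms r :: ('v \<Rightarrow>\<^sub>0 nat) set)"
  let ?f = "power_monomial t l0"
  have inj: "inj_on ?f ?C" and ind: "mp.independent (?f ` ?C)"
    using mp.independent_familyI[of ?C ?f] no_syzygies_imp_independent[OF ns] by auto
  interpret p: vector_space_pair "cmul :: 'a \<Rightarrow> ('v, 'a) mpoly \<Rightarrow> _" "(*)"
    by unfold_locales (auto simp: algebra_simps)
  have "\<exists>\<psi>. Vector_Spaces.linear cmul (*) \<psi> \<and> (\<forall>c'\<in>?C. \<psi> (?f c') = (if c' = c then 1 else 0))"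
    if "c \<in> ?C" for c
  proof -
    obtain \<psi> where "Vector_Spaces.linear cmul (*) \<psi>" "\<forall>x\<in>?f ` ?C. \<psi> x = (if x = ?f c then 1 else 0)"
      using p.linear_independent_extend[OF ind, of "\<lambda>x. if x = ?f c then 1 else 0"] by blast
    then show ?thesis using inj that by (intro exI[of _ \<psi>]) (auto simp: inj_on_eq_iff)
  qed
  then obtain \<psi> where lin: "\<And>c. c \<in> ?C \<Longrightarrow> Vector_Spaces.linear cmul (*) (\<psi> c)"
    and \<psi>: "\<And>c c'. c \<in> ?C \<Longrightarrow> c' \<in> ?C \<Longrightarrow> \<psi> c (?f c') = (if c' = c then 1 else 0)"
    by metis
  obtain e where e: "bij_betw e {0..<card ?C} ?C"
    using ex_bij_betw_nat_finite[of ?C] by auto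
  let ?N = "card ?C"
  define A where "A l i j = (\<Sum>m\<in>monoms (t + r).
      Poly_Mapping.lookup (power_monomial t l (e j)) m * \<psi> (e i) (monomial m))"
    for l :: "nat \<Rightarrow> ('v, 'a) mpoly" and i j
  define M where "M l = mat ?N ?N (\<lambda>(i, j). A l i j)" for l
  have M: "M l \<in> carrier_mat ?N ?N" for l by (simp add: M_def)
  have eC: "e i \<in> ?C" if "i < ?N" for i using bij_betw_apply[OF e] that by auto
  show thesis
  proof (rule that[of "\<lambda>l. det (M l)"])
    show "regular_function n' (\<lambda>l. det (M l))"
      unfolding M_def
    proof (rule regular_det)
      fix i j assume j: "j < ?N"
      obtain i' m' where e': "e j = (i', m')" "i' < n'" using eC[OF j] n by auto
      show "regular_function n' (\<lambda>l. A l i j)"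
        unfolding A_def e' power_monomial_def prod.case
        by (intro regular_sum regular_mult regular_const regular_lookup_power_mult e')
    qed
    have "M l0 = 1\<^sub>m ?N"
    proof (rule eq_matI)
      fix i j assume ij: "i < dim_row (1\<^sub>m ?N)" "j < dim_col (1\<^sub>m ?N)"
      then have eij: "e i \<in> ?C" "e j \<in> ?C" using eC by auto
      interpret l: Vector_Spaces.linear cmul "(*)" "\<psi> (e i)" by (rule lin[OF eij(1)])
      have "?f (e j) \<in> homogeneous_part (t + r)"
        using power_monomial_in_part[OF eij(2), of t l0] power_ideal_part_subset[of n l0 t r] l0 by auto
      then have "?f (e j) = (\<Sum>m\<in>monoms (t + r). cmul (Poly_Mapping.lookup (?f (e j)) m) (monomial m))"
        by (intro sum_cmul_monomial) (auto simp: homogeneous_part_iff)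
      then have "\<psi> (e i) (?f (e j)) = A l0 i j"
        unfolding A_def by (metis (no_types, lifting) l.scale l.sum sum.cong)
      moreover have "e i = e j \<longleftrightarrow> i = j"
        using bij_betw_imp_inj_on[OF e] ij by (auto simp: inj_on_eq_iff)
      ultimately show "M l0 $$ (i, j) = 1\<^sub>m ?N $$ (i, j)"
        using ij \<psi>[OF eij] by (auto simp: M_def)
    qed (auto simp: M_def)
    then show "det (M l0) \<noteq> 0" by simp
  next
    fix l :: "nat \<Rightarrow> ('v, 'a) mpoly" assume det: "det (M l) \<noteq> 0"
    show "no_syzygies n t l r"
    proof (rule independent_imp_no_syzygies)
      fix a assume s: "(\<Sum>c\<in>?C. cmul (a c) (power_monomial t l c)) = 0"
      let ?v = "vec ?N (\<lambda>j. a (e j))"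
      have "M l *\<^sub>v ?v = 0\<^sub>v ?N"
      proof (rule eq_vecI)
        fix i assume i: "i < dim_vec (0\<^sub>v ?N)"
        have "(M l *\<^sub>v ?v) $ i = (\<Sum>j\<in>{0..<?N}. A l i j * a (e j))"
          using i unfolding M_def by (simp add: scalar_prod_def del: card_cartesian_product)
        also have "\<dots> = (\<Sum>j\<in>{0..<?N}. \<Sum>m\<in>monoms (t + r).
            a (e j) * Poly_Mapping.lookup (power_monomial t l (e j)) m * \<psi> (e i) (monomial m))"
          unfolding A_def sum_distrib_right by (intro sum.cong refl) (simp only: mult_ac)
        also have "\<dots> = (\<Sum>m\<in>monoms (t + r). (\<Sum>j\<in>{0..<?N}.
            a (e j) * Poly_Mapping.lookup (power_monomial t l (e j)) m) * \<psi> (e i) (monomial m))"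
          by (subst sum.swap) (simp only: sum_distrib_right)
        also have "\<dots> = (\<Sum>m\<in>monoms (t + r). Poly_Mapping.lookup
            (\<Sum>c\<in>?C. cmul (a c) (power_monomial t l c)) m * \<psi> (e i) (monomial m))"
          by (simp only: lookup_sum lookup_cmul sum.reindex_bij_betw[OF e, of "\<lambda>c. a c * Poly_Mapping.lookup (power_monomial t l c) _"])
        also have "\<dots> = 0" by (simp only: s) simp
        finally show "(M l *\<^sub>v ?v) $ i = 0\<^sub>v ?N $ i" using i by simp
      qed (simp add: M_def)
      moreover have "?v \<in> carrier_vec ?N" by simp
      ultimately have v0: "?v = 0\<^sub>v ?N"
        using det det_0_iff_vec_prod_zero[OF M] by blast
      have a0: "a (e j) = 0" if "j < ?N" for j
      proof -
        have "?v $ j = 0\<^sub>v ?N $ j" by (simp only: v0)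
        then show ?thesis using that by (simp del: card_cartesian_product)
      qed
      show "\<forall>c\<in>?C. a c = 0"
      proof
        fix c assume "c \<in> ?C"
        then have "c \<in> e ` {0..<?N}" using bij_betw_imp_surj_on[OF e] by simp
        then show "a c = 0" using a0 by (elim imageE) (simp del: card_cartesian_product)
      qed
    qed
  qed
qed

section \<open>The quotient ring: cosets, graded pieces and the Artinian property\<close>

lemma (in vector_space) subspace_eq_if_dim_le:
  assumes "subspace U" "U \<subseteq> V" "V \<subseteq> span W" "finite W" "dim V \<le> dim U"
  shows "U = V"
proof (rule ccontr)
  assume "U \<noteq> V"
  then obtain v where v: "v \<in> V" "v \<notin> U" using assms(2) by auto
  obtain B where B: "B \<subseteq> U" "independent B" "span B = U" "finite B" "card B = dim U"
    using obtain_finite_basis[OF assms(1) subset_trans[OF assms(2,3)] assms(4)] .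
  have "independent (insert v B)" "v \<notin> B"
    using B v independent_insertI span_base by auto
  then have "Suc (card B) \<le> dim V"
    using independent_card_le_dim_finite[OF assms(3,4), of "insert v B"] B v assms(2) by auto
  then show False using assms(5) B(5) by simp
qed

lemma mpoly_ring_simps [simp]:
  "carrier mpoly_ring = UNIV" "x \<otimes>\<^bsub>mpoly_ring\<^esub> y = x * y" "x \<oplus>\<^bsub>mpoly_ring\<^esub> y = x + y"
  "\<zero>\<^bsub>mpoly_ring\<^esub> = 0" "\<one>\<^bsub>mpoly_ring\<^esub> = 1"
  by (simp_all add: ring_of_type_algebra_def)

lemma ring_mpoly_ring: "ring (mpoly_ring :: ('v, 'a::comm_ring_1) mpoly ring)"
  by (rule ring_from_type_algebra)

lemma ideal_mpoly_ringI:
  fixes I :: "('v, 'a::comm_ring_1) mpoly set"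
  assumes "0 \<in> I" "\<And>x y. x \<in> I \<Longrightarrow> y \<in> I \<Longrightarrow> x + y \<in> I" "\<And>x y. x \<in> I \<Longrightarrow> y * x \<in> I"
  shows "ideal I mpoly_ring"
proof -
  interpret R: ring "mpoly_ring :: ('v, 'a) mpoly ring" by (rule ring_mpoly_ring)
  have neg: "\<ominus>\<^bsub>mpoly_ring\<^esub> x = - x" for x :: "('v, 'a) mpoly"
    by (rule R.minus_equality) auto
  have inv: "inv\<^bsub>add_monoid mpoly_ring\<^esub> x = - x" for x :: "('v, 'a) mpoly"
    using neg[of x] by (simp add: a_inv_def)
  show ?thesis
  proof (rule idealI)
    show "subgroup I (add_monoid mpoly_ring)"
    proof (rule subgroup.intro)
      fix x assume "x \<in> I"
      then show "inv\<^bsub>add_monoid mpoly_ring\<^esub> x \<in> I"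
        unfolding inv using assms(3)[of x "-1"] by simp
    qed (simp_all add: assms)
  qed (use assms in \<open>auto simp: mult.commute intro: ring_mpoly_ring\<close>)
qed

lemma ideal_mpoly_ringD:
  fixes I :: "('v, 'a::comm_ring_1) mpoly set"
  assumes "ideal I mpoly_ring"
  shows "0 \<in> I" "x \<in> I \<Longrightarrow> y \<in> I \<Longrightarrow> x + y \<in> I" "x \<in> I \<Longrightarrow> y * x \<in> I"
proof -
  interpret I: ideal I mpoly_ring by fact
  show "0 \<in> I" using additive_subgroup.zero_closed[OF I.is_additive_subgroup] by simp
  show "x \<in> I \<Longrightarrow> y \<in> I \<Longrightarrow> x + y \<in> I"
    using additive_subgroup.a_closed[OF I.is_additive_subgroup, of x y] by simp
  show "x \<in> I \<Longrightarrow> y * x \<in> I" using I.I_l_closed[of x y] by simp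
qed

lemma ideal_mpoly_ring_diff:
  assumes "ideal I mpoly_ring" "x \<in> I" "y \<in> I" shows "x - y \<in> I"
  using ideal_mpoly_ringD(2)[OF assms(1) assms(2) ideal_mpoly_ringD(3)[OF assms(1) assms(3), of "-1"]] by simp

lemma ideal_mpoly_ring_sum:
  assumes "ideal I mpoly_ring" "\<And>x. x \<in> A \<Longrightarrow> f x \<in> I" shows "sum f A \<in> I"
  using assms(2) by (induction A rule: infinite_finite_induct) (auto intro: ideal_mpoly_ringD[OF assms(1)])

lemma coset_eq_iff:
  assumes I: "ideal I mpoly_ring"
  shows "I +>\<^bsub>mpoly_ring\<^esub> p = I +>\<^bsub>mpoly_ring\<^esub> q \<longleftrightarrow> p - q \<in> I"
proof
  have coset: "I +>\<^bsub>mpoly_ring\<^esub> p = {x. x - p \<in> I}" for p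
    by (auto simp: a_r_coset_def' intro!: exI[of _ "x - p" for x p] bexI[of _ "x - p" for x p])
  show "p - q \<in> I" if "I +>\<^bsub>mpoly_ring\<^esub> p = I +>\<^bsub>mpoly_ring\<^esub> q"
  proof -
    have "p \<in> {x. x - p \<in> I}" using ideal_mpoly_ringD(1)[OF I] by simp
    then show ?thesis using that unfolding coset by auto
  qed
  show "I +>\<^bsub>mpoly_ring\<^esub> p = I +>\<^bsub>mpoly_ring\<^esub> q" if pq: "p - q \<in> I"
  proof -
    have "x - p \<in> I \<longleftrightarrow> x - q \<in> I" for x
      using ideal_mpoly_ringD(2)[OF I _ pq, of "x - p"] ideal_mpoly_ring_diff[OF I _ pq, of "x - q"] by auto
    then show ?thesis unfolding coset by auto
  qed
qed

lemma mult_map_coset: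
  assumes I: "ideal I mpoly_ring"
  shows "mult_map I h (I +>\<^bsub>mpoly_ring\<^esub> p) = I +>\<^bsub>mpoly_ring\<^esub> (h * p)"
  using ideal.rcoset_mult_add[OF I, of h p] by (simp add: mult_map_def FactRing_def)

text \<open>A single degree \<open>m\<close> that serves all linear forms is enough. The two
  alternatives are refuted on representatives, which removes cosets from the rest of the
  proof.\<close>

lemma not_weak_lefschetzI:
  fixes I :: "('v, 'a::comm_ring_1) mpoly set"
  assumes I: "ideal I mpoly_ring"
    and inj: "\<And>h. h \<in> homogeneous_part 1 \<Longrightarrow> \<exists>p\<in>homogeneous_part m. h * p \<in> I \<and> p \<notin> I"
    and surj: "\<And>h. h \<in> homogeneous_part 1 \<Longrightarrow> \<exists>f\<in>homogeneous_part (Suc m). \<forall>p\<in>homogeneous_part m. f - h * p \<notin> I"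
  shows "\<not> weak_lefschetz I"
proof
  assume "weak_lefschetz I"
  then obtain h where h: "h \<in> homogeneous_part 1"
    and or: "inj_on (mult_map I h) (quot_part I m) \<or> mult_map I h ` quot_part I m = quot_part I (Suc m)"
    unfolding weak_lefschetz_def by blast
  obtain p where p: "p \<in> homogeneous_part m" "h * p \<in> I" "p \<notin> I" using inj[OF h] by blast
  obtain f where f: "f \<in> homogeneous_part (Suc m)" "\<And>p. p \<in> homogeneous_part m \<Longrightarrow> f - h * p \<notin> I"
    using surj[OF h] by blast
  from or show False
  proof
    assume "inj_on (mult_map I h) (quot_part I m)"
    moreover have "mult_map I h (I +>\<^bsub>mpoly_ring\<^esub> p) = mult_map I h (I +>\<^bsub>mpoly_ring\<^esub> 0)"
      unfolding mult_map_coset[OF I] coset_eq_iff[OF I] using p by simp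
    moreover have "I +>\<^bsub>mpoly_ring\<^esub> p \<in> quot_part I m" "I +>\<^bsub>mpoly_ring\<^esub> 0 \<in> quot_part I m"
      using p(1) by (auto simp: quot_part_def)
    ultimately have "I +>\<^bsub>mpoly_ring\<^esub> p = I +>\<^bsub>mpoly_ring\<^esub> 0" by (rule inj_onD)
    then show False using p(3) by (simp add: coset_eq_iff[OF I])
  next
    assume "mult_map I h ` quot_part I m = quot_part I (Suc m)"
    moreover have "I +>\<^bsub>mpoly_ring\<^esub> f \<in> quot_part I (Suc m)" using f(1) by (auto simp: quot_part_def)
    ultimately have "I +>\<^bsub>mpoly_ring\<^esub> f \<in> mult_map I h ` quot_part I m" by simp
    then obtain p where "p \<in> homogeneous_part m" "I +>\<^bsub>mpoly_ring\<^esub> f = mult_map I h (I +>\<^bsub>mpoly_ring\<^esub> p)"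
      by (auto simp: quot_part_def)
    then show False using f(2) by (simp add: mult_map_coset[OF I] coset_eq_iff[OF I])
  qed
qed

lemma power_in_power_ideal: "i < n \<Longrightarrow> l i ^ t \<in> power_ideal n t l"
  using ring.genideal_self[OF ring_mpoly_ring, of "{l i ^ t |i. i < n}"] unfolding power_ideal_def by auto

lemma power_ideal_eq: "power_ideal n t l = {(\<Sum>i<n. l i ^ t * g i) | g. True}" (is "_ = ?J")
  and ideal_power_ideal: "ideal (power_ideal n t l) mpoly_ring"
proof -
  interpret R: ring "mpoly_ring :: ('a, 'b) mpoly ring" by (rule ring_mpoly_ring)
  show I: "ideal (power_ideal n t l) mpoly_ring"
    unfolding power_ideal_def by (rule R.genideal_ideal) simp
  have J: "ideal ?J mpoly_ring"
  proof (rule ideal_mpoly_ringI)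
    show "0 \<in> ?J" by (auto intro: exI[of _ "\<lambda>_. 0"])
  next
    fix x y assume "x \<in> ?J" "y \<in> ?J"
    then obtain f g where "x = (\<Sum>i<n. l i ^ t * f i)" "y = (\<Sum>i<n. l i ^ t * g i)" by blast
    then have "x + y = (\<Sum>i<n. l i ^ t * (f i + g i))" by (simp add: sum.distrib distrib_left)
    then show "x + y \<in> ?J" by auto
  next
    fix x y assume "x \<in> ?J"
    then obtain f where "x = (\<Sum>i<n. l i ^ t * f i)" by blast
    then have "y * x = (\<Sum>i<n. l i ^ t * (y * f i))" by (simp add: sum_distrib_left mult_ac)
    then show "y * x \<in> ?J" by auto
  qed
  show "power_ideal n t l = ?J"
  proof
    have "l i ^ t \<in> ?J" if "i < n" for i
    proof -
      have "(\<Sum>j<n. l j ^ t * (if j = i then 1 else 0)) = (\<Sum>j<n. if j = i then l i ^ t else 0)"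
        by (rule sum.cong) auto
      then have "l i ^ t = (\<Sum>j<n. l j ^ t * (if j = i then 1 else 0))" using that by simp
      then show ?thesis by (intro CollectI exI[of _ "\<lambda>j. if j = i then 1 else 0"]) simp
    qed
    then show "power_ideal n t l \<subseteq> ?J"
      unfolding power_ideal_def by (intro R.genideal_minimal J) auto
    show "?J \<subseteq> power_ideal n t l"
    proof
      fix x assume "x \<in> ?J"
      then obtain g where x: "x = (\<Sum>i<n. l i ^ t * g i)" by blast
      show "x \<in> power_ideal n t l"
        unfolding x
      proof (rule ideal_mpoly_ring_sum[OF I])
        fix i assume "i \<in> {..<n}"
        then show "l i ^ t * g i \<in> power_ideal n t l"
          using ideal_mpoly_ringD(3)[OF I power_in_power_ideal, of i "g i"] by (simp add: mult.commute)
      qed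
    qed
  qed
qed

definition hcomp :: "nat \<Rightarrow> ('v, 'a::comm_ring_1) mpoly \<Rightarrow> ('v, 'a) mpoly"
  where "hcomp d p = (\<Sum>m\<in>{m \<in> Poly_Mapping.keys p. monom_degree m = d}. Poly_Mapping.single m (Poly_Mapping.lookup p m))"

lemma lookup_hcomp: "Poly_Mapping.lookup (hcomp d p) m = (if monom_degree m = d then Poly_Mapping.lookup p m else 0)"
proof -
  have "Poly_Mapping.lookup (hcomp d p) m =
      (\<Sum>k\<in>{k \<in> Poly_Mapping.keys p. monom_degree k = d}. if k = m then Poly_Mapping.lookup p m else 0)"
    unfolding hcomp_def lookup_sum by (rule sum.cong) (auto simp: lookup_single when_def)
  then show ?thesis by (auto simp: in_keys_iff)
qed

lemma hcomp_add: "hcomp d (p + q) = hcomp d p + hcomp d q"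
  by (rule poly_mapping_eqI) (simp add: lookup_hcomp lookup_add)

lemma hcomp_zero [simp]: "hcomp d 0 = 0"
  by (simp add: hcomp_def)

lemma hcomp_sum: "hcomp d (sum f A) = (\<Sum>x\<in>A. hcomp d (f x))"
  by (induction A rule: infinite_finite_induct) (auto simp: hcomp_add)

lemma homogeneous_hcomp: "hcomp d p \<in> homogeneous_part d"
  by (auto simp: homogeneous_part_def in_keys_iff lookup_hcomp split: if_splits)

lemma hcomp_homogeneous:
  assumes "p \<in> homogeneous_part e" shows "hcomp d p = (if d = e then p else 0)"
proof (rule poly_mapping_eqI)
  fix m
  show "Poly_Mapping.lookup (hcomp d p) m = Poly_Mapping.lookup (if d = e then p else 0) m"
  proof (cases "m \<in> Poly_Mapping.keys p")
    case True
    then have "monom_degree m = e" using assms unfolding homogeneous_part_def by auto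
    then show ?thesis by (simp add: lookup_hcomp)
  next
    case False
    then show ?thesis by (simp add: lookup_hcomp in_keys_iff)
  qed
qed

lemma hcomp_mult:
  fixes a g :: "('v::finite, 'a::comm_ring_1) mpoly"
  assumes a: "a \<in> homogeneous_part t"
  shows "hcomp (t + r) (a * g) = a * hcomp r g"
proof (rule mpoly_additive_eqI[of "\<lambda>g. hcomp (t + r) (a * g)" "\<lambda>g. a * hcomp r g" g])
  fix m :: "'v \<Rightarrow>\<^sub>0 nat" and b :: 'a
  have s: "Poly_Mapping.single m b \<in> homogeneous_part (monom_degree m)" by (simp add: homogeneous_single)
  show "hcomp (t + r) (a * Poly_Mapping.single m b) = a * hcomp r (Poly_Mapping.single m b)"
    using hcomp_homogeneous[OF homogeneous_mult[OF a s], of "t + r"] hcomp_homogeneous[OF s, of r] by simp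
qed (simp_all add: hcomp_add distrib_left)

text \<open>The generators are homogeneous of degree \<open>t\<close>, so replacing each cofactor by
  its component of degree \<open>r\<close> does not change a form of degree
  \<open>t + r\<close>.\<close>

lemma power_ideal_part_eq:
  fixes l :: "nat \<Rightarrow> ('v::finite, 'a::comm_ring_1) mpoly"
  assumes l: "\<And>i. i < n \<Longrightarrow> l i \<in> homogeneous_part 1" and p: "p \<in> homogeneous_part (t + r)"
  shows "p \<in> power_ideal n t l \<longleftrightarrow> p \<in> power_ideal_part n t l r"
proof
  assume "p \<in> power_ideal n t l"
  then obtain g where g: "p = (\<Sum>i<n. l i ^ t * g i)" unfolding power_ideal_eq by blast
  have "l i ^ t \<in> homogeneous_part t" if "i < n" for i using homogeneous_power[OF l[OF that], of t] by simp
  then have "hcomp (t + r) p = (\<Sum>i<n. l i ^ t * hcomp r (g i))"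
    unfolding g hcomp_sum by (intro sum.cong) (auto simp: hcomp_mult)
  then show "p \<in> power_ideal_part n t l r"
    using hcomp_homogeneous[OF p, of "t + r"] by (auto simp: power_ideal_part_def intro: homogeneous_hcomp)
qed (auto simp: power_ideal_part_def power_ideal_eq)

lemma monomial_split:
  fixes m :: "'v::finite \<Rightarrow>\<^sub>0 nat"
  assumes "monom_degree m = Suc d"
  obtains v m' where "monom_degree m' = d" "(monomial m :: ('v, 'a::comm_ring_1) mpoly) = var v * monomial m'"
proof -
  have "\<exists>v. Poly_Mapping.lookup m v > 0"
    using assms by (rule_tac ccontr) (simp add: monom_degree_eq)
  then obtain v where v: "Poly_Mapping.lookup m v > 0" by blast
  let ?m = "m - Poly_Mapping.single v 1"
  have s: "m = ?m + Poly_Mapping.single v 1" by (rule monom_split[OF v])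
  then have "monom_degree m = monom_degree ?m + 1" by (metis monom_degree_add monom_degree_single)
  then have "monom_degree ?m = d" using assms by simp
  moreover have "(monomial m :: ('v, 'a) mpoly) = var v * monomial ?m"
    unfolding var_def mult_single using s by (simp add: add.commute)
  ultimately show thesis by (rule that)
qed

text \<open>Linear forms spanning \<open>S\<^sub>1\<close> can replace the variables, so a long product of variables contains a
  high power of some \<open>l i\<close>.\<close>
lemma products_in_power_ideal:
  fixes l :: "nat \<Rightarrow> ('v::finite, 'a::comm_ring_1) mpoly"
  assumes k: "k \<le> n" "k > 0" and span: "homogeneous_part 1 \<subseteq> power_ideal_part k 1 l 0"
  shows "p \<in> homogeneous_part b \<Longrightarrow> k * t \<le> (\<Sum>i<k. a i) + b \<Longrightarrow> (\<Prod>i<k. l i ^ a i) * p \<in> power_ideal n t l"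
proof (induction b arbitrary: a p)
  case 0
  have "\<exists>i<k. t \<le> a i"
  proof (rule ccontr)
    assume "\<not> (\<exists>i<k. t \<le> a i)"
    then have "(\<Sum>i<k. a i) < (\<Sum>i<k. t)" using k(2) by (intro sum_strict_mono) auto
    then show False using 0(2) by simp
  qed
  then obtain i where i: "i < k" "t \<le> a i" by auto
  have "(\<Prod>i<k. l i ^ a i) = l i ^ t * (l i ^ (a i - t) * (\<Prod>j\<in>{..<k} - {i}. l j ^ a j))"
    using i by (subst prod.remove[of _ i]) (auto simp: mult.assoc[symmetric] power_add[symmetric])
  moreover have "l i ^ t \<in> power_ideal n t l"
    by (rule power_in_power_ideal) (use i k in simp)
  ultimately show ?case
    using ideal_mpoly_ringD(3)[OF ideal_power_ideal, of "l i ^ t" n t l "(l i ^ (a i - t) * (\<Prod>j\<in>{..<k} - {i}. l j ^ a j)) * p"]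
    by (simp add: mult_ac)
next
  case (Suc b)
  have mono: "(\<Prod>i<k. l i ^ a i) * monomial m \<in> power_ideal n t l" if m: "monom_degree m = Suc b" for m
  proof -
    obtain v m' where m': "monom_degree m' = b" "(monomial m :: ('v, 'a) mpoly) = var v * monomial m'"
      using monomial_split[OF m] by blast
    \<comment> \<open>Expanding one variable in the \<open>l j\<close> moves one degree from
      \<open>p\<close> into the exponents \<open>a\<close>; when \<open>p\<close> is constant, some
      exponent is at least \<open>t\<close> by the pigeonhole principle.\<close>
    obtain g where g: "\<And>j. j < k \<Longrightarrow> g j \<in> homogeneous_part 0" "var v = (\<Sum>j<k. l j * g j)"
      using span homogeneous_var[of v] by (fastforce simp: power_ideal_part_def)
    have "(\<Prod>i<k. l i ^ a i) * (l j * g j * monomial m') \<in> power_ideal n t l" if j: "j < k" for j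
    proof -
      let ?a = "a(j := Suc (a j))"
      have "(\<Prod>i<k. l i ^ ?a i) = l j * (\<Prod>i<k. l i ^ a i)"
        using j by (subst (1 2) prod.remove[of _ j]) (auto intro!: prod.cong simp: mult_ac)
      moreover have "(\<Sum>i<k. ?a i) = Suc (\<Sum>i<k. a i)"
        using j by (subst (1 2) sum.remove[of _ j]) (auto intro!: sum.cong)
      moreover have "g j * monomial m' \<in> homogeneous_part b"
        using homogeneous_mult[OF g(1)[OF j] homogeneous_single[OF m'(1), of 1]] by simp
      ultimately show ?thesis using Suc.IH[of "g j * monomial m'" ?a] Suc.prems(2) by (simp add: mult_ac)
    qed
    then have "(\<Sum>j<k. (\<Prod>i<k. l i ^ a i) * (l j * g j * monomial m')) \<in> power_ideal n t l"
      by (intro ideal_mpoly_ring_sum[OF ideal_power_ideal]) auto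
    then show ?thesis by (simp add: m'(2) g(2) sum_distrib_left sum_distrib_right mult.assoc)
  qed
  have "p = (\<Sum>m\<in>monoms (Suc b). cmul (Poly_Mapping.lookup p m) (monomial m))"
    using Suc.prems(1) by (intro sum_cmul_monomial) (auto simp: homogeneous_part_iff)
  then have "(\<Prod>i<k. l i ^ a i) * p =
      (\<Sum>m\<in>monoms (Suc b). Poly_Mapping.single 0 (Poly_Mapping.lookup p m) * ((\<Prod>i<k. l i ^ a i) * monomial m))"
    by (metis (no_types, lifting) cmul_def mult_cmul_right sum.cong sum_distrib_left)
  also have "\<dots> \<in> power_ideal n t l"
    by (intro ideal_mpoly_ring_sum[OF ideal_power_ideal] ideal_mpoly_ringD(3)[OF ideal_power_ideal] mono)
      (simp add: monoms_def)
  finally show ?case .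
qed

text \<open>Every coset has a representative in the finite-dimensional space \<open>T\<close> of
  polynomials of degree below \<open>N\<close>. An ideal of the quotient is determined by the
  subspace of such representatives, so a descending chain is constant from the index where the
  dimension of that subspace is least.\<close>

lemma artinian_quotient:
  fixes I :: "('v::finite, 'a::field) mpoly set"
  assumes I: "ideal I mpoly_ring" and N: "\<And>d. N \<le> d \<Longrightarrow> homogeneous_part d \<subseteq> I"
  shows "artinian_ring (mpoly_ring Quot I)"
proof -
  let ?R = "mpoly_ring Quot I"
  define \<phi> where "\<phi> = a_r_coset mpoly_ring I"
  interpret h: ring_hom_ring mpoly_ring ?R \<phi>
    unfolding \<phi>_def by (rule ideal.rcos_ring_hom_ring[OF I])
  define A :: "('v \<Rightarrow>\<^sub>0 nat) set" where "A = (\<Union>d<N. monoms d)"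
  define T :: "('v, 'a) mpoly set" where "T = {p. Poly_Mapping.keys p \<subseteq> A}"
  have T: "mp.subspace T"
    unfolding mp.subspace_def
  proof (intro conjI ballI allI)
    fix p q assume "p \<in> T" "q \<in> T"
    then show "p + q \<in> T" using keys_add[of p q] by (auto simp: T_def)
  next
    fix c p assume "p \<in> T"
    moreover have "Poly_Mapping.keys (cmul c p) \<subseteq> Poly_Mapping.keys p" by (auto simp: in_keys_iff)
    ultimately show "cmul c p \<in> T" by (auto simp: T_def)
  qed (simp add: T_def)
  have Tspan: "T \<subseteq> mp.span (monomial ` A)"
  proof
    fix p assume "p \<in> T"
    then have "p = (\<Sum>m\<in>A. cmul (Poly_Mapping.lookup p m) (monomial m))"
      by (intro sum_cmul_monomial) (auto simp: T_def A_def)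
    also have "\<dots> \<in> mp.span (monomial ` A)"
      by (intro mp.span_sum mp.span_scale mp.span_base) auto
    finally show "p \<in> mp.span (monomial ` A)" .
  qed
  have split: "\<exists>q\<in>T. p - q \<in> I" for p
  proof -
    let ?s = "\<lambda>m. Poly_Mapping.single m (Poly_Mapping.lookup p m)"
    let ?q = "\<Sum>m\<in>Poly_Mapping.keys p \<inter> A. ?s m"
    have "p = (\<Sum>m\<in>Poly_Mapping.keys p. ?s m)" by (rule mpoly_sum_single)
    also have "\<dots> = ?q + (\<Sum>m\<in>Poly_Mapping.keys p - A. ?s m)"
      by (rule sum.Int_Diff) simp
    finally have "p - ?q = (\<Sum>m\<in>Poly_Mapping.keys p - A. ?s m)" by (simp add: algebra_simps)
    also have "\<dots> \<in> I"
    proof (rule ideal_mpoly_ring_sum[OF I])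
      fix m assume "m \<in> Poly_Mapping.keys p - A"
      then have "N \<le> monom_degree m" by (auto simp: A_def monoms_def)
      then show "?s m \<in> I" using N homogeneous_single by blast
    qed
    finally have "p - ?q \<in> I" .
    moreover have "?q \<in> T"
      using mp.subspace_sum[OF T, of "Poly_Mapping.keys p \<inter> A" ?s] by (auto simp: T_def)
    ultimately show ?thesis by blast
  qed
  show ?thesis
  proof (intro artinian_ring.intro artinian_ring_axioms.intro ideal.quotient_is_ring[OF I])
    fix C :: "nat \<Rightarrow> ('v, 'a) mpoly set set"
    assume C: "\<And>k. ideal (C k) ?R" and desc: "\<And>k. C (Suc k) \<subseteq> C k"
    have anti: "C k \<subseteq> C j" if "j \<le> k" for j k
      using lift_Suc_antimono_le[of C j k] desc that by blast
    define J where "J k = {p. \<phi> p \<in> C k}" for k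
    have zero: "0 \<in> J k" for k
      using additive_subgroup.zero_closed[OF ideal.axioms(1)[OF C[of k]]] h.hom_zero by (simp add: J_def)
    have add: "p + q \<in> J k" if "p \<in> J k" "q \<in> J k" for p q k
      using additive_subgroup.a_closed[OF ideal.axioms(1)[OF C[of k]], of "\<phi> p" "\<phi> q"] that h.hom_add[of p q]
      by (simp add: J_def)
    have mult: "q * p \<in> J k" if "p \<in> J k" for p q k
      using ideal.I_l_closed[OF C[of k], of "\<phi> p" "\<phi> q"] that h.hom_mult[of q p] h.hom_closed[of q]
      by (simp add: J_def)
    have J: "ideal (J k) mpoly_ring" for k
      by (rule ideal_mpoly_ringI) (auto intro: zero add mult)
    have IJ: "I \<subseteq> J k" for k
    proof
      fix p assume "p \<in> I"
      then have "\<phi> p = \<phi> 0" by (simp add: \<phi>_def coset_eq_iff[OF I])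
      then show "p \<in> J k" using zero[of k] by (simp add: J_def)
    qed
    define U where "U k = J k \<inter> T" for k
    have U: "mp.subspace (U k)" for k
      unfolding U_def by (rule mp.subspace_inter[OF _ T]) (auto simp: mp.subspace_def cmul_def intro: zero add mult)
    define k0 where "k0 = (ARG_MIN (\<lambda>k. mp.dim (U k)) k. True)"
    have k0: "mp.dim (U k0) \<le> mp.dim (U k)" for k
      unfolding k0_def by (rule arg_min_nat_le) simp
    have "C k = C k0" if k: "k0 \<le> k" for k
    proof
      show "C k \<subseteq> C k0" using anti k by blast
      have JJ: "J k \<subseteq> J k0" using anti[OF k] by (auto simp: J_def)
      have UU: "U k = U k0"
        by (rule mp.subspace_eq_if_dim_le[OF U, of _ _ "monomial ` A"])
          (use JJ Tspan k0 in \<open>auto simp: U_def A_def\<close>)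
      show "C k0 \<subseteq> C k"
      proof
        fix c assume c: "c \<in> C k0"
        have "c \<in> carrier ?R"
          using c additive_subgroup.a_subset[OF ideal.axioms(1)[OF C[of k0]]] by blast
        then obtain p where p: "c = \<phi> p" by (auto simp: FactRing_def A_RCOSETS_def' \<phi>_def)
        then have pJ: "p \<in> J k0" using c by (simp add: J_def)
        obtain q where q: "q \<in> T" "p - q \<in> I" using split by blast
        have "p - (p - q) \<in> J k0" using ideal_mpoly_ring_diff[OF J pJ] IJ q(2) by blast
        then have "q \<in> J k" using UU q(1) by (auto simp: U_def)
        moreover have "p - q \<in> J k" using IJ q(2) by blast
        ultimately have "(p - q) + q \<in> J k" using add by blast
        then show "c \<in> C k" using p by (simp add: J_def)
      qed
    qed
    then show "\<exists>N. \<forall>k\<ge>N. C k = C N" by blast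
  qed
qed

text \<open>With \<open>t = 1\<close> and \<open>r = 0\<close> the cofactors are constants, so the
  hypothesis is linear independence of four forms in a space of dimension 4.\<close>

lemma no_syzygies_imp_span:
  fixes l :: "nat \<Rightarrow> (4, 'a::field) mpoly"
  assumes ns: "no_syzygies 4 1 l 0" and l: "\<And>i. i < 4 \<Longrightarrow> l i \<in> homogeneous_part 1"
  shows "homogeneous_part 1 \<subseteq> power_ideal_part 4 1 l 0"
proof -
  let ?C = "{..<4} \<times> (monoms 0 :: (4 \<Rightarrow>\<^sub>0 nat) set)"
  have "inj_on (power_monomial 1 l) ?C" "mp.independent (power_monomial 1 l ` ?C)"
    using mp.independent_familyI[of ?C "power_monomial 1 l"] no_syzygies_imp_independent[OF ns] by auto
  moreover have "card (monoms 0 :: (4 \<Rightarrow>\<^sub>0 nat) set) = 1"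
    using card_monoms[where 'v = 4, of 0] by simp
  ultimately have "4 \<le> mp.dim (power_ideal_part 4 1 l 0)"
    using mp.independent_card_le_dim_finite[of "power_ideal_part 4 1 l 0" "power_monomial 1 l ` ?C" "power_monomial 1 l ` ?C"]
      power_ideal_part_subset_span[of 4 1 l 0] power_monomial_in_part[of _ 4 0 1 l]
    by (simp add: card_image image_subset_iff card_cartesian_product)
  moreover have "mp.dim (homogeneous_part 1 :: (4, 'a) mpoly set) = 4"
    by (simp add: dim_homogeneous_4[where d = 1, simplified] numeral_eq_Suc)
  moreover have "power_ideal_part 4 1 l 0 \<subseteq> homogeneous_part 1"
    using power_ideal_part_subset[of 4 l 1 0] l by simp
  ultimately have "power_ideal_part 4 1 l 0 = homogeneous_part 1"
    using mp.subspace_eq_if_dim_le[OF subspace_power_ideal_part _ homogeneous_subset_span, of 4 1 l 0 1] by simp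
  then show ?thesis by simp
qed

lemma artinian_power_ideal:
  fixes l :: "nat \<Rightarrow> (4, 'a::field) mpoly"
  assumes n: "4 \<le> n" and ns: "no_syzygies 4 1 l 0" and l: "\<And>i. i < 4 \<Longrightarrow> l i \<in> homogeneous_part 1"
  shows "artinian_ring (mpoly_ring Quot power_ideal n t l)"
proof (rule artinian_quotient[OF ideal_power_ideal, of "4 * t"])
  fix d assume "4 * t \<le> d"
  then show "homogeneous_part d \<subseteq> power_ideal n t l"
    using products_in_power_ideal[OF n _ no_syzygies_imp_span[OF ns l], of _ d t "\<lambda>_. 0"] by auto
qed

section \<open>Failure of injectivity and surjectivity in one degree\<close>

lemma linear_coeff_nonzero:
  assumes "h \<in> homogeneous_part 1" "h \<noteq> (0 :: ('v::finite, 'a::comm_ring_1) mpoly)"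
  shows "\<exists>v. linear_coeff h v \<noteq> 0"
proof (rule ccontr)
  assume "\<not> ?thesis"
  then have "(\<Sum>v\<in>UNIV. cmul (linear_coeff h v) (var v)) = 0" by (simp add: cmul_def)
  then show False using linear_form_eq[OF assms(1)] assms(2) by simp
qed

text \<open>In the notation M = t + r + 1 and k = r + 2, the hypothesis \<open>big\<close> says that
  K exceeds its expected dimension, against the bound that injectivity would give, and
  \<open>nonzero\<close> supplies a form orthogonal to everything that multiplication by
  \<open>h\<close> reaches modulo the ideal.\<close>

lemma multiplication_fails:
  fixes l :: "nat \<Rightarrow> (4, 'a::field_char_0) mpoly"
  assumes l: "\<And>i. i < n \<Longrightarrow> l i \<in> homogeneous_part 1"
    and ns: "no_syzygies n t l (Suc r)"
    and big: "\<And>(h :: 4 \<Rightarrow> 'a) u. \<exists>v. h v \<noteq> 0 \<Longrightarrow>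
      (t + r + 3) choose 2 < mp.dim (fat_space h u {..<n} (t + Suc r) (\<lambda>_. Suc (Suc r))) + n * ((r + 3) choose 2)"
    and nonzero: "\<And>(h :: 4 \<Rightarrow> 'a) u. \<exists>v. h v \<noteq> 0 \<Longrightarrow> \<exists>F\<in>fat_space h u {..<n} (t + Suc r) (\<lambda>_. Suc (Suc r)). F \<noteq> 0"
  shows "\<not> weak_lefschetz (power_ideal n t l)"
proof -
  let ?I = "power_ideal n t l" and ?u = "\<lambda>i. linear_coeff (l i)"
  have surj: "\<exists>f\<in>homogeneous_part (t + Suc r). \<forall>p\<in>homogeneous_part (t + r). f - h * p \<notin> ?I"
    if h: "h \<in> homogeneous_part 1" "h \<noteq> 0" for h
  proof -
    have "\<exists>v. linear_coeff h v \<noteq> 0" by (rule linear_coeff_nonzero[OF h])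
    then obtain F where F: "F \<in> fat_space (linear_coeff h) ?u {..<n} (t + Suc r) (\<lambda>_. Suc (Suc r))" "F \<noteq> 0"
      using nonzero by blast
    \<comment> \<open>A monomial occurring in \<open>F\<close> has a nonzero pairing with
      \<open>F\<close>, whereas multiples of \<open>h\<close> and elements of the ideal pair to 0;
      so this monomial is not reached.\<close>
    obtain m where m: "m \<in> Poly_Mapping.keys F" using F(2) keys_eq_empty by (metis ex_in_conv)
    have deg: "monomial m \<in> homogeneous_part (t + Suc r)"
      using m F(1) by (intro homogeneous_single) (auto simp: fat_space_def homogeneous_part_def)
    have "monomial m - h * p \<notin> ?I" for p
    proof
      assume "monomial m - h * p \<in> ?I"
      then obtain g where g: "monomial m - h * p = (\<Sum>i<n. l i ^ t * g i)"
        unfolding power_ideal_eq by blast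
      have "apolar (monomial m) F = apolar (h * p) F + (\<Sum>i<n. apolar (l i ^ t * g i) F)"
        using arg_cong[OF g, of "\<lambda>q. apolar (h * p + q) F"] by (simp add: apolar_add apolar_sum)
      also have "apolar (h * p) F = 0" using F(1) by (simp add: apolar_linear_mult[OF h(1)] fat_space_def)
      also have "(\<Sum>i<n. apolar (l i ^ t * g i) F) = 0"
        using F(1) by (intro sum.neutral) (auto simp: apolar_linear_power_mult[OF l] fat_space_def)
      finally show False using m by (simp add: apolar_single in_keys_iff)
    qed
    then show ?thesis using deg by blast
  qed
  have inj: "\<exists>p\<in>homogeneous_part (t + r). h * p \<in> ?I \<and> p \<notin> ?I"
    if h: "h \<in> homogeneous_part 1" "h \<noteq> 0" for h
  proof (rule ccontr)
    assume "\<not> ?thesis"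
    then have all: "\<And>p. p \<in> homogeneous_part (t + r) \<Longrightarrow> h * p \<in> ?I \<Longrightarrow> p \<in> ?I" by blast
    have "mp.dim (fat_space (linear_coeff h) ?u {..<n} (t + Suc r) (\<lambda>_. Suc (Suc r))) + n * ((r + 3) choose 2)
        \<le> (t + r + 3) choose 2"
    proof (rule injective_imp_dim_fat_space_le[OF l h ns])
      fix p assume p: "p \<in> homogeneous_part (t + r)" "h * p \<in> power_ideal_part n t l (Suc r)"
      have hp: "h * p \<in> homogeneous_part (t + Suc r)" using homogeneous_mult[OF h(1) p(1)] by simp
      then have "h * p \<in> ?I" using p(2) power_ideal_part_eq[OF l hp] by simp
      then show "p \<in> power_ideal_part n t l r" using all[OF p(1)] power_ideal_part_eq[OF l p(1)] by simp
    qed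
    moreover have "\<exists>v. linear_coeff h v \<noteq> 0" by (rule linear_coeff_nonzero[OF h])
    ultimately show False using big[of "linear_coeff h" ?u] by simp
  qed
  \<comment> \<open>The zero form is also a candidate in \<open>weak_lefschetz\<close>, and it fails
    once the quotient is nonzero in both degrees. An arbitrary variable serves as a nonzero form to
    see this in the upper degree; the lower degree follows, since forms of degree
    \<open>t + Suc r\<close> are generated by those of degree \<open>t + r\<close>.\<close>
  have "var undefined \<noteq> (0 :: (4, 'a) mpoly)" unfolding var_def by (metis lookup_single_eq lookup_zero zero_neq_one)
  then obtain f where f: "f \<in> homogeneous_part (t + Suc r)" "f \<notin> ?I"
    using surj[OF homogeneous_var[of undefined]] by (metis diff_zero homogeneous_zero mult_zero_right)
  have "\<exists>p\<in>homogeneous_part (t + r). p \<notin> ?I"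
  proof (rule ccontr)
    assume "\<not> ?thesis"
    then have all: "homogeneous_part (t + r) \<subseteq> ?I" by blast
    have "monomial m \<in> ?I" if m: "m \<in> monoms (t + Suc r)" for m
    proof -
      have "monom_degree m = Suc (t + r)" using m by (simp add: monoms_def)
      then obtain v m' where m': "monom_degree m' = t + r" "(monomial m :: (4, 'a) mpoly) = var v * monomial m'"
        using monomial_split by blast
      then have "monomial m' \<in> ?I" using all homogeneous_single by blast
      then show ?thesis unfolding m'(2) by (rule ideal_mpoly_ringD(3)[OF ideal_power_ideal])
    qed
    then have "(\<Sum>m\<in>monoms (t + Suc r). cmul (Poly_Mapping.lookup f m) (monomial m)) \<in> ?I"
      unfolding cmul_def by (intro ideal_mpoly_ring_sum[OF ideal_power_ideal] ideal_mpoly_ringD(3)[OF ideal_power_ideal])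
    moreover have "f = (\<Sum>m\<in>monoms (t + Suc r). cmul (Poly_Mapping.lookup f m) (monomial m))"
      using f(1) by (intro sum_cmul_monomial) (auto simp: homogeneous_part_iff)
    ultimately show False using f(2) by simp
  qed
  then obtain p0 where p0: "p0 \<in> homogeneous_part (t + r)" "p0 \<notin> ?I" by blast
  show ?thesis
  proof (rule not_weak_lefschetzI[OF ideal_power_ideal, of "t + r"])
    fix h :: "(4, 'a) mpoly" assume h: "h \<in> homogeneous_part 1"
    show "\<exists>p\<in>homogeneous_part (t + r). h * p \<in> ?I \<and> p \<notin> ?I"
      using inj[OF h] p0 ideal_mpoly_ringD(1)[OF ideal_power_ideal] by (cases "h = 0") auto
    show "\<exists>f\<in>homogeneous_part (Suc (t + r)). \<forall>p\<in>homogeneous_part (t + r). f - h * p \<notin> ?I"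
      using surj[OF h] f by (cases "h = 0") auto
  qed
qed

lemma no_syzygies_cong: "(\<And>i. i < n \<Longrightarrow> l i = l' i) \<Longrightarrow> no_syzygies n t l r \<longleftrightarrow> no_syzygies n t l' r"
  unfolding no_syzygies_def by (metis (no_types, lifting) lessThan_iff sum.cong)

lemma choose_two_mult: "2 * ((x + 2) choose 2) = (x + 2) * (x + 1)"
  by (simp add: choose_two)

text \<open>Here \<open>E\<close> has degree \<open>c\<close> and multiplicity \<open>\<mu>\<close> at each of the \<open>n\<close> points, and the curves \<open>E\<^sup>s G\<close>, with \<open>G\<close> of
  degree \<open>d e\<close> and multiplicity \<open>\<nu> e\<close>, are those in degree \<open>M\<close> with multiplicity \<open>k = \<mu> s + \<nu> e\<close>.\<close>
lemma generic_failure: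
  assumes n: "4 \<le> n" and t: "t + 1 = c * s + d * e - (\<mu> * s + \<nu> * e) + 2"
    and le: "\<mu> \<le> c" "\<nu> \<le> d" and k: "2 \<le> \<mu> * s + \<nu> * e"
    and kt: "\<mu> * s + \<nu> * e \<le> t" and nk: "n * (\<mu> * s + \<nu> * e) \<le> 3 * (c * s + d * e) + 1"
    and E: "\<And>(h :: 4 \<Rightarrow> 'a::field_char_0) u. \<exists>v. h v \<noteq> 0 \<Longrightarrow> \<exists>E\<in>fat_space h u {..<n} c (\<lambda>_. \<mu>). E \<noteq> 0"
    and num1: "n * ((\<nu> * e + 1) choose 2) < (d * e + 2) choose 2"
    and num2: "((c * s + d * e + 2) choose 2) + n * ((\<nu> * e + 1) choose 2) <
      ((d * e + 2) choose 2) + n * ((\<mu> * s + \<nu> * e + 1) choose 2)"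
  shows "\<exists>U :: (nat \<Rightarrow> (4, 'a) mpoly) set.
    zariski_open n U \<and> U \<noteq> {} \<and>
    (\<forall>l\<in>U. artinian_ring (mpoly_ring Quot power_ideal n t l) \<and>
           \<not> weak_lefschetz (power_ideal n t l))"
proof -
  \<comment> \<open>The multiplicity is k = r + 2, so the cofactors in degree M have degree M - t =
    k - 1 = \<open>Suc r\<close>.\<close>
  obtain r where r: "\<mu> * s + \<nu> * e = Suc (Suc r)"
    using k by (metis add_2_eq_Suc le_Suc_ex)
  have "\<mu> * s + \<nu> * e \<le> c * s + d * e" using le by (intro add_mono mult_right_mono) auto
  then have M: "c * s + d * e = t + Suc r" using t r by linarith
  define l0 :: "nat \<Rightarrow> (4, 'a) mpoly" where "l0 i = (if i < n then moment (of_nat i) else undefined)" for i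
  have l0: "l0 \<in> linear_form_tuples n" "\<And>i. i < n \<Longrightarrow> l0 i \<in> homogeneous_part 1"
    by (auto simp: linear_form_tuples_def l0_def homogeneous_moment simp del: One_nat_def split: if_splits)
  have inj: "inj_on (of_nat :: nat \<Rightarrow> 'a) X'" for X' by (auto intro: inj_onI)
  have "no_syzygies n t (\<lambda>i. moment (of_nat i :: 'a)) (Suc r)"
    by (rule no_syzygies_moment[OF inj n]) (use kt nk r M in auto)
  then have ns1: "no_syzygies n t l0 (Suc r)"
    using no_syzygies_cong[of n l0 "\<lambda>i. moment (of_nat i)" t "Suc r"] by (simp add: l0_def)
  \<comment> \<open>Independence of the first four forms, for the Artinian property; here the
    numerical hypothesis reads \<open>4 \<le> 3 + 1\<close>.\<close>
  have "no_syzygies 4 1 (\<lambda>i. moment (of_nat i :: 'a)) 0"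
    by (rule no_syzygies_moment[OF inj]) auto
  then have ns2: "no_syzygies 4 1 l0 0"
    using no_syzygies_cong[of 4 l0 "\<lambda>i. moment (of_nat i)" 1 0] n by (simp add: l0_def)
  obtain f1 where f1: "regular_function n f1" "f1 l0 \<noteq> 0" "\<And>l. f1 l \<noteq> 0 \<Longrightarrow> no_syzygies n t l (Suc r)"
    using no_syzygies_open[OF l0(2) ns1 order_refl] by blast
  have l04: "\<And>i. i < 4 \<Longrightarrow> l0 i \<in> homogeneous_part 1" using l0(2) n by auto
  obtain f2 where f2: "regular_function n f2" "f2 l0 \<noteq> 0" "\<And>l. f2 l \<noteq> 0 \<Longrightarrow> no_syzygies 4 1 l 0"
    using no_syzygies_open[OF l04 ns2 n] by blast
  have dim: "(d * e + 2) choose 2 \<le> mp.dim (fat_space h u {..<n} (t + Suc r) (\<lambda>_. Suc (Suc r)))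
      + n * ((\<nu> * e + 1) choose 2)" if h: "\<exists>v. h v \<noteq> 0" for h :: "4 \<Rightarrow> 'a" and u
  proof -
    obtain E where "E \<in> fat_space h u {..<n} c (\<lambda>_. \<mu>)" "E \<noteq> 0" using E[OF h] by blast
    then show ?thesis
      using dim_fat_space_power_mult[OF h _ _ le, where e = e and s = s] unfolding M r by blast
  qed
  have big: "(t + r + 3) choose 2 < mp.dim (fat_space h u {..<n} (t + Suc r) (\<lambda>_. Suc (Suc r)))
      + n * ((r + 3) choose 2)" if h: "\<exists>v. h v \<noteq> 0" for h :: "4 \<Rightarrow> 'a" and u
  proof -
    have eq: "t + Suc r + 2 = t + r + 3" "Suc (Suc r) + 1 = r + 3" by auto
    show ?thesis using num2[unfolded M r eq] dim[OF h, of u] by linarith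
  qed
  have nonzero: "\<exists>F\<in>fat_space h u {..<n} (t + Suc r) (\<lambda>_. Suc (Suc r)). F \<noteq> 0"
    if h: "\<exists>v. h v \<noteq> 0" for h :: "4 \<Rightarrow> 'a" and u
  proof (rule ccontr)
    assume "\<not> ?thesis"
    then have "fat_space h u {..<n} (t + Suc r) (\<lambda>_. Suc (Suc r)) \<subseteq> mp.span {}" by (auto simp: mp.span_empty)
    then have "mp.dim (fat_space h u {..<n} (t + Suc r) (\<lambda>_. Suc (Suc r))) \<le> 0"
      using mp.dim_le_card[OF _ finite.emptyI] by (metis card.empty)
    then show False using dim[OF h, of u] num1 by simp
  qed
  \<comment> \<open>Both functions are nonzero at the same tuple \<open>l0\<close>, so their product
    defines a nonempty open set.\<close>
  let ?U = "{l \<in> linear_form_tuples n. f1 l * f2 l \<noteq> 0}"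
  show ?thesis
  proof (intro exI[of _ ?U] conjI ballI)
    show "zariski_open n ?U" by (rule zariski_open_regular[OF regular_mult[OF f1(1) f2(1)]])
    show "?U \<noteq> {}" using l0(1) f1(2) f2(2) by auto
  next
    fix l assume "l \<in> ?U"
    then have l: "\<And>i. i < n \<Longrightarrow> l i \<in> homogeneous_part 1" and ns: "no_syzygies n t l (Suc r)" "no_syzygies 4 1 l 0"
      using f1(3) f2(3) by (auto simp: linear_form_tuples_def)
    show "artinian_ring (mpoly_ring Quot power_ideal n t l)"
      by (rule artinian_power_ideal[OF n ns(2)]) (use l n in auto)
    show "\<not> weak_lefschetz (power_ideal n t l)"
      by (rule multiplication_fails[OF l ns(1) big nonzero])
  qed
qed

section \<open>The numerical choices for n = 5, 6, 7, 8\<close>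

lemma conic_curve:
  fixes h :: "4 \<Rightarrow> 'a::field_char_0"
  assumes "\<exists>v. h v \<noteq> 0"
  shows "\<exists>E\<in>fat_space h u {..<5} 2 (\<lambda>_. 1). E \<noteq> 0"
  by (rule fat_space_nonzero[OF assms]) (auto simp: choose_two)

text \<open>The bound is the conductor (7 - 1) (3 - 1) of the semigroup.\<close>

lemma sums_of_7_and_3: "12 \<le> (q :: nat) \<Longrightarrow> \<exists>y e. q = 7 * y + 3 * e"
  by presburger

text \<open>Since 2 * 13 - 5 * 5 = 1, the pair \<open>y = 2 * q - 5 * w\<close>,
  \<open>e = 13 * w - 5 * q\<close> is a solution for every \<open>w\<close>. The largest
  \<open>w\<close> with \<open>y \<ge> 0\<close> leaves \<open>y \<le> 4\<close>, and then
  \<open>e \<ge> 0\<close> follows from q \<ge> 4 * 13.\<close>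

lemma sums_of_13_and_5:
  assumes "52 \<le> (q :: nat)"
  shows "\<exists>y e. q = 13 * y + 5 * e"
proof -
  define w y where "w = (2 * q) div 5" and "y = (2 * q) mod 5"
  have wy: "2 * q = 5 * w + y" "y < 5" by (simp_all add: w_def y_def)
  then have "5 * q \<le> 13 * w" using assms by linarith
  then obtain e where "13 * w = 5 * q + e" using le_Suc_ex by blast
  then have "q = 13 * y + 5 * e" using wy(1) by linarith
  then show ?thesis by blast
qed

text \<open>As for 13 and 5, now from 5 * 31 - 14 * 11 = 1; here \<open>y \<le> 10\<close>, and 310
  = 10 * 31.\<close>

lemma sums_of_31_and_11:
  assumes "310 \<le> (q :: nat)"
  shows "\<exists>y e. q = 31 * y + 11 * e"
proof -
  define w y where "w = (5 * q) div 11" and "y = (5 * q) mod 11"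
  have wy: "5 * q = 11 * w + y" "y < 11" by (simp_all add: w_def y_def)
  then have "14 * q \<le> 31 * w" using assms by linarith
  then obtain e where "31 * w = 14 * q + e" using le_Suc_ex by blast
  then have "q = 31 * y + 11 * e" using wy(1) by linarith
  then show ?thesis by blast
qed

theorem theorem1p3:
  fixes n t :: nat
  assumes "n = 5 \<and> t \<ge> 3 \<or> n = 6 \<and> t \<ge> 27 \<or> n = 7 \<and> t \<ge> 140 \<or> n = 8 \<and> t \<ge> 704"
  shows "\<exists>U :: (nat \<Rightarrow> (4, 'a::field_char_0) mpoly) set.
    zariski_open n U \<and> U \<noteq> {} \<and>
    (\<forall>l\<in>U. artinian_ring (mpoly_ring Quot power_ideal n t l) \<and>
           \<not> weak_lefschetz (power_ideal n t l))"
  \<comment> \<open>The curve \<open>E\<close> is the conic through five points; for \<open>n = 6\<close> the product of the six conics through five of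
    the points; for \<open>n = 7\<close> that of the seven cubics with one double point; for \<open>n = 8\<close> that of the eight
    sextics with one triple and seven double points. The ratios \<open>5 / 2\<close>, \<open>8 / 3\<close>, \<open>17 / 6\<close> used for \<open>d / \<nu>\<close>
    just exceed \<open>\<surd>n\<close>, so that the system of curves \<open>G\<close> is nonempty.\<close>
  using assms
proof (elim disjE conjE)
  assume n: "n = 5" and t: "3 \<le> t"
  \<comment> \<open>With \<open>e = 0\<close> the cofactor is constant, and the relation for
    \<open>t\<close> forces the power of the conic to be k = t - 1, in degree M = 2 (t - 1). The
    bound \<open>3 \<le> t\<close> makes this power at least 2.\<close>
  obtain s where s: "t = s + 3" using t le_Suc_ex by (metis add.commute)
  show ?thesis
    unfolding n
  proof (rule generic_failure[where c = 2 and d = 5 and \<mu> = 1 and \<nu> = 2 and e = 0 and s = "s + 2"])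
    have "2 * ((2 * (s + 2) + 5 * 0 + 2) choose 2) < 2 * (1 + 5 * ((1 * (s + 2) + 2 * 0 + 1) choose 2))"
      using choose_two_mult[of "2 * (s + 2)"] choose_two_mult[of "s + 1"] by (simp add: algebra_simps)
    then have "((2 * (s + 2) + 5 * 0 + 2) choose 2) + 5 * 0 < 1 + 5 * ((1 * (s + 2) + 2 * 0 + 1) choose 2)"
      by (simp only: mult_less_cancel1 mult_0_right add_0_right)
    moreover have "(5 * 0 + 2) choose 2 = (1 :: nat)" "(2 * 0 + 1) choose 2 = (0 :: nat)"
      by (simp_all add: numeral_2_eq_2)
    ultimately show "((2 * (s + 2) + 5 * 0 + 2) choose 2) + 5 * ((2 * 0 + 1) choose 2) <
        ((5 * 0 + 2) choose 2) + 5 * ((1 * (s + 2) + 2 * 0 + 1) choose 2)" by (simp only:)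
  qed (use s conic_curve in \<open>auto simp: choose_two\<close>)
next
  assume n: "n = 6" and t: "27 \<le> t"
  \<comment> \<open>The relation for \<open>t\<close> is t = (12 - 5) s' + (5 - 2) e + 1 with s'
    \<ge> 2, where s' is the power of \<open>E\<close>; and 27 = 2 * 7 + 12 + 1.\<close>
  obtain j where j: "t = 27 + j" using le_Suc_ex[OF t] by blast
  have "12 \<le> 12 + j" by simp
  then obtain s e where "12 + j = 7 * s + 3 * e" using sums_of_7_and_3 by blast
  then have se: "t = 7 * (s + 2) + 3 * e + 1" using j by presburger
  show ?thesis
    unfolding n
  proof (rule generic_failure[where c = 12 and d = 5 and \<mu> = 5 and \<nu> = 2 and e = e and s = "s + 2"])
    show "\<exists>E\<in>fat_space h u {..<6} 12 (\<lambda>_. 5). E \<noteq> 0" if "\<exists>v. h v \<noteq> 0" for h :: "4 \<Rightarrow> 'a" and u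
      \<comment> \<open>A conic through five points: 5 conditions on 6 coefficients.\<close>
      using fat_space_product_of_curves[OF that, of 0 2 1 6 u] by (simp add: choose_two)
    have 0: "2 * ((2 * e + 1) choose 2) = (2 * e + 1) * (2 * e)" by (simp add: choose_two)
    then show "6 * ((2 * e + 1) choose 2) < (5 * e + 2) choose 2"
      using choose_two_mult[of "5 * e"] by (simp add: algebra_simps)
    \<comment> \<open>The excess over the expected dimension is (s+2 choose 2) for each of the six
      conics, independently of \<open>e\<close>.\<close>
    have "2 * (((12 * (s + 2) + 5 * e + 2) choose 2) + 6 * ((2 * e + 1) choose 2)) + 6 * (s + 2) * (s + 1) =
        2 * (((5 * e + 2) choose 2) + 6 * ((5 * (s + 2) + 2 * e + 1) choose 2))"
      using choose_two_mult[of "12 * (s + 2) + 5 * e"] choose_two_mult[of "5 * (s + 2) + 2 * e - 1"]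
        choose_two_mult[of "5 * e"] 0
      by (simp add: algebra_simps)
    then show "((12 * (s + 2) + 5 * e + 2) choose 2) + 6 * ((2 * e + 1) choose 2) <
        ((5 * e + 2) choose 2) + 6 * ((5 * (s + 2) + 2 * e + 1) choose 2)" by simp
  qed (use se in auto)
next
  assume n: "n = 7" and t: "140 \<le> t"
  obtain j where j: "t = 140 + j" using le_Suc_ex[OF t] by blast
  have "52 \<le> 113 + j" by simp
  \<comment> \<open>Here 13 = 21 - 8 and 5 = 8 - 3, and 113 = 140 - 2 * 13 - 1 reserves two copies
    of \<open>E\<close>.\<close>
  then obtain s e where "113 + j = 13 * s + 5 * e" using sums_of_13_and_5 by blast
  then have se: "t = 13 * (s + 2) + 5 * e + 1" using j by presburger
  show ?thesis
    unfolding n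
  proof (rule generic_failure[where c = 21 and d = 8 and \<mu> = 8 and \<nu> = 3 and e = e and s = "s + 2"])
    show "\<exists>E\<in>fat_space h u {..<7} 21 (\<lambda>_. 8). E \<noteq> 0" if "\<exists>v. h v \<noteq> 0" for h :: "4 \<Rightarrow> 'a" and u
      \<comment> \<open>A cubic with one double and six simple points: 3 + 6 conditions on 10
        coefficients.\<close>
      using fat_space_product_of_curves[OF that, of 2 3 1 7 u] by (simp add: choose_two)
    have 0: "2 * ((3 * e + 1) choose 2) = (3 * e + 1) * (3 * e)" by (simp add: choose_two)
    then show "7 * ((3 * e + 1) choose 2) < (8 * e + 2) choose 2"
      using choose_two_mult[of "8 * e"] by (simp add: algebra_simps)
    have "2 * (((21 * (s + 2) + 8 * e + 2) choose 2) + 7 * ((3 * e + 1) choose 2)) + 7 * (s + 2) * (s + 1) =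
        2 * (((8 * e + 2) choose 2) + 7 * ((8 * (s + 2) + 3 * e + 1) choose 2))"
      using choose_two_mult[of "21 * (s + 2) + 8 * e"] choose_two_mult[of "8 * (s + 2) + 3 * e - 1"]
        choose_two_mult[of "8 * e"] 0
      by (simp add: algebra_simps)
    then show "((21 * (s + 2) + 8 * e + 2) choose 2) + 7 * ((3 * e + 1) choose 2) <
        ((8 * e + 2) choose 2) + 7 * ((8 * (s + 2) + 3 * e + 1) choose 2)" by simp
  qed (use se in auto)
next
  assume n: "n = 8" and t: "704 \<le> t"
  obtain j where j: "t = 704 + j" using le_Suc_ex[OF t] by blast
  have "310 \<le> 641 + j" by simp
  \<comment> \<open>Here 31 = 48 - 17 and 11 = 17 - 6, and 641 = 704 - 2 * 31 - 1.\<close>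
  then obtain s e where "641 + j = 31 * s + 11 * e" using sums_of_31_and_11 by blast
  then have se: "t = 31 * (s + 2) + 11 * e + 1" using j by presburger
  show ?thesis
    unfolding n
  proof (rule generic_failure[where c = 48 and d = 17 and \<mu> = 17 and \<nu> = 6 and e = e and s = "s + 2"])
    show "\<exists>E\<in>fat_space h u {..<8} 48 (\<lambda>_. 17). E \<noteq> 0" if "\<exists>v. h v \<noteq> 0" for h :: "4 \<Rightarrow> 'a" and u
      \<comment> \<open>A sextic with one triple and seven double points: 6 + 7 * 3 conditions on 28
        coefficients.\<close>
      using fat_space_product_of_curves[OF that, of 3 6 2 8 u] by (simp add: choose_two)
    have 0: "2 * ((6 * e + 1) choose 2) = (6 * e + 1) * (6 * e)" by (simp add: choose_two)
    then show "8 * ((6 * e + 1) choose 2) < (17 * e + 2) choose 2"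
      using choose_two_mult[of "17 * e"] by (simp add: algebra_simps)
    have "2 * (((48 * (s + 2) + 17 * e + 2) choose 2) + 8 * ((6 * e + 1) choose 2)) + 8 * (s + 2) * (s + 1) =
        2 * (((17 * e + 2) choose 2) + 8 * ((17 * (s + 2) + 6 * e + 1) choose 2))"
      using choose_two_mult[of "48 * (s + 2) + 17 * e"] choose_two_mult[of "17 * (s + 2) + 6 * e - 1"]
        choose_two_mult[of "17 * e"] 0
      by (simp add: algebra_simps)
    then show "((48 * (s + 2) + 17 * e + 2) choose 2) + 8 * ((6 * e + 1) choose 2) <
        ((17 * e + 2) choose 2) + 8 * ((17 * (s + 2) + 6 * e + 1) choose 2)" by simp
  qed (use se in auto)
qed

end
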